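(* Let $m\le\beta\le\ell$ and suppose that $K(\beta)$ is diagonalizable with eigendecomposition $K(\beta)=X\Lambda X^{-1}$; put $\kappa_X=\|X\|\,\|X^{-1}\|$. Then GMRES-accelerated ADMM generates the iterate $u^{(k)}=[x^{(k)};z^{(k)};y^{(k)}]$ at the $k$-th iteration that satisfies $$\frac{\|Mu^{(k)}-r\|}{\|Mu^{(0)}-r\|}\le 2\,c_1\,\kappa_P\,\kappa_X\left(\frac{\kappa^{2/3}}{\kappa^{2/3}+1}\right)^{0.209\,k},$$ where $\kappa=\ell/m$, $c_1=c_1(\beta)$ and $\kappa_P=\kappa_P(\beta)$; the factors $c_1,\kappa_P$ are polynomial in $\beta$ (i.e. for fixed $A,B,D$ they are polynomially bounded in terms of $\beta$ over this range).
   Context: $\|\cdot\|$ is the Euclidean vector norm and the induced spectral matrix norm. Data: $A\in\mathbb{R}^{n_y\times n_x}$ with $AA^T$ invertible, $B\in\mathbb{R}^{n_y\times n_z}$ with $B^TB$ invertible, $D\in\mathbb{R}^{n_x\times n_x}$ symmetric positive definite, $r\in\mathbb{R}^{n_x+n_z+n_y}$, and $$M=\begin{bmatrix} D & 0 & A^T \\ 0 & 0 & B^T \\ A & B & 0 \end{bmatrix}.$$ Put $\tilde D=(AD^{-1}A^T)^{-1}$, $m=\lambda_{\min}(\tilde D)$, $\ell=\lambda_{\max}(\tilde D)$, $\kappa=\ell/m$. Here $\beta>0$ is the ADMM parameter. The ADMM preconditioner is $$P_{\mathrm{AD}}(\beta)=\begin{bmatrix} D & -\beta A^TB & A^T \\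 0 & 0 & B^T \\ A & B & -\frac1\beta I \end{bmatrix}$$ (invertible), $\kappa_P(\beta)=\|P_{\mathrm{AD}}(\beta)\|\,\|P_{\mathrm{AD}}^{-1}(\beta)\|$, and the ADMM iteration matrix is $G_{\mathrm{AD}}(\beta)=I-P_{\mathrm{AD}}^{-1}(\beta)M$. Let $B=QR$ be a QR decomposition with $Q\in\mathbb{R}^{n_y\times n_z}$ having orthonormal columns and $R\in\mathbb{R}^{n_z\times n_z}$, and let $P\in\mathbb{R}^{n_y\times(n_y-n_z)}$ be such that $[Q\ P]$ is orthogonal. Let $S(\beta)=\mathrm{blkdiag}(\beta I_{n_x},\beta R,I_{n_y-n_z},I_{n_z})$, $c_1(\beta)=\|S(\beta)\|\,\|S^{-1}(\beta)\|\,\|G_{\mathrm{AD}}(\beta)\|^2$, and $$K(\beta)=\begin{bmatrix} Q^T \\ -P^T \end{bmatrix}\left[(\beta^{-1}\tilde D+I)^{-1}-(\beta\tilde D^{-1}+I)^{-1}\right]\begin{bmatrix} Q & P \end{bmatrix}.$$ GMRES-accelerated ADMM (exact arithmetic) from an arbitrary initial point $u^{(0)}$ with $Mu^{(0)}\ne r$ means either of two methods (the statement is for both). Let $\mathcal{K}_k=\mathrm{span}\{(P_{\mathrm{AD}}^{-1}M)^jP_{\mathrm{AD}}^{-1}(r-Mu^{(0)}):0\le j<k\}$. Left-preconditioned: $u^{(k)}$ minimizes $\|P_{\mathrm{AD}}^{-1}(Mu-r)\|$ over $u\in u^{(0)}+\mathcal{K}_k$ (GMRES applied to $P_{\mathrm{AD}}^{-1}(Mu-r)=0$).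 Right-preconditioned: $u^{(k)}$ minimizes $\|Mu-r\|$ over $u\in u^{(0)}+\mathcal{K}_k$ (GMRES applied to $MP_{\mathrm{AD}}^{-1}\hat u-r=0$, with $u=P_{\mathrm{AD}}^{-1}\hat u$). *)

theory Defs
  imports
    "HOL-Analysis.L2_Norm"
    "Jordan_Normal_Form.Gauss_Jordan_Elimination"
    "Jordan_Normal_Form.Spectral_Radius"
    "Jordan_Normal_Form.VS_Connect"
begin

definition append_cols :: "'a :: zero mat \<Rightarrow> 'a mat \<Rightarrow> 'a mat" (infixr "@\<^sub>c" 66) where
  "A @\<^sub>c B = four_block_mat A B (0\<^sub>m 0 (dim_col A)) (0\<^sub>m 0 (dim_col B))"

text \<open>Only meaningful for invertible matrices; otherwise the value is unspecified.\<close>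

definition mat_inv :: "'a :: field mat \<Rightarrow> 'a mat" where
  "mat_inv A = the (mat_inverse A)"

definition vec_norm2 :: "'a :: real_normed_field vec \<Rightarrow> real" where
  "vec_norm2 v = L2_set (\<lambda>i. norm (v $ i)) {..<dim_vec v}"

text \<open>The supremum is over the vectors of the field of the entries. It is taken over the closed
  unit ball, and not the sphere, so that matrices without columns have norm 0.\<close>

definition mat_norm2 :: "'a :: real_normed_field mat \<Rightarrow> real" where
  "mat_norm2 A = Sup {vec_norm2 (A *\<^sub>v v) | v. v \<in> carrier_vec (dim_col A) \<and> vec_norm2 v \<le> 1}"

definition cond2 :: "'a :: real_normed_field mat \<Rightarrow> real" where
  "cond2 A = mat_norm2 A * mat_norm2 (mat_inv A)"

definition sym_pos_def :: "real mat \<Rightarrow> bool" where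
  "sym_pos_def D \<longleftrightarrow> square_mat D \<and> D\<^sup>T = D \<and>
     (\<forall>v \<in> carrier_vec (dim_row D). v \<noteq> 0\<^sub>v (dim_row D) \<longrightarrow> 0 < v \<bullet> (D *\<^sub>v v))"

text \<open>The library constant \<^const>\<open>orthogonal_mat\<close> does not require columns of length one.\<close>

definition orthonormal_cols :: "real mat \<Rightarrow> bool" where
  "orthonormal_cols Q \<longleftrightarrow> Q\<^sup>T * Q = 1\<^sub>m (dim_col Q)"

definition qr_decomposition :: "real mat \<Rightarrow> real mat \<Rightarrow> real mat \<Rightarrow> bool" where
  "qr_decomposition B Q R \<longleftrightarrow>
     Q \<in> carrier_mat (dim_row B) (dim_col B) \<and> R \<in> carrier_mat (dim_col B) (dim_col B) \<and>
     orthonormal_cols Q \<and> upper_triangular R \<and> B = Q * R"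

definition orthogonal_completion :: "real mat \<Rightarrow> real mat \<Rightarrow> bool" where
  "orthogonal_completion Q P \<longleftrightarrow>
     P \<in> carrier_mat (dim_row Q) (dim_row Q - dim_col Q) \<and>
     square_mat (Q @\<^sub>c P) \<and> orthonormal_cols (Q @\<^sub>c P)"

definition eigendecomposition :: "complex mat \<Rightarrow> complex mat \<Rightarrow> complex mat \<Rightarrow> bool" where
  "eigendecomposition K X \<Lambda> \<longleftrightarrow> diagonal_mat \<Lambda> \<and> similar_mat_wit K \<Lambda> X (mat_inv X)"

text \<open>In what follows \<open>A\<close> is \<open>ny \<times> nx\<close>, \<open>B\<close> is \<open>ny \<times> nz\<close> and \<open>D\<close> is \<open>nx \<times> nx\<close>; vectors are
  stacked in the order \<open>x\<close> (\<open>nx\<close>), \<open>z\<close> (\<open>nz\<close>), \<open>y\<close> (\<open>ny\<close>).\<close>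

definition kkt_mat :: "real mat \<Rightarrow> real mat \<Rightarrow> real mat \<Rightarrow> real mat" where
  "kkt_mat A B D = (let nx = dim_col A; nz = dim_col B; ny = dim_row A in
     (D         @\<^sub>c 0\<^sub>m nx nz @\<^sub>c A\<^sup>T) @\<^sub>r
     (0\<^sub>m nz nx @\<^sub>c 0\<^sub>m nz nz @\<^sub>c B\<^sup>T) @\<^sub>r
     (A         @\<^sub>c B         @\<^sub>c 0\<^sub>m ny ny))"

definition admm_precond :: "real mat \<Rightarrow> real mat \<Rightarrow> real mat \<Rightarrow> real \<Rightarrow> real mat" where
  "admm_precond A B D \<beta> = (let nx = dim_col A; nz = dim_col B; ny = dim_row A in
     (D         @\<^sub>c ((- \<beta>) \<cdot>\<^sub>m (A\<^sup>T * B)) @\<^sub>c A\<^sup>T) @\<^sub>r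
     (0\<^sub>m nz nx @\<^sub>c 0\<^sub>m nz nz              @\<^sub>c B\<^sup>T) @\<^sub>r
     (A         @\<^sub>c B                      @\<^sub>c ((- (1 / \<beta>)) \<cdot>\<^sub>m 1\<^sub>m ny)))"

definition admm_iter_mat :: "real mat \<Rightarrow> real mat \<Rightarrow> real mat \<Rightarrow> real \<Rightarrow> real mat" where
  "admm_iter_mat A B D \<beta> = 1\<^sub>m (dim_col A + dim_col B + dim_row A)
     - mat_inv (admm_precond A B D \<beta>) * kkt_mat A B D"

definition D_tilde :: "real mat \<Rightarrow> real mat \<Rightarrow> real mat" where
  "D_tilde A D = mat_inv (A * mat_inv D * A\<^sup>T)"

definition lambda_min :: "real mat \<Rightarrow> real" where
  "lambda_min H = Min (spectrum H)"

definition lambda_max :: "real mat \<Rightarrow> real" where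
  "lambda_max H = Max (spectrum H)"

definition scaling_mat :: "real mat \<Rightarrow> real mat \<Rightarrow> real mat \<Rightarrow> real \<Rightarrow> real mat" where
  "scaling_mat A B R \<beta> = (let nx = dim_col A; nz = dim_col B; ny = dim_row A in
     diag_block_mat [\<beta> \<cdot>\<^sub>m 1\<^sub>m nx, \<beta> \<cdot>\<^sub>m R, 1\<^sub>m (ny - nz), 1\<^sub>m nz])"

definition c1_factor :: "real mat \<Rightarrow> real mat \<Rightarrow> real mat \<Rightarrow> real mat \<Rightarrow> real \<Rightarrow> real" where
  "c1_factor A B D R \<beta> = cond2 (scaling_mat A B R \<beta>) * (mat_norm2 (admm_iter_mat A B D \<beta>))\<^sup>2"

definition K_mat :: "real mat \<Rightarrow> real mat \<Rightarrow> real mat \<Rightarrow> real mat \<Rightarrow> real \<Rightarrow> real mat" where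
  "K_mat A D Q P \<beta> = (let I = 1\<^sub>m (dim_row A) in
     (Q\<^sup>T @\<^sub>r (- P\<^sup>T))
     * (mat_inv ((1 / \<beta>) \<cdot>\<^sub>m D_tilde A D + I) - mat_inv (\<beta> \<cdot>\<^sub>m mat_inv (D_tilde A D) + I))
     * (Q @\<^sub>c P))"

definition krylov_space :: "real mat \<Rightarrow> real vec \<Rightarrow> nat \<Rightarrow> real vec set" where
  "krylov_space W v k =
     module.span class_ring (module_vec TYPE(real) (dim_row W)) {(W ^\<^sub>m j) *\<^sub>v v | j. j < k}"

definition gmres_search_space ::
    "real mat \<Rightarrow> real mat \<Rightarrow> real vec \<Rightarrow> real vec \<Rightarrow> nat \<Rightarrow> real vec set" where
  "gmres_search_space Pre M r u0 k =
     {u0 + d | d. d \<in> krylov_space (mat_inv Pre * M) (mat_inv Pre *\<^sub>v (r - M *\<^sub>v u0)) k}"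

definition gmres_left_iterate ::
    "real mat \<Rightarrow> real mat \<Rightarrow> real vec \<Rightarrow> real vec \<Rightarrow> nat \<Rightarrow> real vec \<Rightarrow> bool" where
  "gmres_left_iterate Pre M r u0 k u \<longleftrightarrow>
     is_arg_min (\<lambda>v. vec_norm2 (mat_inv Pre *\<^sub>v (M *\<^sub>v v - r)))
       (\<lambda>v. v \<in> gmres_search_space Pre M r u0 k) u"

definition gmres_right_iterate ::
    "real mat \<Rightarrow> real mat \<Rightarrow> real vec \<Rightarrow> real vec \<Rightarrow> nat \<Rightarrow> real vec \<Rightarrow> bool" where
  "gmres_right_iterate Pre M r u0 k u \<longleftrightarrow>
     is_arg_min (\<lambda>v. vec_norm2 (M *\<^sub>v v - r))
       (\<lambda>v. v \<in> gmres_search_space Pre M r u0 k) u"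

end

theory Submission
  imports Defs
begin

text \<open>A GMRES residual is bounded by \<open>\<parallel>p(G)\<parallel>\<close> for every polynomial \<open>p\<close> of degree at most \<open>k\<close> with
  \<open>p(1) = 1\<close>, where \<open>G\<close> is the ADMM iteration matrix. On its range \<open>G\<close> is similar to \<open>(I + K) / 2\<close>, so
  that \<open>p(z) = z\<^sup>2 q(z)\<close> gives \<open>\<parallel>p(G)\<parallel> \<le> c\<^sub>1 \<parallel>q((I + K) / 2)\<parallel>\<close>, and \<open>q\<close> only has to be small at the
  eigenvalues \<open>\<lambda>\<close> of \<open>K\<close>. With \<open>D\<^sub>t = (A D\<inverse> A\<^sup>T)\<inverse>\<close> and \<open>H = (\<beta> I - D\<^sub>t) (\<beta> I + D\<^sub>t)\<inverse>\<close>, whose spectrum lies in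
  \<open>[-\<gamma>\<^sub>1, \<gamma>\<^sub>2]\<close> with \<open>\<gamma>\<^sub>1 = (l - \<beta>) / (l + \<beta>)\<close> and \<open>\<gamma>\<^sub>2 = (\<beta> - m) / (\<beta> + m)\<close>, the matrix \<open>K\<close> is
  \<open>J U\<^sup>T H U\<close> with \<open>U\<close> orthogonal and \<open>J = diag(I, -I)\<close>. This structure forces
  \<open>\<bar>\<lambda>\<bar> \<le> max \<gamma>\<^sub>1 \<gamma>\<^sub>2\<close>, and \<open>\<bar>\<lambda>\<bar>\<^sup>2 \<le> \<gamma>\<^sub>1 \<gamma>\<^sub>2\<close> for the nonreal ones. A suitable product of
  a power and a Chebyshev polynomial is small on the resulting disk with two real whiskers. For
  \<open>k = 1\<close>, where there is no room for \<open>z\<^sup>2\<close>, the polynomial \<open>p(z) = z\<close> suffices. The factors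
  \<open>c\<^sub>1\<close> and \<open>\<kappa>\<^sub>P\<close> are bounded because \<open>\<beta>\<close> ranges over a compact interval, so constant polynomials
  will do.\<close>

section \<open>Norms and inverses\<close>

text \<open>The obstacle is that K is not symmetric: Chebyshev polynomials would be the choice for
  real eigenvalues, but off the segment they grow exponentially in their degree. The exponent 2/3 is
  the balance of two strategies. Let t = max (\<beta>/m) (l/\<beta>). The power \<lambda>^N decays
  like exp(-2N/t), which is good for small t. The nonreal \<lambda> lie in a disk of radius at most
  about exp(-t/(2\<kappa>)), so nearly N factors \<lambda> pay for a Chebyshev polynomial whose
  degree j is of order N t/\<kappa>; its decay exp(-2j/sqrt t) on the segment then has an exponent
  of order N sqrt t/\<kappa>. The exponents N/t and N sqrt t/\<kappa> meet at t = \<kappa> powr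
  (2/3), where both are of order N / \<kappa> powr (2/3). As the first decreases in t and the second
  increases, this is the worst case. All estimates are made with exp(-0.209 N / \<kappa> powr
  (2/3)), which is at most the claimed power of the rate.\<close>

lemma vec_norm2_nonneg [simp]: "0 \<le> vec_norm2 v"
  by (simp add: vec_norm2_def L2_set_nonneg)

lemma vec_norm2_power2: "(vec_norm2 v)\<^sup>2 = (\<Sum>i<dim_vec v. (norm (v $ i))\<^sup>2)"
  by (simp add: vec_norm2_def L2_set_def sum_nonneg)

lemma vec_norm2_zero [simp]: "vec_norm2 (0\<^sub>v n) = 0"
  by (simp add: vec_norm2_def L2_set_eq_0_iff)

lemma vec_norm2_eq_0_iff: "vec_norm2 v = 0 \<longleftrightarrow> v = 0\<^sub>v (dim_vec v)"
proof
  assume "vec_norm2 v = 0"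
  thus "v = 0\<^sub>v (dim_vec v)" by (auto simp: vec_norm2_def L2_set_eq_0_iff)
next
  assume "v = 0\<^sub>v (dim_vec v)"
  thus "vec_norm2 v = 0" by (metis vec_norm2_zero)
qed

lemma vec_norm2_pos: "v \<in> carrier_vec n \<Longrightarrow> v \<noteq> 0\<^sub>v n \<Longrightarrow> 0 < vec_norm2 v"
  using vec_norm2_eq_0_iff[of v] vec_norm2_nonneg[of v] by (metis carrier_vecD order_le_less)

lemma vec_norm2_smult: "vec_norm2 (c \<cdot>\<^sub>v v) = norm c * vec_norm2 v"
  by (auto simp: vec_norm2_def norm_mult L2_set_right_distrib intro!: L2_set_cong)

lemma vec_norm2_uminus [simp]: "vec_norm2 (- v) = vec_norm2 v"
  by (auto simp: vec_norm2_def intro!: L2_set_cong)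

lemma vec_norm2_triangle:
  assumes "v \<in> carrier_vec n" "w \<in> carrier_vec n"
  shows "vec_norm2 (v + w) \<le> vec_norm2 v + vec_norm2 w"
proof -
  have "vec_norm2 (v + w) \<le> L2_set (\<lambda>i. norm (v $ i) + norm (w $ i)) {..<n}"
    using assms unfolding vec_norm2_def by (auto intro!: L2_set_mono norm_triangle_ineq)
  also have "\<dots> \<le> vec_norm2 v + vec_norm2 w"
    using assms L2_set_triangle_ineq[of "\<lambda>i. norm (v $ i)" "\<lambda>i. norm (w $ i)" "{..<n}"]
    by (simp add: vec_norm2_def)
  finally show ?thesis .
qed

lemma vec_norm2_minus_commute:
  "v \<in> carrier_vec n \<Longrightarrow> w \<in> carrier_vec n \<Longrightarrow> vec_norm2 (v - w) = vec_norm2 (w - v)"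
  by (auto simp: vec_norm2_def norm_minus_commute intro!: L2_set_cong)

lemma vec_norm2_append: "(vec_norm2 (v @\<^sub>v w))\<^sup>2 = (vec_norm2 v)\<^sup>2 + (vec_norm2 w)\<^sup>2"
proof -
  have "(\<Sum>i<dim_vec v + k. (norm ((v @\<^sub>v w) $ i))\<^sup>2)
      = (\<Sum>i<dim_vec v. (norm (v $ i))\<^sup>2) + (\<Sum>i<k. (norm (w $ i))\<^sup>2)"
    if "k \<le> dim_vec w" for k
    using that by (induction k) auto
  from this[of "dim_vec w"] show ?thesis by (simp add: vec_norm2_power2)
qed

lemma vec_norm2_of_real: "vec_norm2 (map_vec complex_of_real v) = vec_norm2 v"
  by (auto simp: vec_norm2_def intro!: L2_set_cong)

lemma vec_norm2_real: "(vec_norm2 v)\<^sup>2 = v \<bullet> v" for v :: "real vec"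
  unfolding vec_norm2_power2 by (simp add: scalar_prod_def lessThan_atLeast0 power2_eq_square)

lemma vec_Cauchy_Schwarz:
  fixes v w :: "real vec"
  assumes "v \<in> carrier_vec n" "w \<in> carrier_vec n"
  shows "\<bar>v \<bullet> w\<bar> \<le> vec_norm2 v * vec_norm2 w"
proof -
  have "\<bar>v \<bullet> w\<bar> \<le> (\<Sum>i<n. \<bar>v $ i\<bar> * \<bar>w $ i\<bar>)"
    using assms by (auto simp: scalar_prod_def lessThan_atLeast0 abs_mult[symmetric]
      intro: order_trans[OF sum_abs])
  also have "\<dots> \<le> vec_norm2 v * vec_norm2 w"
    using assms L2_set_mult_ineq[of "\<lambda>i. \<bar>v $ i\<bar>" "\<lambda>i. \<bar>w $ i\<bar>" "{..<n}"]
    by (simp add: vec_norm2_def)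
  finally show ?thesis .
qed

text \<open>A crude upper bound for the spectral norm. It shows that the supremum in
  \<open>mat_norm2\<close> is over a bounded set, and since it is continuous in the entries it later
  gives bounds that are uniform in \<beta>.\<close>

definition entry_sum :: "'a :: real_normed_field mat \<Rightarrow> real" where
  "entry_sum A = (\<Sum>i<dim_row A. \<Sum>j<dim_col A. norm (A $$ (i, j)))"

lemma norm_component_le: "i < dim_vec v \<Longrightarrow> norm (v $ i) \<le> vec_norm2 v"
  unfolding vec_norm2_def by (rule member_le_L2_set) auto

lemma vec_norm2_le_sum: "vec_norm2 v \<le> (\<Sum>i<dim_vec v. norm (v $ i))"
  unfolding vec_norm2_def by (rule L2_set_le_sum) auto

lemma vec_norm2_mult_entry_sum:
  assumes "v \<in> carrier_vec (dim_col A)"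
  shows "vec_norm2 (A *\<^sub>v v) \<le> entry_sum A * vec_norm2 v"
proof -
  have "vec_norm2 (A *\<^sub>v v) \<le> (\<Sum>i<dim_row A. norm ((A *\<^sub>v v) $ i))"
    using vec_norm2_le_sum[of "A *\<^sub>v v"] by simp
  also have "\<dots> \<le> (\<Sum>i<dim_row A. \<Sum>j<dim_col A. norm (A $$ (i, j)) * vec_norm2 v)"
  proof (rule sum_mono)
    fix i assume "i \<in> {..<dim_row A}"
    hence "(A *\<^sub>v v) $ i = (\<Sum>j<dim_col A. A $$ (i, j) * v $ j)"
      using assms by (simp add: mult_mat_vec_def scalar_prod_def lessThan_atLeast0)
    also have "norm \<dots> \<le> (\<Sum>j<dim_col A. norm (A $$ (i, j)) * vec_norm2 v)"
      using assms by (intro sum_norm_le)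
        (auto simp: norm_mult intro!: mult_left_mono norm_component_le)
    finally show "norm ((A *\<^sub>v v) $ i) \<le> (\<Sum>j<dim_col A. norm (A $$ (i, j)) * vec_norm2 v)" .
  qed
  also have "\<dots> = entry_sum A * vec_norm2 v"
    by (simp add: entry_sum_def sum_distrib_right)
  finally show ?thesis .
qed

lemma entry_sum_nonneg: "0 \<le> entry_sum A"
  by (auto simp: entry_sum_def intro!: sum_nonneg)

lemma mat_norm2_bdd:
  "bdd_above {vec_norm2 (A *\<^sub>v v) | v. v \<in> carrier_vec (dim_col A) \<and> vec_norm2 v \<le> 1}"
proof (rule bdd_aboveI)
  fix x assume "x \<in> {vec_norm2 (A *\<^sub>v v) | v. v \<in> carrier_vec (dim_col A) \<and> vec_norm2 v \<le> 1}"
  then obtain v where "x = vec_norm2 (A *\<^sub>v v)" "v \<in> carrier_vec (dim_col A)" "vec_norm2 v \<le> 1"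
    by blast
  thus "x \<le> entry_sum A"
    using vec_norm2_mult_entry_sum[of v A] mult_left_mono[of "vec_norm2 v" 1 "entry_sum A"]
      entry_sum_nonneg[of A] by simp
qed

lemma mat_norm2_nonneg [simp]: "0 \<le> mat_norm2 A"
  unfolding mat_norm2_def
  by (rule cSup_upper2[OF _ _ mat_norm2_bdd, of "vec_norm2 (A *\<^sub>v 0\<^sub>v (dim_col A))"])
     (auto intro: exI[of _ "0\<^sub>v (dim_col A)"])

lemma vec_norm2_mult_le:
  assumes A: "A \<in> carrier_mat n k" and v: "v \<in> carrier_vec k"
  shows "vec_norm2 (A *\<^sub>v v) \<le> mat_norm2 A * vec_norm2 v"
proof (cases "v = 0\<^sub>v k")
  case True
  hence "A *\<^sub>v v = 0\<^sub>v n" using A by (auto intro!: eq_vecI)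
  thus ?thesis by simp
next
  case False
  hence pos: "0 < vec_norm2 v" using v by (simp add: vec_norm2_pos)
  let ?w = "of_real (1 / vec_norm2 v) \<cdot>\<^sub>v v"
  have "vec_norm2 (A *\<^sub>v ?w) \<le> mat_norm2 A"
    unfolding mat_norm2_def using A v pos
    by (intro cSup_upper[OF _ mat_norm2_bdd]) (auto simp: vec_norm2_smult norm_divide intro!: exI[of _ ?w])
  moreover have "A *\<^sub>v ?w = of_real (1 / vec_norm2 v) \<cdot>\<^sub>v (A *\<^sub>v v)"
    using A v by (simp add: mult_mat_vec)
  ultimately show ?thesis using pos by (simp add: vec_norm2_smult norm_divide field_simps)
qed

lemma mat_norm2_le:
  assumes "A \<in> carrier_mat n k" "0 \<le> c"
    and "\<And>v. v \<in> carrier_vec k \<Longrightarrow> vec_norm2 (A *\<^sub>v v) \<le> c * vec_norm2 v"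
  shows "mat_norm2 A \<le> c"
  unfolding mat_norm2_def
proof (rule cSup_least)
  show "{vec_norm2 (A *\<^sub>v v) |v. v \<in> carrier_vec (dim_col A) \<and> vec_norm2 v \<le> 1} \<noteq> {}"
    by (auto intro: exI[of _ "0\<^sub>v (dim_col A)"])
next
  fix x assume "x \<in> {vec_norm2 (A *\<^sub>v v) |v. v \<in> carrier_vec (dim_col A) \<and> vec_norm2 v \<le> 1}"
  then obtain v where v: "x = vec_norm2 (A *\<^sub>v v)" "v \<in> carrier_vec k" "vec_norm2 v \<le> 1"
    using assms(1) by auto
  show "x \<le> c"
    using assms(2) assms(3)[OF v(2)] v mult_left_mono[OF v(3) assms(2)] by simp
qed

lemma mat_norm2_mult:
  assumes A: "A \<in> carrier_mat n k" and B: "B \<in> carrier_mat k l"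
  shows "mat_norm2 (A * B) \<le> mat_norm2 A * mat_norm2 B"
proof (rule mat_norm2_le)
  show "A * B \<in> carrier_mat n l" using A B by simp
  show "0 \<le> mat_norm2 A * mat_norm2 B" by simp
  fix v :: "'a vec" assume v: "v \<in> carrier_vec l"
  have "vec_norm2 (A * B *\<^sub>v v) = vec_norm2 (A *\<^sub>v (B *\<^sub>v v))"
    using A B v by simp
  also have "\<dots> \<le> mat_norm2 A * vec_norm2 (B *\<^sub>v v)"
    using A B v by (intro vec_norm2_mult_le) auto
  also have "\<dots> \<le> mat_norm2 A * (mat_norm2 B * vec_norm2 v)"
    using B v by (intro mult_left_mono vec_norm2_mult_le) auto
  finally show "vec_norm2 (A * B *\<^sub>v v) \<le> mat_norm2 A * mat_norm2 B * vec_norm2 v"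
    by (simp add: mult_ac)
qed

lemma mat_norm2_le_entry_sum: "mat_norm2 A \<le> entry_sum A"
  by (rule mat_norm2_le[OF carrier_matI[OF refl refl]]) (auto simp: entry_sum_nonneg vec_norm2_mult_entry_sum)

lemma mat_norm2_one: "0 < n \<Longrightarrow> 1 \<le> mat_norm2 (1\<^sub>m n :: 'a :: real_normed_field mat)"
proof -
  assume n: "0 < n"
  have e: "(unit_vec n 0 :: 'a vec) \<noteq> 0\<^sub>v n"
    using n by (metis index_unit_vec(1) index_zero_vec(1) zero_neq_one)
  have "vec_norm2 (unit_vec n 0 :: 'a vec) \<le> mat_norm2 (1\<^sub>m n :: 'a mat) * vec_norm2 (unit_vec n 0 :: 'a vec)"
    using vec_norm2_mult_le[of "1\<^sub>m n :: 'a mat" n n "unit_vec n 0"] by simp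
  moreover have "0 < vec_norm2 (unit_vec n 0 :: 'a vec)" using e by (intro vec_norm2_pos) auto
  ultimately show ?thesis by simp
qed

text \<open>A left inverse of a square matrix is two-sided, so A is a unit of the matrix ring and
  \<open>mat_inverse\<close> succeeds; uniqueness of inverses identifies its result with B.\<close>

lemma mat_invI:
  assumes A: "A \<in> carrier_mat n n" and B: "B \<in> carrier_mat n n" and BA: "B * A = 1\<^sub>m n"
  shows "mat_inv A = B"
proof -
  have AB: "A * B = 1\<^sub>m n" using mat_mult_left_right_inverse[OF B A BA] .
  have "A \<in> Units (ring_mat TYPE('a) n undefined)"
    using A B AB BA by (auto simp: Units_def ring_mat_simps)
  then obtain C where C: "mat_inverse A = Some C"
    using mat_inverse(1)[OF A, of undefined] by (cases "mat_inverse A") auto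
  hence "A * C = 1\<^sub>m n" "C \<in> carrier_mat n n" using mat_inverse(2)[OF A C] by auto
  moreover have "B * A * C = B * (A * C)" using \<open>C \<in> carrier_mat n n\<close> A B by simp
  ultimately have "C = B" using BA B by simp
  thus ?thesis using C by (simp add: mat_inv_def)
qed

lemma mat_inv_det:
  assumes A: "A \<in> carrier_mat n n" and d: "det A \<noteq> 0"
  shows "mat_inv A \<in> carrier_mat n n" "A * mat_inv A = 1\<^sub>m n" "mat_inv A * A = 1\<^sub>m n"
proof -
  obtain B where B: "B \<in> carrier_mat n n" "B * A = 1\<^sub>m n" "A * B = 1\<^sub>m n"
    using det_non_zero_imp_unit[OF A d, of undefined] by (auto simp: Units_def ring_mat_simps)
  from mat_invI[OF A B(1,2)] B
  show "mat_inv A \<in> carrier_mat n n" "A * mat_inv A = 1\<^sub>m n" "mat_inv A * A = 1\<^sub>m n" by auto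
qed

lemma mat_inv_inj:
  fixes A :: "'a :: field mat"
  assumes A: "A \<in> carrier_mat n n"
    and inj: "\<And>v. v \<in> carrier_vec n \<Longrightarrow> A *\<^sub>v v = 0\<^sub>v n \<Longrightarrow> v = 0\<^sub>v n"
  shows "det A \<noteq> 0"
  using det_0_iff_vec_prod_zero_field[OF A] inj by auto

lemma invertible_mat_det: 
  assumes "A \<in> carrier_mat n n" "invertible_mat (A :: 'a :: field mat)" 
  shows "det A \<noteq> 0"
proof -
  obtain B where B: "A * B = 1\<^sub>m (dim_row A)" "B * A = 1\<^sub>m (dim_row B)"
    using assms(2) unfolding invertible_mat_def inverts_mat_def by blast
  have "dim_col (A * B) = n" "dim_col (B * A) = dim_row B" using assms(1) by (simp_all add: B)
  hence "B \<in> carrier_mat n n" using assms(1) by auto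
  hence "det A * det B = 1" using B(1) assms(1) det_mult[of A n B] by simp
  thus ?thesis by auto
qed

text \<open>The identity A A^-1 has norm at least 1 and the norm is submultiplicative. For n = 0 all
  norms would be 0.\<close>

lemma cond2_ge_1:
  assumes A: "A \<in> carrier_mat n n" and d: "det A \<noteq> 0" and n: "0 < n"
  shows "1 \<le> cond2 A"
  using mat_norm2_one[OF n, where 'a = 'a] mat_norm2_mult[OF A mat_inv_det(1)[OF A d]]
  by (simp add: mat_inv_det(2)[OF A d] cond2_def)

section \<open>Symmetric matrices\<close>

lemma symmetric_scalar_prod:
  fixes S :: "real mat"
  assumes "S \<in> carrier_mat n n" "S\<^sup>T = S" "v \<in> carrier_vec n" "w \<in> carrier_vec n"
  shows "(S *\<^sub>v v) \<bullet> w = v \<bullet> (S *\<^sub>v w)"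
  using transpose_vec_mult_scalar[OF assms(1,4,3)] assms(2) by simp

lemma quadratic_nonneg_discriminant:
  fixes a b c :: real
  assumes c: "0 \<le> c" and *: "\<And>t. 0 \<le> a + 2 * b * t + c * t\<^sup>2"
  shows "b\<^sup>2 \<le> a * c"
proof (cases "c = 0")
  case True
  show ?thesis
  proof (cases "b = 0")
    case False
    \<comment> \<open>At this t the linear function a + 2 b t has the value -1.\<close>
    with *[of "- (a + 1) / (2 * b)"] True show ?thesis by (simp add: field_simps)
  qed (simp add: True)
next
  case False
  with c *[of "- b / c"] have "0 \<le> c * (a + 2 * b * (- b / c) + c * (- b / c)\<^sup>2)" by simp
  also have "\<dots> = a * c - b\<^sup>2" using False by (simp add: field_simps power2_eq_square)
  finally show ?thesis by simp
qed

text \<open>C may be singular, so its form need not be an inner product; nonnegativity along the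
  line v + t w suffices, through the discriminant of the quadratic in t.\<close>

lemma psd_Cauchy_Schwarz:
  fixes C :: "real mat"
  assumes C: "C \<in> carrier_mat n n" "C\<^sup>T = C"
    and psd: "\<And>v. v \<in> carrier_vec n \<Longrightarrow> 0 \<le> v \<bullet> (C *\<^sub>v v)"
    and v: "v \<in> carrier_vec n" and w: "w \<in> carrier_vec n"
  shows "(v \<bullet> (C *\<^sub>v w))\<^sup>2 \<le> (v \<bullet> (C *\<^sub>v v)) * (w \<bullet> (C *\<^sub>v w))"
proof (rule quadratic_nonneg_discriminant[OF psd[OF w]])
  fix t :: real
  have [simp]: "C *\<^sub>v v \<in> carrier_vec n" "C *\<^sub>v w \<in> carrier_vec n" using C(1) v w by auto
  have sym: "w \<bullet> (C *\<^sub>v v) = v \<bullet> (C *\<^sub>v w)"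
    using symmetric_scalar_prod[OF C w v] comm_scalar_prod[of "C *\<^sub>v w" n v] v by simp
  have "0 \<le> (v + t \<cdot>\<^sub>v w) \<bullet> (C *\<^sub>v (v + t \<cdot>\<^sub>v w))" using v w by (intro psd) auto
  also have "C *\<^sub>v (v + t \<cdot>\<^sub>v w) = C *\<^sub>v v + t \<cdot>\<^sub>v (C *\<^sub>v w)"
    using C v w by (simp add: mult_add_distrib_mat_vec[of _ n n] mult_mat_vec)
  also have "(v + t \<cdot>\<^sub>v w) \<bullet> \<dots> = v \<bullet> (C *\<^sub>v v) + 2 * (v \<bullet> (C *\<^sub>v w)) * t + (w \<bullet> (C *\<^sub>v w)) * t\<^sup>2"
    using v w sym by (simp add: scalar_prod_add_distrib[of _ n] add_scalar_prod_distrib[of _ n]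
      power2_eq_square algebra_simps)
  finally show "0 \<le> \<dots>" .
qed

lemma smult_mat_mult_vec:
  assumes "A \<in> carrier_mat n k" "v \<in> carrier_vec k"
  shows "(c \<cdot>\<^sub>m A) *\<^sub>v v = c \<cdot>\<^sub>v (A *\<^sub>v v)"
  using assms by (intro eq_vecI) (auto simp: scalar_prod_def sum_distrib_left mult.assoc)

lemma minus_smult_one_mult_vec:
  fixes S :: "real mat"
  assumes "S \<in> carrier_mat n n" "v \<in> carrier_vec n"
  shows "(S - c \<cdot>\<^sub>m 1\<^sub>m n) *\<^sub>v v = S *\<^sub>v v - c \<cdot>\<^sub>v v"
  using assms by (simp add: minus_mult_distrib_mat_vec[of _ n n] smult_mat_mult_vec[of _ n n])

text \<open>The smallest Rayleigh quotient is an eigenvalue: otherwise the positive semidefinite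
  \<open>S - \<lambda>I\<close> would be invertible, and the Cauchy-Schwarz inequality for its quadratic form, applied
  to \<open>v\<close> and \<open>(S - \<lambda>I)\<inverse>v\<close>, would keep its Rayleigh quotients away from 0.\<close>

lemma symmetric_min_rayleigh_eigenvalue:
  fixes S :: "real mat"
  assumes S: "S \<in> carrier_mat n n" "S\<^sup>T = S" and n: "0 < n"
  obtains e where "eigenvalue S e" "\<And>v. v \<in> carrier_vec n \<Longrightarrow> e * (v \<bullet> v) \<le> v \<bullet> (S *\<^sub>v v)"
proof -
  define rq where "rq = {v \<bullet> (S *\<^sub>v v) | v. v \<in> carrier_vec n \<and> vec_norm2 v = 1}"
  define e where "e = Inf rq"
  have bdd: "bdd_below rq"
  proof (rule bdd_belowI)
    fix x assume "x \<in> rq"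
    then obtain v where v: "x = v \<bullet> (S *\<^sub>v v)" "v \<in> carrier_vec n" "vec_norm2 v = 1"
      by (auto simp: rq_def)
    have "\<bar>x\<bar> \<le> mat_norm2 S"
      using vec_Cauchy_Schwarz[OF v(2), of "S *\<^sub>v v"] vec_norm2_mult_le[OF S(1) v(2)] S v by simp
    thus "- mat_norm2 S \<le> x" by simp
  qed
  have unit: "(1 / vec_norm2 v) \<cdot>\<^sub>v v \<in> carrier_vec n" "vec_norm2 ((1 / vec_norm2 v) \<cdot>\<^sub>v v) = 1"
    if "v \<in> carrier_vec n" "v \<noteq> 0\<^sub>v n" for v :: "real vec"
    using that vec_norm2_pos[OF that] by (auto simp: vec_norm2_smult)
  have ne: "rq \<noteq> {}"
  proof -
    have "unit_vec n 0 \<noteq> (0\<^sub>v n :: real vec)"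
      using n by (metis index_unit_vec(1) index_zero_vec(1) zero_neq_one)
    from unit[OF unit_vec_carrier this] show ?thesis unfolding rq_def by blast
  qed
  have le: "e * (v \<bullet> v) \<le> v \<bullet> (S *\<^sub>v v)" if v: "v \<in> carrier_vec n" for v
  proof (cases "v = 0\<^sub>v n")
    case True
    thus ?thesis using S by simp
  next
    case False
    let ?c = "1 / vec_norm2 v"
    have "(?c \<cdot>\<^sub>v v) \<bullet> (S *\<^sub>v (?c \<cdot>\<^sub>v v)) = (v \<bullet> (S *\<^sub>v v)) / (v \<bullet> v)"
      using S v by (simp add: mult_mat_vec vec_norm2_real[symmetric] power2_eq_square)
    moreover have "(?c \<cdot>\<^sub>v v) \<bullet> (S *\<^sub>v (?c \<cdot>\<^sub>v v)) \<in> rq"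
      using unit[OF v False] by (auto simp: rq_def)
    ultimately have "e \<le> (v \<bullet> (S *\<^sub>v v)) / (v \<bullet> v)"
      unfolding e_def using cInf_lower[OF _ bdd] by simp
    thus ?thesis using vec_norm2_pos[OF v False] by (simp add: vec_norm2_real[symmetric] field_simps)
  qed
  define C where "C = S - e \<cdot>\<^sub>m 1\<^sub>m n"
  have C: "C \<in> carrier_mat n n" "C\<^sup>T = C"
  proof -
    have "(e \<cdot>\<^sub>m 1\<^sub>m n)\<^sup>T = e \<cdot>\<^sub>m (1\<^sub>m n :: real mat)" by (intro eq_matI) auto
    thus "C\<^sup>T = C" using S by (simp add: C_def transpose_minus[of _ n n])
  qed (use S in \<open>auto simp: C_def\<close>)
  have Cv: "C *\<^sub>v v = S *\<^sub>v v - e \<cdot>\<^sub>v v" if "v \<in> carrier_vec n" for v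
    using S that by (simp add: C_def minus_smult_one_mult_vec)
  have vCv: "v \<bullet> (C *\<^sub>v v) = v \<bullet> (S *\<^sub>v v) - e * (v \<bullet> v)" if "v \<in> carrier_vec n" for v
    using S that by (simp add: Cv scalar_prod_minus_distrib[of _ n])
  have psd: "0 \<le> v \<bullet> (C *\<^sub>v v)" if "v \<in> carrier_vec n" for v
    using le[OF that] vCv[OF that] by simp
  have "det C = 0"
  proof (rule ccontr)
    assume d: "det C \<noteq> 0"
    note inv = mat_inv_det[OF C(1) d]
    \<comment> \<open>The summand 1 makes N positive; 1 / N will be a gap between the infimum e and
      all Rayleigh quotients.\<close>
    define N where "N = mat_norm2 (mat_inv C) + 1"
    have N: "0 < N" by (simp add: N_def add_nonneg_pos)
    have "e + 1 / N \<le> x" if xr: "x \<in> rq" for x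
    proof -
      obtain v where v: "x = v \<bullet> (S *\<^sub>v v)" "v \<in> carrier_vec n" "vec_norm2 v = 1"
        using xr by (auto simp: rq_def)
      define y where "y = mat_inv C *\<^sub>v v"
      have y: "y \<in> carrier_vec n" using inv v by (simp add: y_def)
      have Cy: "C *\<^sub>v y = v" unfolding y_def using v inv C by (simp flip: assoc_mult_mat_vec)
      have vv: "v \<bullet> v = 1" using v(3) vec_norm2_real[of v] by simp
      have "y \<bullet> v \<le> vec_norm2 y * vec_norm2 v" using vec_Cauchy_Schwarz[OF y v(2)] by simp
      also have "\<dots> \<le> N" using vec_norm2_mult_le[OF inv(1) v(2)] v(3) by (simp add: y_def N_def)
      finally have yv: "y \<bullet> v \<le> N" .
      have "1 \<le> (v \<bullet> (C *\<^sub>v v)) * (y \<bullet> v)"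
        using psd_Cauchy_Schwarz[OF C psd v(2) y] vv by (simp add: Cy)
      also have "\<dots> \<le> (v \<bullet> (C *\<^sub>v v)) * N" using psd[OF v(2)] yv by (intro mult_left_mono)
      also have "v \<bullet> (C *\<^sub>v v) = x - e" using vCv[OF v(2)] vv v(1) by simp
      finally show ?thesis using N by (simp add: field_simps)
    qed
    hence "e + 1 / N \<le> e" unfolding e_def by (intro cInf_greatest[OF ne]) (simp add: e_def)
    thus False using N by simp
  qed
  then obtain v where v: "v \<in> carrier_vec n" "v \<noteq> 0\<^sub>v n" "C *\<^sub>v v = 0\<^sub>v n"
    using det_0_iff_vec_prod_zero_field[OF C(1)] by auto
  have "S *\<^sub>v v = e \<cdot>\<^sub>v v"
  proof (rule eq_vecI)
    fix i assume i: "i < dim_vec (e \<cdot>\<^sub>v v)"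
    have "(S *\<^sub>v v - e \<cdot>\<^sub>v v) $ i = 0" using v i Cv[OF v(1)] by simp
    thus "(S *\<^sub>v v) $ i = (e \<cdot>\<^sub>v v) $ i" using i S v by simp
  qed (use S v in auto)
  hence "eigenvalue S e" using v S unfolding eigenvalue_def eigenvector_def by auto
  thus ?thesis using le that by blast
qed

lemma lambda_min_le_rayleigh:
  fixes S :: "real mat"
  assumes S: "S \<in> carrier_mat n n" "S\<^sup>T = S" and v: "v \<in> carrier_vec n"
  shows "lambda_min S * (v \<bullet> v) \<le> v \<bullet> (S *\<^sub>v v)"
proof (cases "n = 0")
  \<comment> \<open>The spectrum is empty here and its \<open>Min\<close> unspecified, but both
    sides are 0.\<close>
  case True
  thus ?thesis using S v by (simp add: scalar_prod_def)
next
  case False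
  then obtain e where e: "eigenvalue S e" "e * (v \<bullet> v) \<le> v \<bullet> (S *\<^sub>v v)"
    using symmetric_min_rayleigh_eigenvalue[OF S] v by blast
  have "lambda_min S \<le> e" unfolding lambda_min_def
    using e(1) card_finite_spectrum(1)[OF S(1)] by (intro Min_le) (auto simp: spectrum_def)
  moreover have "0 \<le> v \<bullet> v" by (simp flip: vec_norm2_real)
  ultimately show ?thesis using e(2) mult_right_mono order_trans by blast
qed

text \<open>The least Rayleigh quotient of -S is an eigenvalue of -S; its negative is an eigenvalue
  of S and bounds the quotients of S from above.\<close>

lemma rayleigh_le_lambda_max:
  fixes S :: "real mat"
  assumes S: "S \<in> carrier_mat n n" "S\<^sup>T = S" and v: "v \<in> carrier_vec n"
  shows "v \<bullet> (S *\<^sub>v v) \<le> lambda_max S * (v \<bullet> v)"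
proof (cases "n = 0")
  case True
  thus ?thesis using S v by (simp add: scalar_prod_def)
next
  case False
  have S': "- S \<in> carrier_mat n n" "(- S)\<^sup>T = - S" using S by (auto simp: transpose_uminus)
  obtain e where e: "eigenvalue (- S) e" "e * (v \<bullet> v) \<le> v \<bullet> (- S *\<^sub>v v)"
    using symmetric_min_rayleigh_eigenvalue[OF S'] v False by blast
  then obtain u where u: "u \<in> carrier_vec n" "u \<noteq> 0\<^sub>v n" "- S *\<^sub>v u = e \<cdot>\<^sub>v u"
    using S by (auto simp: eigenvalue_def eigenvector_def)
  have "S *\<^sub>v u = (- e) \<cdot>\<^sub>v u"
  proof -
    have "- (S *\<^sub>v u) = e \<cdot>\<^sub>v u" using S u by simp
    hence "S *\<^sub>v u = - (e \<cdot>\<^sub>v u)" by (metis uminus_uminus_vec)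
    also have "\<dots> = (- e) \<cdot>\<^sub>v u" by (intro eq_vecI) auto
    finally show ?thesis .
  qed
  hence "eigenvalue S (- e)" using u S by (auto simp: eigenvalue_def eigenvector_def)
  hence "- e \<le> lambda_max S" unfolding lambda_max_def
    using card_finite_spectrum(1)[OF S(1)] by (intro Max_ge) (auto simp: spectrum_def)
  moreover have "0 \<le> v \<bullet> v" by (simp flip: vec_norm2_real)
  ultimately have "- e * (v \<bullet> v) \<le> lambda_max S * (v \<bullet> v)" by (rule mult_right_mono)
  thus ?thesis using e(2) S v by simp
qed

text \<open>That is, \<open>(S - m)(l - S)\<close> is positive semidefinite if \<open>m \<le> S \<le> l\<close>. With \<open>C\<^sub>1 = S - m\<close> and
  \<open>C\<^sub>2 = l - S\<close> this is read off \<open>(l - m) C\<^sub>1 C\<^sub>2 = C\<^sub>1 C\<^sub>2 C\<^sub>1 + C\<^sub>2 C\<^sub>1 C\<^sub>2\<close>.\<close>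

lemma symmetric_mult_norm_le:
  fixes S :: "real mat"
  assumes S: "S \<in> carrier_mat n n" "S\<^sup>T = S" and v: "v \<in> carrier_vec n"
    and lo: "\<And>v. v \<in> carrier_vec n \<Longrightarrow> m * (v \<bullet> v) \<le> v \<bullet> (S *\<^sub>v v)"
    and hi: "\<And>v. v \<in> carrier_vec n \<Longrightarrow> v \<bullet> (S *\<^sub>v v) \<le> l * (v \<bullet> v)"
    and ml: "m \<le> l"
  shows "(S *\<^sub>v v) \<bullet> (S *\<^sub>v v) \<le> (l + m) * (v \<bullet> (S *\<^sub>v v)) - l * m * (v \<bullet> v)"
proof -
  define w where "w = S *\<^sub>v v"
  define z where "z = S *\<^sub>v w"
  have c[simp]: "w \<in> carrier_vec n" "z \<in> carrier_vec n" "v \<in> carrier_vec n"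
    using S v by (auto simp: w_def z_def)
  have dims[simp]: "dim_vec v = n" "dim_vec w = n" "dim_vec z = n" using c by auto
  define a where "a = v \<bullet> v"
  define b where "b = v \<bullet> w"
  define cc where "cc = w \<bullet> w"
  define d where "d = w \<bullet> z"
  have prods: "w \<bullet> v = b" "v \<bullet> z = cc" "z \<bullet> v = cc" "z \<bullet> w = d"
    using symmetric_scalar_prod[OF S v c(1)] comm_scalar_prod[OF c(3,1)] comm_scalar_prod[OF c(3,2)]
      comm_scalar_prod[OF c(1,2)]
    by (auto simp: b_def cc_def d_def w_def[symmetric] z_def[symmetric])
  note defs = a_def[symmetric] b_def[symmetric] cc_def[symmetric] d_def[symmetric]
  have S_w: "S *\<^sub>v (w - t \<cdot>\<^sub>v v) = z - t \<cdot>\<^sub>v w" for t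
    using S by (simp add: mult_minus_distrib_mat_vec[of _ n n] mult_mat_vec[of _ n n] w_def z_def)
  have n1: "(w - t \<cdot>\<^sub>v v) \<bullet> (w - t \<cdot>\<^sub>v v) = cc - 2 * t * b + t\<^sup>2 * a" for t
    by (simp add: minus_scalar_prod_distrib[of _ n] scalar_prod_minus_distrib[of _ n] defs prods
      power2_eq_square algebra_simps)
  have n2: "(w - t \<cdot>\<^sub>v v) \<bullet> (z - t \<cdot>\<^sub>v w) = d - 2 * t * cc + t\<^sup>2 * b" for t
    by (simp add: minus_scalar_prod_distrib[of _ n] scalar_prod_minus_distrib[of _ n] defs prods
      power2_eq_square algebra_simps)
  define f where "f = (\<lambda>t. (t + m) * b - cc - t * m * a)"
  \<comment> \<open>For t > l the factor t - m is positive and can be cancelled, even if l = m. The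
    value at l is then the limit from the right.\<close>
  have "0 \<le> f t" if t: "l < t" for t
  proof -
    have vv: "0 \<le> x \<bullet> x" for x :: "real vec" by (simp flip: vec_norm2_real)
    have "d - 2 * m * cc + m\<^sup>2 * b \<le> l * (cc - 2 * m * b + m\<^sup>2 * a)"
      using hi[of "w - m \<cdot>\<^sub>v v"] by (simp add: S_w n1 n2)
    also have "\<dots> \<le> t * (cc - 2 * m * b + m\<^sup>2 * a)"
      using t vv[of "w - m \<cdot>\<^sub>v v"] by (intro mult_right_mono) (auto simp: n1)
    \<comment> \<open>The two summands are the forms of (S - m)(t - S)(S - m) and (t - S)(S - m)(t -
      S) at v, written in terms of the moments a, b, cc, d of S.\<close>
    finally have "0 \<le> t * (cc - 2 * m * b + m\<^sup>2 * a) - (d - 2 * m * cc + m\<^sup>2 * b)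
        + ((d - 2 * t * cc + t\<^sup>2 * b) - m * (cc - 2 * t * b + t\<^sup>2 * a))"
      using lo[of "w - t \<cdot>\<^sub>v v"] by (simp add: S_w n1 n2)
    also have "\<dots> = (t - m) * f t" by (simp add: f_def power2_eq_square algebra_simps)
    finally show ?thesis using t ml by (simp add: zero_le_mult_iff)
  qed
  hence "eventually (\<lambda>t. 0 \<le> f t) (at_right l)" by (auto simp: eventually_at_right_field intro: exI[of _ "l + 1"])
  moreover have "(f \<longlongrightarrow> f l) (at_right l)" unfolding f_def by (intro tendsto_intros)
  ultimately have "0 \<le> f l" by (intro tendsto_lowerbound[where F = "at_right l"]) auto
  thus ?thesis by (simp add: f_def a_def b_def cc_def w_def)
qed

section \<open>The spectrum of \<open>K\<close>\<close>

lemma mat_inv_cancel: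
  assumes A: "A \<in> carrier_mat n n" and d: "det A \<noteq> 0" and v: "v \<in> carrier_vec n"
  shows "A *\<^sub>v (mat_inv A *\<^sub>v v) = v" "mat_inv A *\<^sub>v (A *\<^sub>v v) = v"
  using assoc_mult_mat_vec[OF A mat_inv_det(1)[OF A d] v] assoc_mult_mat_vec[OF mat_inv_det(1)[OF A d] A v]
    mat_inv_det(2,3)[OF A d] v by simp_all

section \<open>Block columns and the splitting of a space by an orthogonal matrix [Q P]\<close>

lemma append_cols_carrier [simp]:
  "A \<in> carrier_mat n k \<Longrightarrow> B \<in> carrier_mat n l \<Longrightarrow> A @\<^sub>c B \<in> carrier_mat n (k + l)"
  by (auto simp: append_cols_def)

lemma append_cols_mult_vec:
  fixes A :: "'a :: comm_ring_1 mat"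
  assumes "A \<in> carrier_mat n k" "B \<in> carrier_mat n l" "v \<in> carrier_vec k" "w \<in> carrier_vec l"
  shows "(A @\<^sub>c B) *\<^sub>v (v @\<^sub>v w) = A *\<^sub>v v + B *\<^sub>v w"
proof -
  have "(A @\<^sub>c B) *\<^sub>v (v @\<^sub>v w) = (A *\<^sub>v v + B *\<^sub>v w) @\<^sub>v (0\<^sub>m 0 k *\<^sub>v v + 0\<^sub>m 0 l *\<^sub>v w)"
    unfolding append_cols_def using assms by (subst four_block_mat_mult_vec[of _ n k _ l _ 0]) auto
  thus ?thesis using assms by (auto intro!: eq_vecI)
qed

lemma transpose_append_cols:
  fixes A :: "'a :: comm_ring_1 mat"
  assumes "A \<in> carrier_mat n k" "B \<in> carrier_mat n l"
  shows "(A @\<^sub>c B)\<^sup>T = A\<^sup>T @\<^sub>r B\<^sup>T"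
proof -
  have z: "(0\<^sub>m a b)\<^sup>T = (0\<^sub>m b a :: 'a mat)" for a b by (intro eq_matI) auto
  show ?thesis unfolding append_cols_def append_rows_def using assms
    by (subst transpose_four_block_mat[of _ n k _ l _ 0]) (auto simp: z)
qed

lemma carrier_vec_append_split:
  assumes "v \<in> carrier_vec (n + k)"
  obtains a b where "v = a @\<^sub>v b" "a \<in> carrier_vec n" "b \<in> carrier_vec k"
  using vec_first_last_append[OF assms] by (metis vec_first_carrier vec_last_carrier)

lemma transpose_mult_scalar_prod:
  fixes A :: "real mat"
  assumes "A \<in> carrier_mat n k" "v \<in> carrier_vec k" "w \<in> carrier_vec n"
  shows "(A *\<^sub>v v) \<bullet> w = v \<bullet> (A\<^sup>T *\<^sub>v w)"
  using transpose_vec_mult_scalar[OF assms] comm_scalar_prod[of w n "A *\<^sub>v v"]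
    comm_scalar_prod[of "A\<^sup>T *\<^sub>v w" k v] assms by simp

lemma orthonormal_cols_norm:
  assumes "U \<in> carrier_mat n k" "orthonormal_cols U" "v \<in> carrier_vec k"
  shows "vec_norm2 (U *\<^sub>v v) = vec_norm2 v"
proof -
  have "(vec_norm2 (U *\<^sub>v v))\<^sup>2 = v \<bullet> (U\<^sup>T *\<^sub>v (U *\<^sub>v v))"
    using assms by (simp add: vec_norm2_real transpose_mult_scalar_prod[of _ n k])
  also have "U\<^sup>T *\<^sub>v (U *\<^sub>v v) = (U\<^sup>T * U) *\<^sub>v v" using assms by simp
  also have "\<dots> = v" using assms by (simp add: orthonormal_cols_def)
  finally show ?thesis by (simp flip: vec_norm2_real)
qed

locale orthogonal_split =
  fixes Q P :: "real mat" and n k :: nat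
  assumes Q: "Q \<in> carrier_mat n k" and PQ: "orthogonal_completion Q P"
begin

text \<open>If k > n, the truncated difference \<open>n - k\<close> is 0, and [Q P] would have k
  columns but only n rows.\<close>

lemma k_le: "k \<le> n"
  using PQ Q by (auto simp: orthogonal_completion_def append_cols_def square_mat.simps)

lemma P: "P \<in> carrier_mat n (n - k)"
  using PQ Q by (auto simp: orthogonal_completion_def)

lemma U: "Q @\<^sub>c P \<in> carrier_mat n n" "orthonormal_cols (Q @\<^sub>c P)"
  using append_cols_carrier[OF Q P] k_le PQ by (auto simp: orthogonal_completion_def)

lemma U_transpose: "(Q @\<^sub>c P)\<^sup>T * (Q @\<^sub>c P) = 1\<^sub>m n" "(Q @\<^sub>c P) * (Q @\<^sub>c P)\<^sup>T = 1\<^sub>m n"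
proof -
  show *: "(Q @\<^sub>c P)\<^sup>T * (Q @\<^sub>c P) = 1\<^sub>m n" using U by (auto simp: orthonormal_cols_def)
  show "(Q @\<^sub>c P) * (Q @\<^sub>c P)\<^sup>T = 1\<^sub>m n"
    using mat_mult_left_right_inverse[OF _ U(1) *] U by simp
qed

lemma U_mult_vec:
  "a \<in> carrier_vec k \<Longrightarrow> b \<in> carrier_vec (n - k) \<Longrightarrow> (Q @\<^sub>c P) *\<^sub>v (a @\<^sub>v b) = Q *\<^sub>v a + P *\<^sub>v b"
  using append_cols_mult_vec[OF Q P] .

lemma U_transpose_mult_vec:
  "v \<in> carrier_vec n \<Longrightarrow> (Q @\<^sub>c P)\<^sup>T *\<^sub>v v = (Q\<^sup>T *\<^sub>v v) @\<^sub>v (P\<^sup>T *\<^sub>v v)"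
  unfolding transpose_append_cols[OF Q P] using Q P
  by (subst mat_mult_append[of _ k n _ "n - k"]) auto

lemma transpose_split:
  assumes a: "a \<in> carrier_vec k" and b: "b \<in> carrier_vec (n - k)"
  shows "Q\<^sup>T *\<^sub>v (Q *\<^sub>v a + P *\<^sub>v b) = a" "P\<^sup>T *\<^sub>v (Q *\<^sub>v a + P *\<^sub>v b) = b"
proof -
  have ab: "a @\<^sub>v b \<in> carrier_vec n" using append_carrier_vec[OF a b] k_le by simp
  have "(Q @\<^sub>c P)\<^sup>T *\<^sub>v ((Q @\<^sub>c P) *\<^sub>v (a @\<^sub>v b)) = a @\<^sub>v b"
    using U ab U_transpose by (simp flip: assoc_mult_mat_vec)
  moreover have "Q *\<^sub>v a + P *\<^sub>v b \<in> carrier_vec n" using Q P a b by auto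
  ultimately have "(Q\<^sup>T *\<^sub>v (Q *\<^sub>v a + P *\<^sub>v b)) @\<^sub>v (P\<^sup>T *\<^sub>v (Q *\<^sub>v a + P *\<^sub>v b)) = a @\<^sub>v b"
    using U_mult_vec[OF a b] U_transpose_mult_vec by simp
  moreover have "Q\<^sup>T *\<^sub>v (Q *\<^sub>v a + P *\<^sub>v b) \<in> carrier_vec k" using Q by (intro carrier_vecI) simp
  ultimately show "Q\<^sup>T *\<^sub>v (Q *\<^sub>v a + P *\<^sub>v b) = a" "P\<^sup>T *\<^sub>v (Q *\<^sub>v a + P *\<^sub>v b) = b"
    using append_vec_eq[OF _ a] by blast+
qed

lemma transpose_cross:
  "a \<in> carrier_vec k \<Longrightarrow> Q\<^sup>T *\<^sub>v (Q *\<^sub>v a) = a" "a \<in> carrier_vec k \<Longrightarrow> P\<^sup>T *\<^sub>v (Q *\<^sub>v a) = 0\<^sub>v (n - k)"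
  "b \<in> carrier_vec (n - k) \<Longrightarrow> P\<^sup>T *\<^sub>v (P *\<^sub>v b) = b" "b \<in> carrier_vec (n - k) \<Longrightarrow> Q\<^sup>T *\<^sub>v (P *\<^sub>v b) = 0\<^sub>v k"
  using transpose_split[of a "0\<^sub>v (n - k)"] transpose_split[of "0\<^sub>v k" b] Q P
  by (auto simp: mult_mat_vec_def scalar_prod_def)

lemma split_vec:
  assumes "v \<in> carrier_vec n"
  shows "Q *\<^sub>v (Q\<^sup>T *\<^sub>v v) + P *\<^sub>v (P\<^sup>T *\<^sub>v v) = v"
proof -
  have "(Q @\<^sub>c P) *\<^sub>v ((Q @\<^sub>c P)\<^sup>T *\<^sub>v v) = v"
    using U(1) assms U_transpose(2) by (simp flip: assoc_mult_mat_vec)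
  thus ?thesis using assms U_transpose_mult_vec[OF assms] U_mult_vec[of "Q\<^sup>T *\<^sub>v v" "P\<^sup>T *\<^sub>v v"] Q P by simp
qed

lemma split_norm:
  assumes "v \<in> carrier_vec n"
  shows "(vec_norm2 (Q\<^sup>T *\<^sub>v v))\<^sup>2 + (vec_norm2 (P\<^sup>T *\<^sub>v v))\<^sup>2 = (vec_norm2 v)\<^sup>2"
proof -
  have "(Q @\<^sub>c P) *\<^sub>v ((Q @\<^sub>c P)\<^sup>T *\<^sub>v v) = v"
    using U(1) assms U_transpose(2) by (simp flip: assoc_mult_mat_vec)
  hence "vec_norm2 v = vec_norm2 ((Q @\<^sub>c P)\<^sup>T *\<^sub>v v)"
    using orthonormal_cols_norm[OF U, of "(Q @\<^sub>c P)\<^sup>T *\<^sub>v v"] U assms by simp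
  thus ?thesis using assms by (simp add: U_transpose_mult_vec vec_norm2_append)
qed

end

section \<open>The Cayley transform of a symmetric positive definite matrix\<close>

locale shifted_inverse =
  fixes S :: "real mat" and n :: nat and m l \<beta> :: real
  assumes S: "S \<in> carrier_mat n n" "S\<^sup>T = S"
    and lo: "\<And>v. v \<in> carrier_vec n \<Longrightarrow> m * (v \<bullet> v) \<le> v \<bullet> (S *\<^sub>v v)"
    and hi: "\<And>v. v \<in> carrier_vec n \<Longrightarrow> v \<bullet> (S *\<^sub>v v) \<le> l * (v \<bullet> v)"
    and m: "0 < m" "m \<le> \<beta>" "\<beta> \<le> l"
begin

text \<open>Kept in the form in which it occurs in \<open>K_mat\<close>; it equals the Cayley
  transform (\<beta> I - S)(\<beta> I + S)^-1, see \<open>H_mult_vec\<close>.\<close>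

definition H :: "real mat" where
  "H = mat_inv ((1 / \<beta>) \<cdot>\<^sub>m S + 1\<^sub>m n) - mat_inv (\<beta> \<cdot>\<^sub>m mat_inv S + 1\<^sub>m n)"

lemma beta_pos: "0 < \<beta>" using m by simp

lemma S_pos: "v \<in> carrier_vec n \<Longrightarrow> v \<bullet> (S *\<^sub>v v) \<le> 0 \<Longrightarrow> v = 0\<^sub>v n"
proof -
  assume v: "v \<in> carrier_vec n" "v \<bullet> (S *\<^sub>v v) \<le> 0"
  hence "m * (vec_norm2 v)\<^sup>2 \<le> 0" using lo[OF v(1)] by (simp add: vec_norm2_real)
  hence "vec_norm2 v = 0" using m by (simp add: mult_le_0_iff)
  thus "v = 0\<^sub>v n" using v vec_norm2_eq_0_iff[of v] by simp
qed

lemma S_det: "det S \<noteq> 0"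
  by (rule mat_inv_inj[OF S(1)]) (auto intro: S_pos)

lemma scaled_mult_vec:
  assumes v: "v \<in> carrier_vec n"
  shows "((1 / \<beta>) \<cdot>\<^sub>m S + 1\<^sub>m n) *\<^sub>v v = (1 / \<beta>) \<cdot>\<^sub>v (S *\<^sub>v v) + v"
  using S v by (simp add: add_mult_distrib_mat_vec[of _ n n] smult_mat_mult_vec[of _ n n])

lemma shift_inj:
  assumes v: "v \<in> carrier_vec n" and eq: "\<beta> \<cdot>\<^sub>v v + S *\<^sub>v v = 0\<^sub>v n"
  shows "v = 0\<^sub>v n"
proof (rule S_pos[OF v])
  have "v \<bullet> (\<beta> \<cdot>\<^sub>v v + S *\<^sub>v v) = \<beta> * (vec_norm2 v)\<^sup>2 + v \<bullet> (S *\<^sub>v v)"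
    using S v by (simp add: scalar_prod_add_distrib[of _ n] vec_norm2_real)
  moreover have "0 \<le> \<beta> * (vec_norm2 v)\<^sup>2" using beta_pos by simp
  moreover have "v \<bullet> (\<beta> \<cdot>\<^sub>v v + S *\<^sub>v v) = 0" using v by (simp only: eq) simp
  ultimately show "v \<bullet> (S *\<^sub>v v) \<le> 0" by simp
qed

lemma det1: "det ((1 / \<beta>) \<cdot>\<^sub>m S + 1\<^sub>m n) \<noteq> 0"
proof (rule mat_inv_inj)
  show "(1 / \<beta>) \<cdot>\<^sub>m S + 1\<^sub>m n \<in> carrier_mat n n" using S by simp
  fix v :: "real vec" assume v: "v \<in> carrier_vec n" "((1 / \<beta>) \<cdot>\<^sub>m S + 1\<^sub>m n) *\<^sub>v v = 0\<^sub>v n"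
  have "\<beta> \<cdot>\<^sub>v v + S *\<^sub>v v = \<beta> \<cdot>\<^sub>v (((1 / \<beta>) \<cdot>\<^sub>m S + 1\<^sub>m n) *\<^sub>v v)"
    unfolding scaled_mult_vec[OF v(1)] using S(1) v(1) beta_pos by (intro eq_vecI) (auto simp: field_simps)
  also have "\<dots> = 0\<^sub>v n" unfolding v(2) by (intro eq_vecI) auto
  finally show "v = 0\<^sub>v n" by (rule shift_inj[OF v(1)])
qed

text \<open>\<beta> S^-1 + I equals (\<beta> I + S) S^-1, so evaluating it at vectors of the form S
  v removes the inverse.\<close>

lemma inv2_mult_vec:
  assumes v: "v \<in> carrier_vec n"
  shows "(\<beta> \<cdot>\<^sub>m mat_inv S + 1\<^sub>m n) *\<^sub>v (S *\<^sub>v v) = \<beta> \<cdot>\<^sub>v v + S *\<^sub>v v"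
proof -
  note i = mat_inv_det[OF S(1) S_det]
  have "mat_inv S *\<^sub>v (S *\<^sub>v v) = v" by (rule mat_inv_cancel(2)[OF S(1) S_det v])
  thus ?thesis using S v i
    by (simp add: add_mult_distrib_mat_vec[of _ n n] smult_mat_mult_vec[of _ n n])
qed

lemma det2: "det (\<beta> \<cdot>\<^sub>m mat_inv S + 1\<^sub>m n) \<noteq> 0"
proof (rule mat_inv_inj)
  note i = mat_inv_det[OF S(1) S_det]
  show "\<beta> \<cdot>\<^sub>m mat_inv S + 1\<^sub>m n \<in> carrier_mat n n" using i by simp
  fix u :: "real vec" assume u: "u \<in> carrier_vec n" "(\<beta> \<cdot>\<^sub>m mat_inv S + 1\<^sub>m n) *\<^sub>v u = 0\<^sub>v n"
  define v where "v = mat_inv S *\<^sub>v u"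
  have v: "v \<in> carrier_vec n" "S *\<^sub>v v = u" using i u mat_inv_cancel(1)[OF S(1) S_det u(1)] by (auto simp: v_def)
  have "v = 0\<^sub>v n" by (rule shift_inj[OF v(1)]) (use inv2_mult_vec[OF v(1)] u(2) v(2) in argo)
  thus "u = 0\<^sub>v n" using v(2) S(1) by (auto intro!: eq_vecI)
qed

text \<open>The parametrization w = (\<beta> I + S) v is used for all facts about H: in terms of v,
  H acts without inverses, and every form in w becomes a combination of v.v, v.Sv and Sv.Sv.\<close>

lemma shift_surj:
  assumes w: "w \<in> carrier_vec n"
  obtains v where "v \<in> carrier_vec n" "w = \<beta> \<cdot>\<^sub>v v + S *\<^sub>v v"
proof
  have c: "(1 / \<beta>) \<cdot>\<^sub>m S + 1\<^sub>m n \<in> carrier_mat n n" using S by simp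
  note i = mat_inv_det[OF c det1]
  define u where "u = mat_inv ((1 / \<beta>) \<cdot>\<^sub>m S + 1\<^sub>m n) *\<^sub>v w"
  have u: "u \<in> carrier_vec n" using i w by (simp add: u_def)
  have "((1 / \<beta>) \<cdot>\<^sub>m S + 1\<^sub>m n) *\<^sub>v u = w" unfolding u_def using mat_inv_cancel(1)[OF c det1 w] .
  hence "w = (1 / \<beta>) \<cdot>\<^sub>v (S *\<^sub>v u) + u" using scaled_mult_vec[OF u] by simp
  also have "\<dots> = \<beta> \<cdot>\<^sub>v ((1 / \<beta>) \<cdot>\<^sub>v u) + S *\<^sub>v ((1 / \<beta>) \<cdot>\<^sub>v u)"
    using S u beta_pos by (intro eq_vecI) (auto simp: mult_mat_vec[of S n n])
  finally show "w = \<beta> \<cdot>\<^sub>v ((1 / \<beta>) \<cdot>\<^sub>v u) + S *\<^sub>v ((1 / \<beta>) \<cdot>\<^sub>v u)" .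
  show "(1 / \<beta>) \<cdot>\<^sub>v u \<in> carrier_vec n" using u by simp
qed

lemma H_carrier [simp]: "H \<in> carrier_mat n n"
  unfolding H_def using S mat_inv_det[OF S(1) S_det] mat_inv_det[OF _ det1] mat_inv_det[OF _ det2]
  by (auto intro!: minus_carrier_mat)

text \<open>For w = \<beta> v + S v the two inverses in \<open>H\<close> yield \<beta> v and S v,
  respectively.\<close>

lemma H_mult_vec:
  assumes v: "v \<in> carrier_vec n"
  shows "H *\<^sub>v (\<beta> \<cdot>\<^sub>v v + S *\<^sub>v v) = \<beta> \<cdot>\<^sub>v v - S *\<^sub>v v"
proof -
  let ?w = "\<beta> \<cdot>\<^sub>v v + S *\<^sub>v v"
  have w: "?w \<in> carrier_vec n" "S *\<^sub>v v \<in> carrier_vec n" using S v by auto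
  note i = mat_inv_det[OF S(1) S_det]
  have c1: "(1 / \<beta>) \<cdot>\<^sub>m S + 1\<^sub>m n \<in> carrier_mat n n" using S by simp
  have c2: "\<beta> \<cdot>\<^sub>m mat_inv S + 1\<^sub>m n \<in> carrier_mat n n" using i by simp
  note i1 = mat_inv_det[OF c1 det1] and i2 = mat_inv_det[OF c2 det2]
  have "((1 / \<beta>) \<cdot>\<^sub>m S + 1\<^sub>m n) *\<^sub>v (\<beta> \<cdot>\<^sub>v v) = ?w"
    using scaled_mult_vec[of "\<beta> \<cdot>\<^sub>v v"] S v beta_pos
    by (simp add: mult_mat_vec[of S n n] smult_smult_assoc comm_add_vec[of _ n])
  hence e1: "mat_inv ((1 / \<beta>) \<cdot>\<^sub>m S + 1\<^sub>m n) *\<^sub>v ?w = \<beta> \<cdot>\<^sub>v v"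
    using mat_inv_cancel(2)[OF c1 det1, of "\<beta> \<cdot>\<^sub>v v"] v by simp
  have e2: "mat_inv (\<beta> \<cdot>\<^sub>m mat_inv S + 1\<^sub>m n) *\<^sub>v ?w = S *\<^sub>v v"
    using mat_inv_cancel(2)[OF c2 det2 w(2)] inv2_mult_vec[OF v] by simp
  show ?thesis unfolding H_def using i1 i2 w
    by (simp only: minus_mult_distrib_mat_vec[of _ n n] e1 e2)
qed

text \<open>This is the form of (H + g1)(H - g2) \<le> 0, with g1 and g2 the two fractions, and
  expresses that the spectrum of H lies in [-g1, g2]. In terms of v it is a positive multiple of
  \<open>symmetric_mult_norm_le\<close> for S.\<close>

lemma H_spectral_bound:
  assumes w: "w \<in> carrier_vec n"
  shows "(H *\<^sub>v w) \<bullet> (H *\<^sub>v w) \<le> (l - \<beta>) / (l + \<beta>) * ((\<beta> - m) / (\<beta> + m)) * (w \<bullet> w)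
    + ((\<beta> - m) / (\<beta> + m) - (l - \<beta>) / (l + \<beta>)) * (w \<bullet> (H *\<^sub>v w))"
proof -
  obtain v where v: "v \<in> carrier_vec n" and w_eq: "w = \<beta> \<cdot>\<^sub>v v + S *\<^sub>v v"
    using shift_surj[OF w] .
  have Sv: "S *\<^sub>v v \<in> carrier_vec n" using S v by simp
  define a where "a = v \<bullet> v"
  define b where "b = v \<bullet> (S *\<^sub>v v)"
  define c where "c = (S *\<^sub>v v) \<bullet> (S *\<^sub>v v)"
  have b': "(S *\<^sub>v v) \<bullet> v = b" using symmetric_scalar_prod[OF S v v] by (simp add: b_def)
  note defs = a_def[symmetric] b_def[symmetric] c_def[symmetric] b'
  have ww: "w \<bullet> w = \<beta>\<^sup>2 * a + 2 * \<beta> * b + c"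
    using v Sv by (simp add: w_eq scalar_prod_add_distrib[of _ n] add_scalar_prod_distrib[of _ n] defs
      power2_eq_square algebra_simps)
  have hh: "(H *\<^sub>v w) \<bullet> (H *\<^sub>v w) = \<beta>\<^sup>2 * a - 2 * \<beta> * b + c"
    using v Sv by (simp add: w_eq H_mult_vec scalar_prod_minus_distrib[of _ n] minus_scalar_prod_distrib[of _ n]
      defs power2_eq_square algebra_simps)
  have wh: "w \<bullet> (H *\<^sub>v w) = \<beta>\<^sup>2 * a - c"
    using v Sv by (simp add: w_eq H_mult_vec scalar_prod_minus_distrib[of _ n] add_scalar_prod_distrib[of _ n]
      defs power2_eq_square algebra_simps)
  have key: "c \<le> (l + m) * b - l * m * a"
    unfolding a_def b_def c_def using m by (intro symmetric_mult_norm_le[OF S v lo hi]) auto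
  have pos: "0 < l + \<beta>" "0 < \<beta> + m" using m by auto
  have "(l + \<beta>) * (\<beta> + m) * ((H *\<^sub>v w) \<bullet> (H *\<^sub>v w)) - (l - \<beta>) * (\<beta> - m) * (w \<bullet> w)
      - ((\<beta> - m) * (l + \<beta>) - (l - \<beta>) * (\<beta> + m)) * (w \<bullet> (H *\<^sub>v w))
      = 4 * \<beta>\<^sup>2 * (c - ((l + m) * b - l * m * a))"
    unfolding ww hh wh by (simp add: power2_eq_square algebra_simps)
  also have "\<dots> \<le> 0" using key by (simp add: mult_le_0_iff)
  finally have "(l + \<beta>) * (\<beta> + m) * ((H *\<^sub>v w) \<bullet> (H *\<^sub>v w)) \<le> (l - \<beta>) * (\<beta> - m) * (w \<bullet> w)
      + ((\<beta> - m) * (l + \<beta>) - (l - \<beta>) * (\<beta> + m)) * (w \<bullet> (H *\<^sub>v w))" by simp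
  hence "(H *\<^sub>v w) \<bullet> (H *\<^sub>v w) \<le> ((l - \<beta>) * (\<beta> - m) * (w \<bullet> w)
      + ((\<beta> - m) * (l + \<beta>) - (l - \<beta>) * (\<beta> + m)) * (w \<bullet> (H *\<^sub>v w))) / ((l + \<beta>) * (\<beta> + m))"
    using pos by (simp add: pos_le_divide_eq mult_ac)
  also have "\<dots> = (l - \<beta>) / (l + \<beta>) * ((\<beta> - m) / (\<beta> + m)) * (w \<bullet> w)
    + ((\<beta> - m) / (\<beta> + m) - (l - \<beta>) / (l + \<beta>)) * (w \<bullet> (H *\<^sub>v w))"
  proof -
    have "((p * q) * x + (q * L - p * M) * y) / (L * M) = p / L * (q / M) * x + (q / M - p / L) * y"
      if "L \<noteq> 0" "M \<noteq> 0" for p q x y L M :: real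
      using that by (simp add: add_divide_distrib diff_divide_distrib left_diff_distrib)
    from this[of "l + \<beta>" "\<beta> + m"] show ?thesis using pos by simp
  qed
  finally show ?thesis .
qed

lemma H_symmetric:
  assumes w: "w \<in> carrier_vec n" "w' \<in> carrier_vec n"
  shows "w \<bullet> (H *\<^sub>v w') = w' \<bullet> (H *\<^sub>v w)"
proof -
  obtain v where v: "v \<in> carrier_vec n" and w_eq: "w = \<beta> \<cdot>\<^sub>v v + S *\<^sub>v v"
    using shift_surj[OF w(1)] .
  obtain v' where v': "v' \<in> carrier_vec n" and w'_eq: "w' = \<beta> \<cdot>\<^sub>v v' + S *\<^sub>v v'"
    using shift_surj[OF w(2)] .
  have Sv: "S *\<^sub>v v \<in> carrier_vec n" "S *\<^sub>v v' \<in> carrier_vec n" using S v v' by simp_all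
  have 1: "(S *\<^sub>v v) \<bullet> v' = v \<bullet> (S *\<^sub>v v')" by (rule symmetric_scalar_prod[OF S v v'])
  have 2: "(S *\<^sub>v v') \<bullet> v = v' \<bullet> (S *\<^sub>v v)" by (rule symmetric_scalar_prod[OF S v' v])
  have "w \<bullet> (H *\<^sub>v w') = \<beta>\<^sup>2 * (v \<bullet> v') - (S *\<^sub>v v) \<bullet> (S *\<^sub>v v')"
    using v v' Sv by (simp add: w_eq w'_eq H_mult_vec scalar_prod_minus_distrib[of _ n]
      add_scalar_prod_distrib[of _ n] 1 power2_eq_square algebra_simps)
  also have "\<dots> = \<beta>\<^sup>2 * (v' \<bullet> v) - (S *\<^sub>v v') \<bullet> (S *\<^sub>v v)"
    using comm_scalar_prod[OF v v'] comm_scalar_prod[OF Sv] by (simp only:)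
  also have "\<dots> = w' \<bullet> (H *\<^sub>v w)"
    using v v' Sv by (simp add: w_eq w'_eq H_mult_vec scalar_prod_minus_distrib[of _ n]
      add_scalar_prod_distrib[of _ n] 2 power2_eq_square algebra_simps)
  finally show ?thesis .
qed

end

text \<open>\<open>K = J U\<^sup>T H U\<close> with \<open>U\<close> orthogonal, \<open>J = diag(I, -I)\<close> and \<open>H\<close> symmetric. For an eigenvector
  \<open>x\<close> of \<open>K\<close>, \<open>\<lambda> x\<^sup>* J x = (Ux)\<^sup>* H (Ux)\<close> is real, so \<open>\<lambda>\<close> is real unless both forms
  vanish; in that case the spectral bound for \<open>H\<close> loses its middle term. Eigenvectors are treated as
  pairs (real part, imaginary part) of real vectors.\<close>

locale split_shifted_inverse = orthogonal_split Q P n k + shifted_inverse S n m l \<beta>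
  for Q P S :: "real mat" and n k :: nat and m l \<beta> :: real
begin

definition K :: "real mat" where "K = (Q\<^sup>T @\<^sub>r (- P\<^sup>T)) * H * (Q @\<^sub>c P)"

definition J :: "real mat" where
  "J = four_block_mat (1\<^sub>m k) (0\<^sub>m k (n - k)) (0\<^sub>m (n - k) k) (- 1\<^sub>m (n - k))"

lemma J_carrier [simp]: "J \<in> carrier_mat n n"
  using k_le unfolding J_def by (metis four_block_carrier_mat le_add_diff_inverse one_carrier_mat uminus_carrier_mat)

lemma J_append:
  assumes "a \<in> carrier_vec k" "b \<in> carrier_vec (n - k)"
  shows "J *\<^sub>v (a @\<^sub>v b) = a @\<^sub>v (- b)"
  unfolding J_def using assms by (subst mult_mat_vec_split) auto

lemma J_split:
  assumes "x \<in> carrier_vec n"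
  obtains a b where "x = a @\<^sub>v b" "a \<in> carrier_vec k" "b \<in> carrier_vec (n - k)"
  using carrier_vec_append_split[of x k "n - k"] assms k_le by auto

lemma J_form:
  assumes x: "x \<in> carrier_vec n" and y: "y \<in> carrier_vec n"
  shows "x \<bullet> (J *\<^sub>v y) = y \<bullet> (J *\<^sub>v x)" "\<bar>x \<bullet> (J *\<^sub>v x)\<bar> \<le> x \<bullet> x"
    "J *\<^sub>v (J *\<^sub>v x) = x" "vec_norm2 (J *\<^sub>v x) = vec_norm2 x"
proof -
  obtain a b where ab: "x = a @\<^sub>v b" "a \<in> carrier_vec k" "b \<in> carrier_vec (n - k)"
    using J_split[OF x] .
  obtain c d where cd: "y = c @\<^sub>v d" "c \<in> carrier_vec k" "d \<in> carrier_vec (n - k)"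
    using J_split[OF y] .
  have u: "- b \<in> carrier_vec (n - k)" "- d \<in> carrier_vec (n - k)" using ab cd by auto
  show "x \<bullet> (J *\<^sub>v y) = y \<bullet> (J *\<^sub>v x)"
    using ab(2,3) cd(2,3) u comm_scalar_prod[OF ab(2) cd(2)] comm_scalar_prod[OF ab(3) cd(3)] unfolding ab(1) cd(1)
    by (simp add: J_append scalar_prod_append[of _ k _ "n - k"])
  show "\<bar>x \<bullet> (J *\<^sub>v x)\<bar> \<le> x \<bullet> x"
  proof -
    have "x \<bullet> (J *\<^sub>v x) = (vec_norm2 a)\<^sup>2 - (vec_norm2 b)\<^sup>2"
      using ab(2,3) u unfolding ab(1) vec_norm2_real
      by (simp add: J_append scalar_prod_append[of _ k _ "n - k"])
    moreover have "x \<bullet> x = (vec_norm2 a)\<^sup>2 + (vec_norm2 b)\<^sup>2"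
      by (simp only: ab(1) vec_norm2_append flip: vec_norm2_real)
    moreover have "0 \<le> (vec_norm2 a)\<^sup>2" "0 \<le> (vec_norm2 b)\<^sup>2" by simp_all
    ultimately show ?thesis by linarith
  qed
  show "J *\<^sub>v (J *\<^sub>v x) = x" using ab u by (simp add: J_append)
  have "(vec_norm2 (J *\<^sub>v x))\<^sup>2 = (vec_norm2 x)\<^sup>2" using ab by (simp add: J_append vec_norm2_append)
  thus "vec_norm2 (J *\<^sub>v x) = vec_norm2 x" by simp
qed

lemma K_mult_vec:
  assumes x: "x \<in> carrier_vec n"
  shows "K *\<^sub>v x = (Q\<^sup>T *\<^sub>v (H *\<^sub>v ((Q @\<^sub>c P) *\<^sub>v x))) @\<^sub>v - (P\<^sup>T *\<^sub>v (H *\<^sub>v ((Q @\<^sub>c P) *\<^sub>v x)))"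
    "K *\<^sub>v x = J *\<^sub>v ((Q @\<^sub>c P)\<^sup>T *\<^sub>v (H *\<^sub>v ((Q @\<^sub>c P) *\<^sub>v x)))"
proof -
  define h where "h = H *\<^sub>v ((Q @\<^sub>c P) *\<^sub>v x)"
  have h: "h \<in> carrier_vec n" unfolding h_def
    by (intro mult_mat_vec_carrier[OF H_carrier] mult_mat_vec_carrier[OF U(1)] x)
  have c: "Q\<^sup>T @\<^sub>r (- P\<^sup>T) \<in> carrier_mat n n"
    using carrier_append_rows[of "Q\<^sup>T" k n "- P\<^sup>T" "n - k"] Q P k_le by simp
  have "K *\<^sub>v x = (Q\<^sup>T @\<^sub>r (- P\<^sup>T)) *\<^sub>v h"
    unfolding K_def h_def
    by (subst assoc_mult_mat_vec[OF mult_carrier_mat[OF c H_carrier] U(1) x],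
      rule assoc_mult_mat_vec[OF c H_carrier mult_mat_vec_carrier[OF U(1) x]])
  also have "\<dots> = (Q\<^sup>T *\<^sub>v h) @\<^sub>v - (P\<^sup>T *\<^sub>v h)"
    using Q P h by (subst mat_mult_append[of _ k n _ "n - k"]) auto
  finally show 1: "K *\<^sub>v x = (Q\<^sup>T *\<^sub>v (H *\<^sub>v ((Q @\<^sub>c P) *\<^sub>v x))) @\<^sub>v - (P\<^sup>T *\<^sub>v (H *\<^sub>v ((Q @\<^sub>c P) *\<^sub>v x)))"
    by (simp add: h_def)
  show "K *\<^sub>v x = J *\<^sub>v ((Q @\<^sub>c P)\<^sup>T *\<^sub>v (H *\<^sub>v ((Q @\<^sub>c P) *\<^sub>v x)))"
    unfolding 1 h_def[symmetric] U_transpose_mult_vec[OF h] using Q P h by (subst J_append) auto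
qed

lemma K_carrier [simp]: "K \<in> carrier_mat n n"
  unfolding K_def using carrier_append_rows[of "Q\<^sup>T" k n "- P\<^sup>T" "n - k"] Q P U k_le
  by (auto intro!: mult_carrier_mat[of _ n n])

text \<open>J and U^T preserve norms, where U = [Q P], and J K = U^T H U because J is an
  involution.\<close>

lemma K_forms:
  assumes x: "x \<in> carrier_vec n" and y: "y \<in> carrier_vec n"
  shows "vec_norm2 (K *\<^sub>v x) = vec_norm2 (H *\<^sub>v ((Q @\<^sub>c P) *\<^sub>v x))"
    "y \<bullet> (J *\<^sub>v (K *\<^sub>v x)) = ((Q @\<^sub>c P) *\<^sub>v y) \<bullet> (H *\<^sub>v ((Q @\<^sub>c P) *\<^sub>v x))"
proof -
  define h where "h = H *\<^sub>v ((Q @\<^sub>c P) *\<^sub>v x)"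
  have h: "h \<in> carrier_vec n" unfolding h_def
    by (intro mult_mat_vec_carrier[OF H_carrier] mult_mat_vec_carrier[OF U(1)] x)
  have Uh: "(Q @\<^sub>c P)\<^sup>T *\<^sub>v h \<in> carrier_vec n" using U h by simp
  have "(vec_norm2 (K *\<^sub>v x))\<^sup>2 = (vec_norm2 h)\<^sup>2"
    using K_mult_vec(1)[OF x] split_norm[OF h] by (simp add: vec_norm2_append h_def)
  thus "vec_norm2 (K *\<^sub>v x) = vec_norm2 (H *\<^sub>v ((Q @\<^sub>c P) *\<^sub>v x))" by (simp add: h_def)
  show "y \<bullet> (J *\<^sub>v (K *\<^sub>v x)) = ((Q @\<^sub>c P) *\<^sub>v y) \<bullet> (H *\<^sub>v ((Q @\<^sub>c P) *\<^sub>v x))"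
    using K_mult_vec(2)[OF x] J_form(3)[OF Uh Uh] transpose_mult_scalar_prod[OF U(1) y h]
    by (simp add: h_def)
qed

abbreviation "g1 \<equiv> (l - \<beta>) / (l + \<beta>)"
abbreviation "g2 \<equiv> (\<beta> - m) / (\<beta> + m)"

text \<open>The hypotheses say that z = x + i y is an eigenvector for \<lambda> = p + i q. With N =
  |z|^2 and the real number j = z* J z, the spectral bound for H at U z becomes |\<lambda>|^2 N
  \<le> g1 g2 N + (g2 - g1) p j. Either q is not 0, and then j = 0, or |j| \<le> N leaves a
  quadratic inequality for |p|.\<close>

lemma K_real_eigenpair_bound:
  assumes x: "x \<in> carrier_vec n" and y: "y \<in> carrier_vec n" and ne: "x \<noteq> 0\<^sub>v n \<or> y \<noteq> 0\<^sub>v n"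
    and Kx: "K *\<^sub>v x = p \<cdot>\<^sub>v x - q \<cdot>\<^sub>v y" and Ky: "K *\<^sub>v y = q \<cdot>\<^sub>v x + p \<cdot>\<^sub>v y"
  shows "p\<^sup>2 + q\<^sup>2 \<le> (max g1 g2)\<^sup>2" "q \<noteq> 0 \<Longrightarrow> p\<^sup>2 + q\<^sup>2 \<le> g1 * g2"
proof -
  define ux where "ux = (Q @\<^sub>c P) *\<^sub>v x"
  define uy where "uy = (Q @\<^sub>c P) *\<^sub>v y"
  have u: "ux \<in> carrier_vec n" "uy \<in> carrier_vec n" using x y U by (simp_all add: ux_def uy_def)
  define N where "N = x \<bullet> x + y \<bullet> y"
  define j where "j = x \<bullet> (J *\<^sub>v x) + y \<bullet> (J *\<^sub>v y)"
  have Jc: "J *\<^sub>v x \<in> carrier_vec n" "J *\<^sub>v y \<in> carrier_vec n"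
    using x y by (auto intro: mult_mat_vec_carrier[OF J_carrier])
  have N: "0 < N"
    using ne vec_norm2_pos[OF x] vec_norm2_pos[OF y]
    by (auto simp: N_def add_pos_nonneg add_nonneg_pos simp flip: vec_norm2_real)
  have jN: "\<bar>j\<bar> \<le> N" using J_form(2)[OF x x] J_form(2)[OF y y] by (simp add: j_def N_def)
  have xy: "y \<bullet> x = x \<bullet> y" using comm_scalar_prod[OF x y] by simp
  have nn: "ux \<bullet> ux + uy \<bullet> uy = N"
    using orthonormal_cols_norm[OF U x] orthonormal_cols_norm[OF U y]
    by (simp add: N_def ux_def uy_def flip: vec_norm2_real)
  have JK: "J *\<^sub>v (K *\<^sub>v x) = p \<cdot>\<^sub>v (J *\<^sub>v x) - q \<cdot>\<^sub>v (J *\<^sub>v y)"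
    "J *\<^sub>v (K *\<^sub>v y) = q \<cdot>\<^sub>v (J *\<^sub>v x) + p \<cdot>\<^sub>v (J *\<^sub>v y)"
    using x y by (simp_all add: Kx Ky mult_minus_distrib_mat_vec[of _ n n]
      mult_add_distrib_mat_vec[of _ n n] mult_mat_vec[of _ n n])
  have hh: "(H *\<^sub>v ux) \<bullet> (H *\<^sub>v ux) + (H *\<^sub>v uy) \<bullet> (H *\<^sub>v uy) = (p\<^sup>2 + q\<^sup>2) * N"
  proof -
    have "(H *\<^sub>v ux) \<bullet> (H *\<^sub>v ux) + (H *\<^sub>v uy) \<bullet> (H *\<^sub>v uy)
        = (K *\<^sub>v x) \<bullet> (K *\<^sub>v x) + (K *\<^sub>v y) \<bullet> (K *\<^sub>v y)"
      using K_forms(1)[OF x x] K_forms(1)[OF y y] by (simp add: ux_def uy_def flip: vec_norm2_real)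
    also have "\<dots> = (p\<^sup>2 + q\<^sup>2) * N"
      using x y by (simp add: Kx Ky N_def xy minus_scalar_prod_distrib[of _ n] scalar_prod_minus_distrib[of _ n]
        add_scalar_prod_distrib[of _ n] scalar_prod_add_distrib[of _ n] power2_eq_square algebra_simps)
    finally show ?thesis .
  qed
  have Jxy: "y \<bullet> (J *\<^sub>v x) = x \<bullet> (J *\<^sub>v y)" using J_form(1)[OF y x] .
  have uh: "ux \<bullet> (H *\<^sub>v ux) + uy \<bullet> (H *\<^sub>v uy) = p * j"
    using x y Jc by (simp add: ux_def uy_def K_forms(2)[symmetric] JK j_def Jxy
      scalar_prod_minus_distrib[of _ n] scalar_prod_add_distrib[of _ n] algebra_simps)
  \<comment> \<open>The left-hand side is the imaginary part of (U z)* H (U z) = \<lambda> j; it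
    vanishes since H is symmetric.\<close>
  have "ux \<bullet> (H *\<^sub>v uy) - uy \<bullet> (H *\<^sub>v ux) = q * j"
    using x y Jc by (simp add: ux_def uy_def K_forms(2)[symmetric] JK j_def Jxy
      scalar_prod_minus_distrib[of _ n] scalar_prod_add_distrib[of _ n] algebra_simps)
  hence qj: "q * j = 0" using H_symmetric[OF u] by simp
  have "(p\<^sup>2 + q\<^sup>2) * N \<le> g1 * g2 * (ux \<bullet> ux + uy \<bullet> uy) + (g2 - g1) * (ux \<bullet> (H *\<^sub>v ux) + uy \<bullet> (H *\<^sub>v uy))"
    unfolding hh[symmetric] using H_spectral_bound[OF u(1)] H_spectral_bound[OF u(2)]
    by (simp only: distrib_left)
  hence main: "(p\<^sup>2 + q\<^sup>2) * N \<le> g1 * g2 * N + (g2 - g1) * (p * j)"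
    by (simp only: nn uh)
  show *: "p\<^sup>2 + q\<^sup>2 \<le> g1 * g2" if "q \<noteq> 0"
  proof -
    have "j = 0" using qj that by simp
    thus ?thesis using main N by (simp add: mult_le_cancel_right_pos del: times_divide_eq_left times_divide_eq_right)
  qed
  have g: "0 \<le> g1" "0 \<le> g2" using m by auto
  show "p\<^sup>2 + q\<^sup>2 \<le> (max g1 g2)\<^sup>2"
  proof (cases "q = 0")
    case False
    have "g1 * g2 \<le> max g1 g2 * max g1 g2" using g by (intro mult_mono) auto
    thus ?thesis using *[OF False] by (simp add: power2_eq_square)
  next
    case True
    have "(g2 - g1) * (p * j) \<le> \<bar>g2 - g1\<bar> * (\<bar>p\<bar> * N)"
    proof -
      have "(g2 - g1) * (p * j) \<le> \<bar>(g2 - g1) * (p * j)\<bar>" by (rule abs_ge_self)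
      also have "\<dots> = \<bar>g2 - g1\<bar> * (\<bar>p\<bar> * \<bar>j\<bar>)" by (simp only: abs_mult)
      also have "\<dots> \<le> \<bar>g2 - g1\<bar> * (\<bar>p\<bar> * N)" using jN by (intro mult_left_mono) auto
      finally show ?thesis .
    qed
    hence "p\<^sup>2 * N \<le> (g1 * g2 + \<bar>g2 - g1\<bar> * \<bar>p\<bar>) * N" using main True by (simp add: algebra_simps)
    hence "p\<^sup>2 \<le> g1 * g2 + \<bar>g2 - g1\<bar> * \<bar>p\<bar>" using N by (simp only: mult_le_cancel_right_pos)
    also have "\<bar>g2 - g1\<bar> = max g1 g2 - min g1 g2" by (simp add: max_def min_def abs_if)
    also have "g1 * g2 = max g1 g2 * min g1 g2" by (simp add: max_def min_def mult.commute)
    finally have p2: "p\<^sup>2 \<le> max g1 g2 * min g1 g2 + (max g1 g2 - min g1 g2) * \<bar>p\<bar>" .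
    \<comment> \<open>The first premise is (|p| - M)(|p| + \<mu>) \<le> 0 multiplied out.\<close>
    have "\<bar>p\<bar> \<le> M" if "p\<^sup>2 \<le> M * \<mu> + (M - \<mu>) * \<bar>p\<bar>" "0 \<le> \<mu>" "0 \<le> M" for M \<mu> :: real
    proof (rule ccontr)
      assume "\<not> ?thesis"
      hence "0 < (\<bar>p\<bar> - M) * (\<bar>p\<bar> + \<mu>)" using that by (intro mult_pos_pos) auto
      also have "\<dots> = p\<^sup>2 - (M * \<mu> + (M - \<mu>) * \<bar>p\<bar>)"
        by (simp add: power2_eq_square algebra_simps)
      finally show False using that(1) by simp
    qed
    from this[OF p2] g have "\<bar>p\<bar> \<le> max g1 g2" by (simp add: le_max_iff_disj)
    hence "\<bar>p\<bar>\<^sup>2 \<le> (max g1 g2)\<^sup>2" by (intro power_mono) auto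
    thus ?thesis using True by simp
  qed
qed

lemma K_complex_eigenvalue_bound:
  fixes e :: complex
  assumes "eigenvalue (map_mat complex_of_real K) e"
  shows "cmod e \<le> max g1 g2" "Im e \<noteq> 0 \<Longrightarrow> (cmod e)\<^sup>2 \<le> g1 * g2"
proof -
  obtain x where x: "x \<in> carrier_vec n" "x \<noteq> 0\<^sub>v n" "map_mat complex_of_real K *\<^sub>v x = e \<cdot>\<^sub>v x"
    using assms K_carrier by (auto simp: eigenvalue_def eigenvector_def)
  define xr where "xr = map_vec Re x"
  define xi where "xi = map_vec Im x"
  have c: "xr \<in> carrier_vec n" "xi \<in> carrier_vec n" using x by (simp_all add: xr_def xi_def)
  have ne: "xr \<noteq> 0\<^sub>v n \<or> xi \<noteq> 0\<^sub>v n"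
  proof (rule ccontr)
    assume "\<not> ?thesis"
    hence z: "xr = 0\<^sub>v n" "xi = 0\<^sub>v n" by auto
    have "x = 0\<^sub>v n"
    proof (rule eq_vecI)
      fix i assume i: "i < dim_vec (0\<^sub>v n :: complex vec)"
      have "Re (x $ i) = xr $ i" "Im (x $ i) = xi $ i" using i x(1) by (simp_all add: xr_def xi_def)
      thus "x $ i = 0\<^sub>v n $ i" using i z by (simp add: complex_eq_iff)
    qed (use x in auto)
    thus False using x(2) by simp
  qed
  have entry: "(map_mat complex_of_real K *\<^sub>v x) $ i = Complex ((K *\<^sub>v xr) $ i) ((K *\<^sub>v xi) $ i)"
    if i: "i < n" for i
    using i x(1) carrier_matD[OF K_carrier]
    by (simp add: xr_def xi_def scalar_prod_def complex_eq_iff Re_sum Im_sum)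
  have eq: "Complex ((K *\<^sub>v xr) $ i) ((K *\<^sub>v xi) $ i) = e * x $ i" if i: "i < n" for i
    using entry[OF i] x i by simp
  have Kc: "K *\<^sub>v xr \<in> carrier_vec n" "K *\<^sub>v xi \<in> carrier_vec n"
    using c by (auto intro: mult_mat_vec_carrier[OF K_carrier])
  have 1: "K *\<^sub>v xr = Re e \<cdot>\<^sub>v xr - Im e \<cdot>\<^sub>v xi"
    using c Kc x eq carrier_matD[OF K_carrier] by (intro eq_vecI) (auto simp: xr_def xi_def complex_eq_iff)
  have 2: "K *\<^sub>v xi = Im e \<cdot>\<^sub>v xr + Re e \<cdot>\<^sub>v xi"
    using c Kc x eq carrier_matD[OF K_carrier] by (intro eq_vecI) (auto simp: xr_def xi_def complex_eq_iff)
  have g: "0 \<le> max g1 g2" using m by (auto simp: le_max_iff_disj)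
  show "cmod e \<le> max g1 g2"
    using K_real_eigenpair_bound(1)[OF c ne 1 2] g by (simp add: cmod_def real_le_lsqrt)
  show "(cmod e)\<^sup>2 \<le> g1 * g2" if "Im e \<noteq> 0"
    using K_real_eigenpair_bound(2)[OF c ne 1 2 that] by (simp add: cmod_power2)
qed

end

section \<open>Residual polynomials\<close>

text \<open>Chebyshev polynomials of the first kind, as functions on any commutative ring: on reals
  and complex numbers this evaluates them, and on a polynomial p it gives the composition with
  p.\<close>

fun chebyshev :: "nat \<Rightarrow> 'a :: comm_ring_1 \<Rightarrow> 'a" where
  "chebyshev 0 x = 1"
| "chebyshev (Suc 0) x = x"
| "chebyshev (Suc (Suc n)) x = 2 * x * chebyshev (Suc n) x - chebyshev n x"

lemma poly_chebyshev: "poly (chebyshev n p) x = chebyshev n (poly p x)"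
  by (induction n p rule: chebyshev.induct) auto

lemma of_real_chebyshev: "chebyshev n (complex_of_real x) = of_real (chebyshev n x)"
  by (induction n x rule: chebyshev.induct) auto

interpretation of_real_poly_hom: map_poly_idom_hom complex_of_real ..

lemma map_poly_chebyshev:
  "map_poly complex_of_real (chebyshev n p) = chebyshev n (map_poly complex_of_real p)"
proof (induction n p rule: chebyshev.induct)
  case (3 n p)
  have "map_poly complex_of_real 2 = 2"
    by (simp add: numeral_poly)
  thus ?case using 3 by (simp add: of_real_poly_hom.hom_mult of_real_poly_hom.hom_minus)
qed auto

lemma degree_chebyshev:
  fixes p :: "'a :: comm_ring_1 poly"
  assumes "degree p \<le> 1"
  shows "degree (chebyshev n p) \<le> n"
  using assms
proof (induction n p rule: chebyshev.induct)
  case (3 n p)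
  have "degree (2 * p * chebyshev (Suc n) p) \<le> degree (2 * p) + degree (chebyshev (Suc n) p)"
    by (rule degree_mult_le)
  also have "degree (2 * p) \<le> degree (2 :: 'a poly) + degree p" by (rule degree_mult_le)
  finally have "degree (2 * p * chebyshev (Suc n) p) \<le> Suc (Suc n)" using 3 by simp
  thus ?case using 3 by (auto intro!: degree_diff_le)
qed auto

lemma chebyshev_cos: "chebyshev n (cos \<theta>) = cos (real n * \<theta>)"
proof (induction n "cos \<theta>" rule: chebyshev.induct)
  case (3 n)
  have "cos (real (Suc (Suc n)) * \<theta>) + cos (real n * \<theta>) = 2 * cos \<theta> * cos (real (Suc n) * \<theta>)"
    using cos_add[of "real (Suc n) * \<theta>" \<theta>] cos_diff[of "real (Suc n) * \<theta>" \<theta>]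
    by (simp add: algebra_simps)
  thus ?case using 3 by simp
qed auto

lemma abs_chebyshev_le_1:
  fixes x :: real
  assumes "\<bar>x\<bar> \<le> 1"
  shows "\<bar>chebyshev n x\<bar> \<le> 1"
proof -
  have "x = cos (arccos x)" using assms by (simp add: cos_arccos abs_le_iff)
  hence "chebyshev n x = cos (real n * arccos x)" by (metis chebyshev_cos)
  thus ?thesis by simp
qed

text \<open>The recursion preserves this bound because 2 * (5/2) + 1 \<le> (5/2)^2. The base 5/2 is
  chosen below e, so that the growth can be compared with exp j.\<close>

lemma norm_chebyshev_le:
  fixes z :: complex
  assumes "norm z \<le> 1"
  shows "norm (chebyshev n z) \<le> (5 / 2) ^ n"
  using assms
proof (induction n z rule: chebyshev.induct)
  case (3 n z)
  have "norm (chebyshev (Suc (Suc n)) z) \<le> norm (2 * z * chebyshev (Suc n) z) + norm (chebyshev n z)"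
    by (simp add: norm_triangle_ineq4)
  also have "norm (2 * z * chebyshev (Suc n) z) = 2 * norm z * norm (chebyshev (Suc n) z)"
    by (simp add: norm_mult)
  also have "\<dots> \<le> 2 * 1 * (5 / 2) ^ Suc n" using 3 by (intro mult_mono) auto
  also have "2 * 1 * (5 / 2) ^ Suc n + norm (chebyshev n z) \<le> 2 * 1 * (5 / 2) ^ Suc n + (5 / 2 :: real) ^ n"
    using 3 by simp
  also have "\<dots> \<le> (5 / 2) ^ Suc (Suc n)" by simp
  finally show ?case by simp
qed auto

text \<open>At (y + 1/y) / 2 the recursion is solved by (y^n + y^-n) / 2.\<close>

lemma chebyshev_ge:
  fixes y :: real
  assumes y: "0 < y"
  shows "y ^ n / 2 \<le> chebyshev n ((y + 1 / y) / 2)"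
proof -
  have "chebyshev n ((y + 1 / y) / 2) = (y ^ n + 1 / y ^ n) / 2"
  proof (induction n "(y + 1 / y) / 2" rule: chebyshev.induct)
    case (3 n)
    show ?case unfolding chebyshev.simps 3 using y by (simp add: field_simps)
  qed (use y in auto)
  thus ?thesis using y by simp
qed


lemma exp_minus_ge_1_minus: "1 - x \<le> exp (- x)" for x :: real
  using exp_ge_add_one_self[of "- x"] by simp

text \<open>The set of admissible \<open>\<lambda>\<close> is a disk of radius \<open>sqrt (a * b)\<close> together with the segment \<open>[-a, a]\<close>.
  If \<open>t\<close> is at most of order \<open>\<kappa> powr (2/3)\<close>, powers of \<open>\<lambda>\<close> converge fast enough. Otherwise the
  disk is so small that a power \<open>\<lambda>\<^sup>i\<close> absorbs the growth \<open>(5/2)\<^sup>j\<close> of the Chebyshev polynomial of a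
  much smaller degree \<open>j\<close>, which in turn provides the decay on the segment. The loss of the two
  degrees is absorbed by the factor 2.\<close>

locale residual_polynomial =
  fixes \<kappa> t :: real and N :: nat
  assumes t: "1 \<le> t" "t \<le> \<kappa>" "\<kappa> \<le> t\<^sup>2" and N: "2 \<le> N"
begin

text \<open>For \<kappa> = l/m and t = max (\<beta>/m) (l/\<beta>), \<open>a\<close> and
  \<open>b\<close> are the larger and the smaller of the two endpoints g1 and g2, see
  \<open>residual_polynomial_params\<close>.\<close>

definition "a = (t - 1) / (t + 1)"
definition "b = (\<kappa> - t) / (\<kappa> + t)"
definition "rate = \<kappa> powr (2 / 3) / (\<kappa> powr (2 / 3) + 1)"
text \<open>With the cube root as the basic quantity, \<kappa> and \<kappa> powr (2/3) become the
  integral powers g^3 and g^2.\<close>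

definition "g = \<kappa> powr (1 / 3)"

definition admissible :: "complex \<Rightarrow> bool" where
  "admissible e \<longleftrightarrow> cmod e \<le> a \<and> (Im e \<noteq> 0 \<longrightarrow> (cmod e)\<^sup>2 \<le> a * b)"

lemma kappa_ge_1: "1 \<le> \<kappa>" using t by simp

lemma g: "1 \<le> g" "g ^ 3 = \<kappa>" "\<kappa> powr (2 / 3) = g\<^sup>2"
proof -
  show "1 \<le> g" using kappa_ge_1 by (simp add: g_def ge_one_powr_ge_zero)
  show "g ^ 3 = \<kappa>" using kappa_ge_1 by (simp add: g_def powr_power)
  show "\<kappa> powr (2 / 3) = g\<^sup>2" using kappa_ge_1 by (simp add: g_def powr_power)
qed

lemma rate: "1 / 2 \<le> rate" "rate < 1" "rate = 1 / (1 + 1 / g\<^sup>2)"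
proof -
  have "1 \<le> g\<^sup>2" using g(1) by simp
  moreover have "1 / 2 \<le> G / (G + 1)" "G / (G + 1) < 1" "G / (G + 1) = 1 / (1 + 1 / G)"
    if "1 \<le> G" for G :: real using that by (simp_all add: field_simps)
  ultimately show "1 / 2 \<le> rate" "rate < 1" "rate = 1 / (1 + 1 / g\<^sup>2)"
    unfolding rate_def g(3) by blast+
qed

text \<open>Since the rate is 1 / (1 + 1/g^2), this is ln (1 + 1/g^2) \<le> 1/g^2. It reduces the
  comparisons with the rate to comparisons of exponents.\<close>

lemma rate_powr_ge: "0 \<le> x \<Longrightarrow> exp (- x / g\<^sup>2) \<le> rate powr x"
proof -
  assume x: "0 \<le> x"
  have g2: "0 < g\<^sup>2" using g(1) by simp
  have "ln (1 + 1 / g\<^sup>2) \<le> 1 / g\<^sup>2" using g2 by (intro ln_add_one_self_le_self) auto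
  hence "x * ln (1 + 1 / g\<^sup>2) \<le> x * (1 / g\<^sup>2)" using x by (intro mult_left_mono)
  moreover have "ln rate = - ln (1 + 1 / g\<^sup>2)" 
    using g2 ln_inverse[of "1 + 1 / g\<^sup>2"] unfolding rate(3) by (simp add: inverse_eq_divide add_pos_pos)
  ultimately have "- x / g\<^sup>2 \<le> x * ln rate" by simp
  thus "exp (- x / g\<^sup>2) \<le> rate powr x" using rate(1) by (simp add: powr_def)
qed

lemma a: "0 \<le> a" "a < 1" "0 \<le> b" "b \<le> a" "a \<le> exp (- 2 / (t + 1))"
proof -
  show "0 \<le> a" "a < 1" "0 \<le> b" using t by (auto simp: a_def b_def)
  have "(\<kappa> - t) * (t + 1) \<le> (t - 1) * (\<kappa> + t)"
    using t by (simp add: algebra_simps power2_eq_square)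
  thus "b \<le> a" using t by (simp add: a_def b_def divide_simps)
  have "a = 1 - 2 / (t + 1)" using t by (simp add: a_def field_simps)
  thus "a \<le> exp (- 2 / (t + 1))" using exp_minus_ge_1_minus[of "2 / (t + 1)"] by simp
qed

text \<open>The threshold 9.569 is 2/0.209 rounded down: it makes 2/(t + 1) at least 0.209/g^2, so
  that each factor of modulus at most a \<le> exp(-2/(t + 1)) gains rate powr 0.209.\<close>

lemma power_residual:
  assumes tg: "t + 1 \<le> 9.569 * g\<^sup>2" and e: "admissible e"
  shows "cmod e ^ (N - 2) \<le> 2 * rate powr (0.209 * real N)"
proof -
  define J where "J = N - 2"
  have NJ: "real N = real J + 2" using N by (simp add: J_def)
  have g2: "0 < g\<^sup>2" using g(1) by simp
  have "0.209 / g\<^sup>2 \<le> 2 / (t + 1)" using tg t g2 by (simp add: field_simps)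
  hence "- 2 / (t + 1) \<le> - 0.209 / g\<^sup>2" by linarith
  hence "exp (- 2 / (t + 1)) \<le> exp (- 0.209 / g\<^sup>2)" by (simp only: exp_le_cancel_iff)
  with a(5) have "a \<le> exp (- 0.209 / g\<^sup>2)" by (rule order_trans)
  also have "\<dots> \<le> rate powr 0.209" using rate_powr_ge[of "0.209"] by simp
  finally have "cmod e \<le> rate powr 0.209" using e by (simp add: admissible_def)
  hence "cmod e ^ J \<le> (rate powr 0.209) ^ J" by (intro power_mono) auto
  also have "\<dots> = rate powr (0.209 * real J)" using rate(1) by (simp add: powr_powr flip: powr_realpow)
  \<comment> \<open>The two degrees missing from N would have contributed rate powr 0.418, which is
    at least 1/2 because the rate is at least 1/2.\<close>
  also have "\<dots> \<le> rate powr (0.209 * real J) * (2 * rate powr (0.209 * 2))"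
  proof -
    have "(1 / 2 :: real) = (1 / 2) powr 1" by simp
    also have "\<dots> \<le> (1 / 2) powr (0.209 * 2)" by (intro powr_mono') auto
    also have "\<dots> \<le> rate powr (0.209 * 2)" using rate by (intro powr_mono2) auto
    finally have "1 \<le> 2 * rate powr (0.209 * 2)" by simp
    from mult_left_mono[OF this, of "rate powr (0.209 * real J)"] show ?thesis by simp
  qed
  also have "\<dots> = 2 * rate powr (0.209 * real N)" by (simp add: NJ distrib_left powr_add)
  finally show ?thesis by (simp add: J_def)
qed

text \<open>As long as the exponent is at most 1/2, the factor 2 outweighs the decay, and the
  constant polynomial 1 will do.\<close>

lemma trivial_residual:
  assumes "0.209 * real N / g\<^sup>2 \<le> 1 / 2"
  shows "1 \<le> 2 * rate powr (0.209 * real N)"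
proof -
  have "1 / 2 \<le> exp (- (0.209 * real N / g\<^sup>2))"
    using assms exp_minus_ge_1_minus[of "0.209 * real N / g\<^sup>2"] by linarith
  also have "\<dots> \<le> rate powr (0.209 * real N)" using rate_powr_ge[of "0.209 * real N"] by simp
  finally show ?thesis by simp
qed

text \<open>From t \<le> g^3 the hypothesis gives 9.569 g^2 < g^3 + 1, which is false for 1 \<le> g
  < 9. Once g^2 \<ge> 81, the difference 0.069 g^2 exceeds 1, which gives the second claim.\<close>

lemma large_t:
  assumes tg: "9.569 * g\<^sup>2 < t + 1"
  shows "9 \<le> g" "9.5 * g\<^sup>2 \<le> t"
proof -
  have "t \<le> g ^ 3" using t g by simp
  hence less: "9.569 * g\<^sup>2 < g * g\<^sup>2 + 1" using tg by (simp add: power3_eq_cube power2_eq_square)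
  show "9 \<le> g"
  proof (rule ccontr)
    assume "\<not> 9 \<le> g"
    hence "0.569 * g\<^sup>2 \<le> (9.569 - g) * g\<^sup>2" by (intro mult_right_mono) auto
    hence "0.569 * g\<^sup>2 < 1" using less by (simp add: algebra_simps)
    hence "g\<^sup>2 < 2\<^sup>2" by simp
    hence "g < 2" by (rule power_less_imp_less_base) simp
    hence "7.569 * 1 \<le> (9.569 - g) * g\<^sup>2" using g(1) by (intro mult_mono) auto
    thus False using less by (simp add: algebra_simps)
  qed
  hence "9\<^sup>2 \<le> g\<^sup>2" by (intro power_mono) auto
  thus "9.5 * g\<^sup>2 \<le> t" using tg by simp
qed

text \<open>The degree j is just large enough for the decay exp(-2j/(sqrt t + 1)) on the segment.
  The last condition says that i factors of modulus exp(-t/(2\<kappa>)) absorb the growth exp j and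
  still leave the required decay. There is room for both since sqrt t is at least 3 g, hence at
  least 27.\<close>

lemma chebyshev_degree:
  assumes tg: "9.569 * g\<^sup>2 < t + 1" and Ng: "1 / 2 < 0.209 * real N / g\<^sup>2"
  obtains i j where "i + j = N - 2" "0.209 * real N / g\<^sup>2 \<le> 2 * real j / (sqrt t + 1)"
    "0.209 * real N / g\<^sup>2 + real j \<le> real i * t / (2 * \<kappa>)"
proof -
  note lt = large_t[OF tg]
  define s where "s = sqrt t"
  define c where "c = real N / g\<^sup>2"
  have g2: "0 < g\<^sup>2" "0 < g" using g(1) by auto
  have s: "s\<^sup>2 = t" "0 < s" using t by (auto simp: s_def)
  have "9 * g\<^sup>2 \<le> t" using lt(2) zero_le_power2[of g] by linarith
  hence s_ge: "3 * g \<le> s" unfolding s_def by (intro real_le_rsqrt) (simp add: power_mult_distrib)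
  hence s27: "27 \<le> s" using lt by simp
  have c: "1 < 0.418 * c" using Ng by (simp add: c_def)
  have N_eq: "real N = c * g\<^sup>2" using g2 by (simp add: c_def)
  have "9\<^sup>2 \<le> g\<^sup>2" using lt by (intro power_mono) auto
  hence "2 * 81 \<le> c * g\<^sup>2" using c by (intro mult_mono) auto
  hence N162: "162 \<le> real N" by (simp add: N_eq)
  \<comment> \<open>The constant 0.1045 is 0.209/2: this is the least j that satisfies the second
    claim.\<close>
  define j where "j = nat \<lceil>0.1045 * c * (s + 1)\<rceil>"
  have j_ge: "0.1045 * c * (s + 1) \<le> real j" unfolding j_def by (rule real_nat_ceiling_ge)
  have "real j \<le> 0.1045 * c * (s + 1) + 1"
  proof -
    have "0 \<le> 0.1045 * c * (s + 1)" using c s by simp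
    thus ?thesis unfolding j_def by linarith
  qed
  \<comment> \<open>The 1 lost by rounding up is absorbed here. This is where the exclusion of the
    trivial case, 1/2 < 0.209 c, enters.\<close>
  also have "\<dots> \<le> 0.1045 * c * (s + 1) + 0.418 * c" using c by simp
  also have "\<dots> = c * (0.1045 * s + 0.5225)" by (simp add: field_simps)
  also have "\<dots> \<le> c * (0.125 * s)" using c s27 by (intro mult_left_mono) auto
  finally have j_le: "real j \<le> 0.125 * c * s" by simp
  \<comment> \<open>t \<le> g^3 and g \<ge> 9 make s at most g^2/3, so j takes up only a small part
    of the available degree.\<close>
  have "s\<^sup>2 \<le> g * g\<^sup>2" using t g s by (simp add: power3_eq_cube power2_eq_square)
  also have "\<dots> \<le> g * g\<^sup>2 * (g / 9)" using lt g2 by (simp add: field_simps)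
  also have "\<dots> = (g\<^sup>2 / 3)\<^sup>2" by (simp add: power2_eq_square)
  finally have "s \<le> g\<^sup>2 / 3" by (rule power2_le_imp_le) simp
  hence "0.125 * c * s \<le> 0.125 * c * (g\<^sup>2 / 3)" using c by (intro mult_left_mono) auto
  hence j_N: "real j \<le> real N / 24" using j_le by (simp add: N_eq)
  define i where "i = N - 2 - j"
  have "real (j + 2) \<le> real N" using j_N N162 by simp
  hence jN: "j + 2 \<le> N" by linarith
  hence i_j: "i + j = N - 2" by (simp add: i_def)
  have "real i = real N - 2 - real j" using jN by (simp add: i_def)
  hence i_ge: "c * g\<^sup>2 / 2 \<le> real i" using j_N N162 by (simp flip: N_eq)
  \<comment> \<open>Replacing g by its bound s/3 makes both terms comparable with c s^2. The target
    c s^2/4 divided by g is the guaranteed part c g^2/2 of i times t/(2\<kappa>).\<close>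
  have "0.209 * c * g + 0.125 * c * s * g \<le> 0.209 * c * (s / 3) + 0.125 * c * s * (s / 3)"
    using s_ge c s by (intro add_mono mult_left_mono) auto
  also have "\<dots> \<le> c * s\<^sup>2 / 4"
  proof -
    have "0.209 * (c * s) \<le> 0.1 * (c * s * s)" using s27 c by (simp add: mult_ac)
    moreover have "0 \<le> c * s * s" using c s(2) by simp
    moreover have "0.209 / 3 * x + 0.125 / 3 * z \<le> z / 4" if "0.209 * x \<le> 0.1 * z" "0 \<le> z" for x z :: real
      using that by simp
    ultimately have "0.209 / 3 * (c * s) + 0.125 / 3 * (c * s * s) \<le> c * s * s / 4" by blast
    thus ?thesis by (simp add: power2_eq_square)
  qed
  finally have "(0.209 * c + 0.125 * c * s) * g \<le> c * s\<^sup>2 / 4" by (simp add: algebra_simps)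
  hence "0.209 * c + 0.125 * c * s \<le> c * s\<^sup>2 / 4 / g" using g2 by (simp add: pos_le_divide_eq)
  also have "\<dots> = (c * g\<^sup>2 / 2) * t / (2 * \<kappa>)"
  proof -
    have "c * y / 4 / x = (c * x\<^sup>2 / 2) * y / (2 * x ^ 3)" if "0 < x" for x y :: real
      using that by (simp add: power3_eq_cube power2_eq_square)
    from this[OF g2(2), of t] show ?thesis by (simp only: g(2) s(1))
  qed
  also have "\<dots> \<le> real i * t / (2 * \<kappa>)"
    using i_ge t by (intro divide_right_mono mult_right_mono) auto
  finally have "0.209 * c + real j \<le> real i * t / (2 * \<kappa>)" using j_le by simp
  moreover have "0.209 * c \<le> 2 * real j / (s + 1)" using j_ge s by (simp add: pos_le_divide_eq)
  ultimately show ?thesis using that[OF i_j] by (simp add: c_def s_def)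
qed

text \<open>1/a = (t + 1)/(t - 1) is (y + 1/y)/2 for y = (sqrt t + 1)/(sqrt t - 1), so the Chebyshev
  polynomial has its explicit form there. The square root is the usual gain of Chebyshev polynomials
  over powers.\<close>

lemma chebyshev_inverse_a_ge:
  assumes "1 < t"
  shows "((sqrt t + 1) / (sqrt t - 1)) ^ j / 2 \<le> chebyshev j (1 / a)"
    "0 < chebyshev j (1 / a)"
proof -
  have s: "1 < sqrt t" using assms by simp
  have t_eq: "t = (sqrt t)\<^sup>2" using assms by simp
  have "((s + 1) / (s - 1) + 1 / ((s + 1) / (s - 1))) / 2 = 1 / ((s\<^sup>2 - 1) / (s\<^sup>2 + 1))"
    if "1 < s" for s :: real
  proof -
    have pq: "(p / q + 1 / (p / q)) / 2 = 1 / (p * q / ((p\<^sup>2 + q\<^sup>2) / 2))" if "0 < p" "0 < q" for p q :: real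
      using that by (simp add: field_simps power2_eq_square)
    have e: "(s + 1) * (s - 1) = s\<^sup>2 - 1" "((s + 1)\<^sup>2 + (s - 1)\<^sup>2) / 2 = s\<^sup>2 + 1"
      by (simp_all add: power2_eq_square algebra_simps)
    have "0 < s + 1" "0 < s - 1" using that by auto
    from pq[OF this] show ?thesis unfolding e .
  qed
  from this[OF s] have "((sqrt t + 1) / (sqrt t - 1) + 1 / ((sqrt t + 1) / (sqrt t - 1))) / 2 = 1 / a"
    unfolding a_def t_eq[symmetric] .
  moreover have y: "0 < (sqrt t + 1) / (sqrt t - 1)" using s by (intro divide_pos_pos) linarith+
  ultimately show *: "((sqrt t + 1) / (sqrt t - 1)) ^ j / 2 \<le> chebyshev j (1 / a)"
    using chebyshev_ge[OF y, of j] by simp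
  have "0 < ((sqrt t + 1) / (sqrt t - 1)) ^ j / 2" using y by simp
  thus "0 < chebyshev j (1 / a)" using * by linarith
qed

text \<open>On the segment the Chebyshev factor is at most 1 and the normalization 1/T_j(1/a) \<le>
  2 exp(-2j/(sqrt t + 1)) provides the decay. In the disk the power \<lambda>^i provides it and also
  pays for the growth (5/2)^j. The factor 2 is the one from T_j(1/a) \<ge> y^j/2.\<close>

lemma chebyshev_residual:
  assumes tg: "9.569 * g\<^sup>2 < t + 1"
    and j1: "0.209 * real N / g\<^sup>2 \<le> 2 * real j / (sqrt t + 1)"
    and j2: "0.209 * real N / g\<^sup>2 + real j \<le> real i * t / (2 * \<kappa>)"
    and e: "admissible e"
  shows "cmod (e ^ i * chebyshev j (e / of_real a) / of_real (chebyshev j (1 / a)))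
      \<le> 2 * rate powr (0.209 * real N)"
proof -
  note lt = large_t[OF tg]
  have "1 \<le> g\<^sup>2" using g(1) by simp
  hence t9: "9 \<le> t" using lt(2) by simp
  define s where "s = sqrt t"
  have s: "s\<^sup>2 = t" "3 \<le> s" using t9 by (auto simp: s_def real_le_rsqrt)
  define y where "y = (s + 1) / (s - 1)"
  have y: "0 < y" using s by (simp add: y_def)
  have a_pos: "0 < a" using t9 by (simp add: a_def)
  have T_ge: "y ^ j / 2 \<le> chebyshev j (1 / a)" and T_pos: "0 < chebyshev j (1 / a)"
    using chebyshev_inverse_a_ge[of j] t9 by (simp_all add: y_def s_def)
  have "exp (2 / (s + 1)) * (1 - 2 / (s + 1)) \<le> exp (2 / (s + 1)) * exp (- (2 / (s + 1)))"
    by (intro mult_left_mono exp_minus_ge_1_minus) auto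
  also have "\<dots> = 1" by (simp flip: exp_add)
  finally have "exp (2 / (s + 1)) \<le> 1 / (1 - 2 / (s + 1))" using s by (simp add: field_simps)
  also have "\<dots> = y" using s by (simp add: y_def field_simps)
  finally have "exp (2 / (s + 1)) ^ j \<le> y ^ j" by (intro power_mono) auto
  hence "exp (2 * real j / (s + 1)) / 2 \<le> chebyshev j (1 / a)"
    using T_ge by (simp add: mult_ac flip: exp_of_nat_mult)
  hence inv: "1 / chebyshev j (1 / a) \<le> 2 * exp (- (2 * real j / (s + 1)))"
    using T_pos by (simp add: exp_minus field_simps)
  have small: "cmod (e / of_real a) \<le> 1"
    using e a_pos by (simp add: admissible_def norm_divide)
  have norm_eq: "cmod (e ^ i * chebyshev j (e / of_real a) / of_real (chebyshev j (1 / a)))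
      = cmod e ^ i * cmod (chebyshev j (e / of_real a)) * (1 / chebyshev j (1 / a))"
    using T_pos by (simp add: norm_mult norm_divide norm_power)
  have goal: ?thesis if "cmod e ^ i * cmod (chebyshev j (e / of_real a)) \<le> M"
    "M * exp (- (2 * real j / (s + 1))) \<le> exp (- (0.209 * real N / g\<^sup>2))" for M
  proof -
    have "cmod e ^ i * cmod (chebyshev j (e / of_real a)) * (1 / chebyshev j (1 / a))
        \<le> M * (2 * exp (- (2 * real j / (s + 1))))"
      using that(1) inv T_pos by (intro mult_mono) (auto intro: order_trans[OF _ that(1)])
    also have "\<dots> \<le> 2 * exp (- (0.209 * real N / g\<^sup>2))" using that(2) by simp
    also have "\<dots> \<le> 2 * rate powr (0.209 * real N)" using rate_powr_ge[of "0.209 * real N"] by simp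
    finally show ?thesis unfolding norm_eq .
  qed
  show ?thesis
  proof (cases "Im e = 0")
    case True
    then obtain x where x: "e = of_real x" by (metis complex_is_Real_iff Reals_cases)
    have "cmod (chebyshev j (e / of_real a)) = \<bar>chebyshev j (x / a)\<bar>"
      by (simp add: x of_real_chebyshev flip: of_real_divide)
    also have "\<dots> \<le> 1" using small by (intro abs_chebyshev_le_1) (simp add: x norm_divide)
    finally have "cmod e ^ i * cmod (chebyshev j (e / of_real a)) \<le> 1 * 1"
      using e a by (intro mult_mono power_le_one) (auto simp: admissible_def)
    thus ?thesis using j1 by (intro goal[of 1]) (auto simp: s_def)
  next
    case False
    have "(cmod e)\<^sup>2 \<le> a * b" using e False by (simp add: admissible_def)
    also have "\<dots> \<le> 1 * b" using a by (intro mult_right_mono) auto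
    also have "b = 1 - 2 * t / (\<kappa> + t)" using t by (simp add: b_def field_simps)
    also have "1 * (1 - 2 * t / (\<kappa> + t)) \<le> 1 - t / \<kappa>"
    proof -
      have "t / \<kappa> = 2 * t / (2 * \<kappa>)" by simp
      also have "\<dots> \<le> 2 * t / (\<kappa> + t)" using t by (intro divide_left_mono) auto
      finally show ?thesis by simp
    qed
    also have "\<dots> \<le> exp (- (t / \<kappa>))" by (rule exp_minus_ge_1_minus)
    also have "\<dots> = (exp (- (t / (2 * \<kappa>))))\<^sup>2" by (simp add: power2_eq_square flip: exp_add)
    finally have "cmod e \<le> exp (- (t / (2 * \<kappa>)))" by (rule power2_le_imp_le) simp
    hence "cmod e ^ i \<le> exp (- (t / (2 * \<kappa>))) ^ i" by (intro power_mono) auto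
    also have "\<dots> = exp (- (real i * t / (2 * \<kappa>)))" by (simp flip: exp_of_nat_mult)
    finally have ei: "cmod e ^ i \<le> exp (- (real i * t / (2 * \<kappa>)))" .
    have "(5 / 2 :: real) \<le> exp 1"
      using exp_lower_Taylor_quadratic[of "1 :: real"] by simp
    hence "(5 / 2) ^ j \<le> exp (1 :: real) ^ j" by (intro power_mono) auto
    hence "cmod (chebyshev j (e / of_real a)) \<le> exp (real j)"
      using norm_chebyshev_le[OF small, of j] by (simp flip: exp_of_nat_mult)
    with ei have "cmod e ^ i * cmod (chebyshev j (e / of_real a))
        \<le> exp (- (real i * t / (2 * \<kappa>))) * exp (real j)" by (intro mult_mono) auto
    also have "\<dots> = exp (real j - real i * t / (2 * \<kappa>))" by (simp flip: exp_add)
    finally show ?thesis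
    proof (rule goal)
      \<comment> \<open>Off the real axis the decay of 1/T_j(1/a) is given away; only its bound 2 is
        kept.\<close>
      have "0 \<le> 2 * real j / (s + 1)" using s by simp
      thus "exp (real j - real i * t / (2 * \<kappa>)) * exp (- (2 * real j / (s + 1)))
          \<le> exp (- (0.209 * real N / g\<^sup>2))"
        using j2 unfolding exp_add[symmetric] exp_le_cancel_iff by linarith
    qed
  qed
qed

text \<open>The factor \<open>2z - 1\<close> turns the bound in \<open>\<lambda>\<close> into one in \<open>z = (1 + \<lambda>) / 2\<close>.\<close>

lemma residual_polynomial_exists:
  obtains q :: "real poly" where "degree q \<le> N - 2" "poly q 1 = 1"
    "\<And>e. admissible e \<Longrightarrow> cmod (poly (map_poly complex_of_real q) ((1 + e) / 2))
        \<le> 2 * rate powr (0.209 * real N)"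
proof -
  define L :: "real poly" where "L = [:-1, 2:]"
  have L1: "poly L 1 = 1" by (simp add: L_def)
  have Le: "poly (map_poly complex_of_real L) ((1 + e) / 2) = e" for e
    by (simp add: L_def hom_distribs field_simps)
  have degL: "degree L \<le> 1" by (simp add: L_def)
  have deg_pow: "degree (L ^ i) \<le> i" for i
    using order_trans[OF degree_power_le mult_right_mono[OF degL, of i]] by simp
  consider "t + 1 \<le> 9.569 * g\<^sup>2" | "0.209 * real N / g\<^sup>2 \<le> 1 / 2"
    | "9.569 * g\<^sup>2 < t + 1" "1 / 2 < 0.209 * real N / g\<^sup>2" by linarith
  thus ?thesis
  proof cases
    case 1
    show ?thesis
    proof (rule that[of "L ^ (N - 2)"])
      show "cmod (poly (map_poly complex_of_real (L ^ (N - 2))) ((1 + e) / 2))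
          \<le> 2 * rate powr (0.209 * real N)"
        if "admissible e" for e
        using power_residual[OF 1 that] by (simp add: of_real_poly_hom.hom_power Le norm_power)
    qed (use deg_pow in \<open>auto simp: L1\<close>)
  next
    case 2
    show ?thesis by (rule that[of 1]) (use trivial_residual[OF 2] in auto)
  next
    case 3
    obtain i j where ij: "i + j = N - 2" "0.209 * real N / g\<^sup>2 \<le> 2 * real j / (sqrt t + 1)"
      "0.209 * real N / g\<^sup>2 + real j \<le> real i * t / (2 * \<kappa>)"
      using chebyshev_degree[OF 3] .
    define T where "T = chebyshev j (1 / a)"
    \<comment> \<open>The points z = 1 and \<lambda> = 1 correspond, where the Chebyshev argument
      \<lambda>/a is 1/a; dividing by T therefore gives q(1) = 1.\<close>
    define q where "q = Polynomial.smult (1 / T) (L ^ i * chebyshev j (Polynomial.smult (1 / a) L))"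
    have T0: "T \<noteq> 0"
    proof -
      have g1: "1 \<le> g\<^sup>2" using g(1) by simp
      have "1 < t" using large_t(2)[OF 3(1)] g1 by simp
      thus ?thesis using chebyshev_inverse_a_ge(2)[of j] by (simp add: T_def)
    qed
    show ?thesis
    proof (rule that[of q])
      have "degree q \<le> degree (L ^ i) + degree (chebyshev j (Polynomial.smult (1 / a) L))"
        unfolding q_def by (rule order_trans[OF degree_smult_le degree_mult_le])
      also have "\<dots> \<le> i + j"
        using degL by (intro add_mono deg_pow degree_chebyshev) (meson degree_smult_le order_trans)
      finally show "degree q \<le> N - 2" by (simp add: ij)
      show "poly q 1 = 1" using T0 by (simp add: q_def poly_chebyshev L1 T_def)
      fix e assume e: "admissible e"
      have "poly (map_poly complex_of_real q) ((1 + e) / 2)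
          = e ^ i * chebyshev j (e / of_real a) / of_real T"
        by (simp add: q_def of_real_hom.map_poly_hom_smult of_real_poly_hom.hom_mult
          of_real_poly_hom.hom_power map_poly_chebyshev poly_chebyshev Le)
      thus "cmod (poly (map_poly complex_of_real q) ((1 + e) / 2)) \<le> 2 * rate powr (0.209 * real N)"
        using chebyshev_residual[OF 3(1) ij(2,3) e] by (simp add: T_def)
    qed
  qed
qed

end

section \<open>Polynomials in a matrix and GMRES\<close>

text \<open>p(A) v by Horner's scheme. Only the vector p(A) v is ever used, and the starting value
  takes its dimension from v.\<close>

definition poly_vec :: "'a :: comm_ring_1 poly \<Rightarrow> 'a mat \<Rightarrow> 'a vec \<Rightarrow> 'a vec" where
  "poly_vec p A v = foldr (\<lambda>c w. c \<cdot>\<^sub>v v + A *\<^sub>v w) (coeffs p) (0\<^sub>v (dim_vec v))"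

lemma poly_vec_0 [simp]: "poly_vec 0 A v = 0\<^sub>v (dim_vec v)"
  by (simp add: poly_vec_def)

lemma zero_smult_vec: "0 \<cdot>\<^sub>v v = 0\<^sub>v (dim_vec v)" for v :: "'a :: comm_ring_1 vec"
  by (intro eq_vecI) auto

lemma mult_zero_vec: "A \<in> carrier_mat n k \<Longrightarrow> A *\<^sub>v 0\<^sub>v k = 0\<^sub>v n" for A :: "'a :: comm_ring_1 mat"
  by (intro eq_vecI) auto

lemma poly_vec_pCons:
  assumes A: "A \<in> carrier_mat n n" and v: "v \<in> carrier_vec n"
  shows "poly_vec (pCons c p) A v = c \<cdot>\<^sub>v v + A *\<^sub>v poly_vec p A v"
proof (cases "c = 0 \<and> p = 0")
  case True
  thus ?thesis using v mult_zero_vec[OF A] by (simp add: zero_smult_vec)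
next
  case False
  hence "coeffs (pCons c p) = c # coeffs p" by auto
  thus ?thesis by (simp add: poly_vec_def)
qed

lemma poly_vec_carrier:
  assumes A: "A \<in> carrier_mat n n" and v: "v \<in> carrier_vec n"
  shows "poly_vec p A v \<in> carrier_vec n"
proof (induction p)
  case (pCons c p)
  thus ?case using A v by (simp add: poly_vec_pCons[OF A v])
qed (use v in simp)

text \<open>The homomorphism \<open>h\<close> is the identity or the embedding of the reals into the complex numbers.\<close>

lemma poly_vec_intertwine:
  fixes h :: "'a :: comm_ring_1 \<Rightarrow> 'b :: comm_ring_1"
  assumes A: "A \<in> carrier_mat n n" and v: "v \<in> carrier_vec n"
    and B: "B \<in> carrier_mat k k" and f: "\<And>u. u \<in> carrier_vec n \<Longrightarrow> f u \<in> carrier_vec k"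
    and h0: "h 0 = 0"
    and add: "\<And>u w. u \<in> carrier_vec n \<Longrightarrow> w \<in> carrier_vec n \<Longrightarrow> f (u + w) = f u + f w"
    and smult: "\<And>c u. u \<in> carrier_vec n \<Longrightarrow> f (c \<cdot>\<^sub>v u) = h c \<cdot>\<^sub>v f u"
    and AB: "\<And>u. u \<in> carrier_vec n \<Longrightarrow> f (A *\<^sub>v u) = B *\<^sub>v f u"
  shows "f (poly_vec p A v) = poly_vec (map_poly h p) B (f v)"
proof (induction p)
  case 0
  have "f (0\<^sub>v n) = h 0 \<cdot>\<^sub>v f (0\<^sub>v n)" using smult[of "0\<^sub>v n" 0] by (simp add: zero_smult_vec)
  also have "\<dots> = 0\<^sub>v k" using f[of "0\<^sub>v n"] by (simp add: h0 zero_smult_vec)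
  finally show ?case using v f[OF v] by simp
next
  case (pCons c p)
  have p: "poly_vec p A v \<in> carrier_vec n" using A v by (rule poly_vec_carrier)
  have "f (poly_vec (pCons c p) A v) = h c \<cdot>\<^sub>v f v + B *\<^sub>v f (poly_vec p A v)"
    using A v p by (simp add: poly_vec_pCons[OF A v] add smult AB)
  also have "\<dots> = poly_vec (map_poly h (pCons c p)) B (f v)"
    using pCons(1) by (simp add: map_poly_pCons[OF pCons(1)] pCons(2) poly_vec_pCons[OF B f[OF v]])
  finally show ?case .
qed

lemma mult_mat_smult_vec:
  fixes A :: "'a :: comm_ring_1 mat"
  assumes "A \<in> carrier_mat n k" "v \<in> carrier_vec k"
  shows "A *\<^sub>v (c \<cdot>\<^sub>v v) = c \<cdot>\<^sub>v (A *\<^sub>v v)"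
  using assms by (intro eq_vecI) auto

lemma poly_vec_mult_mat:
  assumes A: "A \<in> carrier_mat n n" and B: "B \<in> carrier_mat k k" and X: "X \<in> carrier_mat k n"
    and AB: "X * A = B * X" and v: "v \<in> carrier_vec n"
  shows "X *\<^sub>v poly_vec p A v = poly_vec p B (X *\<^sub>v v)"
proof -
  have "X *\<^sub>v poly_vec p A v = poly_vec (map_poly (\<lambda>c. c) p) B (X *\<^sub>v v)"
  proof (rule poly_vec_intertwine[OF A v B])
    show "X *\<^sub>v (A *\<^sub>v u) = B *\<^sub>v (X *\<^sub>v u)" if "u \<in> carrier_vec n" for u
      using that A B X AB by (simp flip: assoc_mult_mat_vec)
  qed (use X in \<open>auto simp: mult_add_distrib_mat_vec[OF X] mult_mat_smult_vec[OF X]\<close>)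
  thus ?thesis by (simp add: map_poly_idI)
qed

lemma poly_vec_diagonal:
  assumes L: "L \<in> carrier_mat n n" "diagonal_mat L" and v: "v \<in> carrier_vec n" and i: "i < n"
  shows "poly_vec p L v $ i = poly p (L $$ (i, i)) * v $ i"
proof (induction p)
  case (pCons c p)
  have p: "poly_vec p L v \<in> carrier_vec n" using L v by (intro poly_vec_carrier)
  have "(L *\<^sub>v poly_vec p L v) $ i = (\<Sum>j<n. L $$ (i, j) * poly_vec p L v $ j)"
    using L i p by (simp add: scalar_prod_def lessThan_atLeast0)
  also have "\<dots> = (\<Sum>j<n. if j = i then L $$ (i, i) * poly_vec p L v $ i else 0)"
    using L i by (intro sum.cong) (auto simp: diagonal_mat_def)
  also have "\<dots> = L $$ (i, i) * (poly p (L $$ (i, i)) * v $ i)" using i pCons(2) by simp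
  finally show ?case using i v L p by (simp add: poly_vec_pCons[OF L(1) v] algebra_simps)
qed (use v i in simp)

lemma vec_norm2_mono:
  assumes "v \<in> carrier_vec n" "w \<in> carrier_vec n" "0 \<le> c"
    and "\<And>i. i < n \<Longrightarrow> norm (v $ i) \<le> c * norm (w $ i)"
  shows "vec_norm2 v \<le> c * vec_norm2 w"
  unfolding vec_norm2_def using assms by (auto simp: L2_set_right_distrib intro!: L2_set_mono)

text \<open>The polynomial, F and v are real, only the eigenbasis is complex. After the
  norm-preserving embedding, p(F) v = X p(\<Lambda>) X^-1 v, and p(\<Lambda>) scales each coordinate
  by at most c in modulus.\<close>

lemma poly_vec_diagonalizable_norm:
  fixes F :: "real mat" and X \<Lambda> :: "complex mat"
  assumes F: "F \<in> carrier_mat n n" and X: "X \<in> carrier_mat n n" "det X \<noteq> 0"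
    and L: "\<Lambda> \<in> carrier_mat n n" "diagonal_mat \<Lambda>"
    and eig: "X * \<Lambda> = map_mat complex_of_real F * X"
    and bound: "\<And>i. i < n \<Longrightarrow> cmod (poly (map_poly complex_of_real p) (\<Lambda> $$ (i, i))) \<le> c" and c: "0 \<le> c"
    and v: "v \<in> carrier_vec n"
  shows "vec_norm2 (poly_vec p F v) \<le> c * cond2 X * vec_norm2 v"
proof -
  let ?p = "map_poly complex_of_real p" and ?v = "map_vec complex_of_real v"
  note i = mat_inv_det[OF X]
  define u where "u = mat_inv X *\<^sub>v ?v"
  have u: "u \<in> carrier_vec n" using i v by (simp add: u_def)
  have Fc: "map_mat complex_of_real F \<in> carrier_mat n n" using F by simp
  have "map_vec complex_of_real (poly_vec p F v) = poly_vec ?p (map_mat complex_of_real F) ?v"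
    by (rule poly_vec_intertwine[OF F v Fc])
      (use F in \<open>auto intro!: eq_vecI simp: scalar_prod_def\<close>)
  also have "?v = X *\<^sub>v u" unfolding u_def using mat_inv_cancel(1)[OF X] v by simp
  also have "poly_vec ?p (map_mat complex_of_real F) (X *\<^sub>v u) = X *\<^sub>v poly_vec ?p \<Lambda> u"
    by (rule poly_vec_mult_mat[OF L(1) Fc X(1) eig u, symmetric])
  finally have "vec_norm2 (poly_vec p F v) = vec_norm2 (X *\<^sub>v poly_vec ?p \<Lambda> u)"
    by (metis vec_norm2_of_real)
  also have "\<dots> \<le> mat_norm2 X * vec_norm2 (poly_vec ?p \<Lambda> u)"
    by (rule vec_norm2_mult_le[OF X(1) poly_vec_carrier[OF L(1) u]])
  also have "\<dots> \<le> mat_norm2 X * (c * vec_norm2 u)"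
    using bound c
    by (intro mult_left_mono vec_norm2_mono[OF poly_vec_carrier[OF L(1) u] u])
      (auto simp: poly_vec_diagonal[OF L u] norm_mult intro!: mult_right_mono)
  also have "\<dots> \<le> mat_norm2 X * (c * (mat_norm2 (mat_inv X) * vec_norm2 ?v))"
    unfolding u_def using c v by (intro mult_left_mono vec_norm2_mult_le[OF i(1)]) auto
  finally show ?thesis by (simp add: vec_norm2_of_real cond2_def mult_ac)
qed

section \<open>Krylov spaces and the residual of GMRES\<close>

locale krylov =
  fixes W :: "real mat" and v :: "real vec" and n :: nat
  assumes W: "W \<in> carrier_mat n n" and v: "v \<in> carrier_vec n"
begin

sublocale vec_space "TYPE(real)" n .

lemma krylov_span: "krylov_space W v k = span {(W ^\<^sub>m j) *\<^sub>v v | j. j < k}"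
  using W by (simp add: krylov_space_def)

lemma krylov_generators: "{(W ^\<^sub>m j) *\<^sub>v v | j. j < k} \<subseteq> carrier_vec n"
  using W v by (auto intro: mult_mat_vec_carrier[OF pow_carrier_mat])

lemma krylov_carrier: "d \<in> krylov_space W v k \<Longrightarrow> d \<in> carrier_vec n"
  using span_is_subset2[OF krylov_generators] by (auto simp: krylov_span)

lemma krylov_add: "d \<in> krylov_space W v k \<Longrightarrow> d' \<in> krylov_space W v k \<Longrightarrow> d + d' \<in> krylov_space W v k"
  using span_add1[of "{(W ^\<^sub>m j) *\<^sub>v v | j. j < k}" d d'] krylov_generators[of k] by (simp add: krylov_span)

lemma krylov_smult: "d \<in> krylov_space W v k \<Longrightarrow> c \<cdot>\<^sub>v d \<in> krylov_space W v k"
  using smult_in_span[OF krylov_generators] by (simp add: krylov_span)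

lemma krylov_zero: "0\<^sub>v n \<in> krylov_space W v k"
  using span_zero[of "{(W ^\<^sub>m j) *\<^sub>v v | j. j < k}"] by (simp add: krylov_span)

lemma krylov_mono: "k \<le> k' \<Longrightarrow> krylov_space W v k \<subseteq> krylov_space W v k'"
  unfolding krylov_span by (intro span_is_monotone) auto

lemma krylov_start: "0 < k \<Longrightarrow> v \<in> krylov_space W v k"
proof -
  assume k: "0 < k"
  have "(W ^\<^sub>m 0) *\<^sub>v v = v" using W v by simp
  hence "v \<in> {(W ^\<^sub>m j) *\<^sub>v v | j. j < k}" using k by (metis (mono_tags, lifting) mem_Collect_eq)
  thus ?thesis using in_own_span[OF krylov_generators[of k]] by (auto simp: krylov_span)
qed

text \<open>The preimage of the larger Krylov space under W is a submodule, so it is enough to look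
  at the generators.\<close>

lemma krylov_mult:
  assumes "d \<in> krylov_space W v k"
  shows "W *\<^sub>v d \<in> krylov_space W v (Suc k)"
proof -
  define N where "N = {d \<in> carrier_vec n. W *\<^sub>v d \<in> krylov_space W v (Suc k)}"
  have "span {(W ^\<^sub>m j) *\<^sub>v v | j. j < k} \<subseteq> N"
  proof (rule span_is_subset)
    show "{(W ^\<^sub>m j) *\<^sub>v v | j. j < k} \<subseteq> N"
    proof
      fix x assume "x \<in> {(W ^\<^sub>m j) *\<^sub>v v | j. j < k}"
      then obtain j where j: "x = (W ^\<^sub>m j) *\<^sub>v v" "j < k" by auto
      have c: "W ^\<^sub>m j \<in> carrier_mat n n" using W by simp
      \<comment> \<open>Powers unfold with the new factor on the right, so W has to be moved past
        the power.\<close>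
      have "W * W ^\<^sub>m j = W ^\<^sub>m Suc j" 
        by (induction j) (use W in \<open>auto simp: assoc_mult_mat[of W n n _ n W n, symmetric]\<close>)
      hence "W *\<^sub>v x = (W ^\<^sub>m Suc j) *\<^sub>v v"
        using assoc_mult_mat_vec[OF W c v] j by simp
      moreover have "(W ^\<^sub>m Suc j) *\<^sub>v v \<in> krylov_space W v (Suc k)"
        using in_own_span[OF krylov_generators[of "Suc k"]] j(2) unfolding krylov_span by blast
      ultimately show "x \<in> N" using c v by (simp add: N_def j(1))
    qed
    show "submodule class_ring N V"
    proof (unfold_locales, goal_cases)
      case 1
      show ?case by (auto simp: N_def)
    next
      case (2 x y)
      thus ?case by (simp add: N_def mult_add_distrib_mat_vec[OF W] krylov_add)
    next
      case 3
      thus ?case by (simp add: N_def mult_zero_vec[OF W] krylov_zero)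
    next
      case (4 c x)
      thus ?case by (simp add: N_def mult_mat_vec[OF W] krylov_smult)
    qed
  qed
  thus ?thesis using assms by (auto simp: krylov_span[of k] N_def)
qed

text \<open>A polynomial of degree at most \<open>k\<close> in \<open>G = I - W\<close> with value 1 at 1 is a residual polynomial
  in \<open>W\<close>.\<close>

lemma poly_vec_residual:
  assumes G: "G = 1\<^sub>m n - W" and deg: "degree p \<le> k"
  shows "\<exists>d \<in> krylov_space W v k. poly_vec p G v + W *\<^sub>v d = poly p 1 \<cdot>\<^sub>v v"
  using deg
proof (induction p arbitrary: k)
  case 0
  show ?case using krylov_zero v W by (intro bexI[of _ "0\<^sub>v n"]) (auto simp: mult_zero_vec[OF W] zero_smult_vec)
next
  case (pCons c p)
  have Gc: "G \<in> carrier_mat n n" unfolding G by (rule minus_carrier_mat[OF W])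
  note pv = poly_vec_pCons[OF Gc v]
  show ?case
  proof (cases "p = 0")
    case True
    thus ?thesis using krylov_zero v W
      by (intro bexI[of _ "0\<^sub>v n"]) (auto simp: pv mult_zero_vec[OF W] mult_zero_vec[OF Gc])
  next
    case False
    then obtain k' where k: "k = Suc k'" "degree p \<le> k'" using pCons(3) by (cases k) auto
    obtain d where d: "d \<in> krylov_space W v k'" "poly_vec p G v + W *\<^sub>v d = poly p 1 \<cdot>\<^sub>v v"
      using pCons(2)[OF k(2)] by blast
    define w where "w = poly_vec p G v"
    have w: "w \<in> carrier_vec n" unfolding w_def by (rule poly_vec_carrier[OF Gc v])
    have dc: "d \<in> carrier_vec n" using d(1) by (rule krylov_carrier)
    have Wc: "W *\<^sub>v d \<in> carrier_vec n" "W *\<^sub>v w \<in> carrier_vec n" using W dc w by auto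
    have w_eq: "w = poly p 1 \<cdot>\<^sub>v v + (- 1) \<cdot>\<^sub>v (W *\<^sub>v d)"
      using w Wc v carrier_matD[OF W] unfolding d(2)[symmetric] w_def[symmetric] by (intro eq_vecI) auto
    have wk: "w \<in> krylov_space W v k"
      unfolding w_eq using krylov_start[of k] krylov_mult[OF d(1)] k by (intro krylov_add krylov_smult) auto
    have dk: "d \<in> krylov_space W v k" using d(1) krylov_mono[of k' k] k by auto
    have Gw: "G *\<^sub>v w = w - W *\<^sub>v w" unfolding G
      using W w by (simp add: minus_mult_distrib_mat_vec[of _ n n])
    \<comment> \<open>The new polynomial yields c v + G w = c v + w - W w. Adding w to the
      correction d cancels W w, and the induction hypothesis applies to w + W d. The previous lines
      show that w is itself in the Krylov space.\<close>
    have "poly_vec (pCons c p) G v + W *\<^sub>v (d + w) = poly (pCons c p) 1 \<cdot>\<^sub>v v"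
    proof -
      have "poly_vec (pCons c p) G v + W *\<^sub>v (d + w)
          = c \<cdot>\<^sub>v v + (w - W *\<^sub>v w) + (W *\<^sub>v d + W *\<^sub>v w)"
        using dc w by (simp add: pv w_def[symmetric] Gw mult_add_distrib_mat_vec[OF W])
      also have "\<dots> = c \<cdot>\<^sub>v v + (w + W *\<^sub>v d)" using Wc w v by (intro eq_vecI) auto
      also have "w + W *\<^sub>v d = poly p 1 \<cdot>\<^sub>v v" using d(2) by (simp add: w_def)
      also have "c \<cdot>\<^sub>v v + poly p 1 \<cdot>\<^sub>v v = poly (pCons c p) 1 \<cdot>\<^sub>v v"
        by (simp add: add_smult_distrib_vec)
      finally show ?thesis .
    qed
    thus ?thesis using krylov_add[OF dk wk] by blast
  qed
qed

end

text \<open>For the d of \<open>poly_vec_residual\<close>, the competitor u' = u0 + d has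
  preconditioned residual -p(G) \<rho>, where \<rho> is the initial one. In both methods the price
  is one multiplication by the inverse preconditioner, to pass to \<rho>, and one by the
  preconditioner, to return: the left method returns from its own minimal residual, the right method
  from that of u'.\<close>

lemma gmres_residual_le:
  fixes Pre M :: "real mat"
  assumes Pre: "Pre \<in> carrier_mat n n" "det Pre \<noteq> 0" and M: "M \<in> carrier_mat n n"
    and r: "r \<in> carrier_vec n" and u0: "u0 \<in> carrier_vec n"
    and u: "gmres_left_iterate Pre M r u0 k u \<or> gmres_right_iterate Pre M r u0 k u"
    and G: "G = 1\<^sub>m n - mat_inv Pre * M" and p: "degree p \<le> k" "poly p 1 = 1"
    and bound: "\<And>v. v \<in> carrier_vec n \<Longrightarrow> vec_norm2 (poly_vec p G v) \<le> c * vec_norm2 v" and c: "0 \<le> c"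
  shows "vec_norm2 (M *\<^sub>v u - r) \<le> c * cond2 Pre * vec_norm2 (M *\<^sub>v u0 - r)"
proof -
  note i = mat_inv_det[OF Pre]
  define W where "W = mat_inv Pre * M"
  define \<rho> where "\<rho> = mat_inv Pre *\<^sub>v (r - M *\<^sub>v u0)"
  have W: "W \<in> carrier_mat n n" using i M by (simp add: W_def)
  have res: "r - M *\<^sub>v u0 \<in> carrier_vec n" using r M u0 by simp
  have rho: "\<rho> \<in> carrier_vec n" using i res by (simp add: \<rho>_def)
  interpret krylov W \<rho> n using W rho by unfold_locales
  obtain d where d: "d \<in> krylov_space W \<rho> k" "poly_vec p G \<rho> + W *\<^sub>v d = 1 \<cdot>\<^sub>v \<rho>"
    using poly_vec_residual[OF _ p(1), of G] p(2) G W_def by auto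
  have dc: "d \<in> carrier_vec n" using d(1) by (rule krylov_carrier)
  have Gc: "G \<in> carrier_mat n n" unfolding G W_def[symmetric] by (rule minus_carrier_mat[OF W])
  have pc: "poly_vec p G \<rho> \<in> carrier_vec n" using Gc rho by (rule poly_vec_carrier)
  define u' where "u' = u0 + d"
  have u'_in: "u' \<in> gmres_search_space Pre M r u0 k"
    using d(1) by (auto simp: gmres_search_space_def u'_def W_def \<rho>_def)
  have u'_c: "u' \<in> carrier_vec n" using u0 dc by (simp add: u'_def)
  have "mat_inv Pre *\<^sub>v (M *\<^sub>v u' - r) = mat_inv Pre *\<^sub>v (M *\<^sub>v d - (r - M *\<^sub>v u0))"
    using M u0 dc r by (intro arg_cong2[of _ _ _ _ mult_mat_vec]) (auto simp: u'_def mult_add_distrib_mat_vec[OF M])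
  also have "\<dots> = W *\<^sub>v d - \<rho>"
    using i M dc res by (simp add: \<rho>_def W_def mult_minus_distrib_mat_vec[of _ n n])
  also have "\<dots> = W *\<^sub>v d - (poly_vec p G \<rho> + W *\<^sub>v d)" using d(2) by simp
  also have "\<dots> = - poly_vec p G \<rho>"
  proof -
    have "a - (b + a) = - b" if "a \<in> carrier_vec n" "b \<in> carrier_vec n" for a b :: "real vec"
      using that by (intro eq_vecI) auto
    thus ?thesis using pc mult_mat_vec_carrier[OF W dc] by blast
  qed
  finally have eq: "vec_norm2 (mat_inv Pre *\<^sub>v (M *\<^sub>v u' - r)) = vec_norm2 (poly_vec p G \<rho>)" by simp
  have norm_rho: "vec_norm2 \<rho> \<le> mat_norm2 (mat_inv Pre) * vec_norm2 (M *\<^sub>v u0 - r)"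
    unfolding \<rho>_def using vec_norm2_mult_le[OF i(1) res] vec_norm2_minus_commute[of r n "M *\<^sub>v u0"] M u0 r by simp
  have "vec_norm2 (mat_inv Pre *\<^sub>v (M *\<^sub>v u' - r)) \<le> c * vec_norm2 \<rho>"
    unfolding eq by (rule bound[OF rho])
  also have "\<dots> \<le> c * (mat_norm2 (mat_inv Pre) * vec_norm2 (M *\<^sub>v u0 - r))"
    using norm_rho c by (rule mult_left_mono)
  finally have le: "mat_norm2 Pre * vec_norm2 (mat_inv Pre *\<^sub>v (M *\<^sub>v u' - r))
      \<le> c * cond2 Pre * vec_norm2 (M *\<^sub>v u0 - r)"
    using mult_left_mono[of _ _ "mat_norm2 Pre"] by (force simp: cond2_def mult_ac)
  have pre: "vec_norm2 (M *\<^sub>v w - r) \<le> mat_norm2 Pre * vec_norm2 (mat_inv Pre *\<^sub>v (M *\<^sub>v w - r))"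
    if "w \<in> carrier_vec n" for w
  proof -
    have c: "M *\<^sub>v w - r \<in> carrier_vec n" using M that r by simp
    show ?thesis
      using vec_norm2_mult_le[OF Pre(1) mult_mat_vec_carrier[OF i(1) c]] mat_inv_cancel(1)[OF Pre c] by simp
  qed
  have uc: "u \<in> carrier_vec n"
  proof -
    have "u \<in> gmres_search_space Pre M r u0 k"
      using u by (auto simp: gmres_left_iterate_def gmres_right_iterate_def is_arg_min_def)
    thus ?thesis using krylov_carrier u0 by (auto simp: gmres_search_space_def W_def \<rho>_def)
  qed
  from u show ?thesis
  proof
    assume "gmres_left_iterate Pre M r u0 k u"
    hence "vec_norm2 (mat_inv Pre *\<^sub>v (M *\<^sub>v u - r)) \<le> vec_norm2 (mat_inv Pre *\<^sub>v (M *\<^sub>v u' - r))"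
      using u'_in by (auto simp: gmres_left_iterate_def is_arg_min_linorder)
    hence "mat_norm2 Pre * vec_norm2 (mat_inv Pre *\<^sub>v (M *\<^sub>v u - r))
        \<le> mat_norm2 Pre * vec_norm2 (mat_inv Pre *\<^sub>v (M *\<^sub>v u' - r))" by (intro mult_left_mono) auto
    with pre[OF uc] le show ?thesis by linarith
  next
    assume "gmres_right_iterate Pre M r u0 k u"
    hence "vec_norm2 (M *\<^sub>v u - r) \<le> vec_norm2 (M *\<^sub>v u' - r)"
      using u'_in by (auto simp: gmres_right_iterate_def is_arg_min_linorder)
    with pre[OF u'_c] le show ?thesis by linarith
  qed
qed

section \<open>The ADMM iteration\<close>

lemma mat_inv_symmetric:
  fixes S :: "real mat"
  assumes S: "S \<in> carrier_mat n n" "S\<^sup>T = S" and d: "det S \<noteq> 0"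
  shows "(mat_inv S)\<^sup>T = mat_inv S"
proof -
  note i = mat_inv_det[OF S(1) d]
  have "(mat_inv S)\<^sup>T * S = (S * mat_inv S)\<^sup>T"
    using transpose_mult[OF S(1) i(1)] S(2) by simp
  hence "(mat_inv S)\<^sup>T * S = 1\<^sub>m n" by (simp add: i(2))
  from mat_invI[OF S(1) _ this] i(1) show ?thesis by simp
qed

section \<open>Block matrices acting on stacked vectors\<close>

lemma append_cols3_carrier:
  "X \<in> carrier_mat n a \<Longrightarrow> Y \<in> carrier_mat n b \<Longrightarrow> Z \<in> carrier_mat n c \<Longrightarrow>
    X @\<^sub>c Y @\<^sub>c Z \<in> carrier_mat n (a + (b + c))"
  by simp

lemma append_cols3_mult_vec:
  fixes X :: "'a :: comm_ring_1 mat"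
  assumes "X \<in> carrier_mat n a" "Y \<in> carrier_mat n b" "Z \<in> carrier_mat n c"
    and "x \<in> carrier_vec a" "y \<in> carrier_vec b" "z \<in> carrier_vec c"
  shows "(X @\<^sub>c Y @\<^sub>c Z) *\<^sub>v (x @\<^sub>v y @\<^sub>v z) = X *\<^sub>v x + (Y *\<^sub>v y + Z *\<^sub>v z)"
  using assms by (simp add: append_cols_mult_vec[of _ n a _ "b + c"] append_cols_mult_vec[of _ n b _ c])

lemma append_rows3_mult_vec:
  fixes X :: "'a :: comm_ring_1 mat"
  assumes "X \<in> carrier_mat a n" "Y \<in> carrier_mat b n" "Z \<in> carrier_mat c n" "v \<in> carrier_vec n"
  shows "(X @\<^sub>r Y @\<^sub>r Z) *\<^sub>v v = (X *\<^sub>v v) @\<^sub>v (Y *\<^sub>v v) @\<^sub>v (Z *\<^sub>v v)"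
  using assms by (simp add: mat_mult_append[of _ a n _ "b + c"] mat_mult_append[of _ b n _ c])

lemma carrier_vec_append_split3:
  assumes "v \<in> carrier_vec (a + (b + c))"
  obtains x y z where "v = x @\<^sub>v y @\<^sub>v z" "x \<in> carrier_vec a" "y \<in> carrier_vec b" "z \<in> carrier_vec c"
  using carrier_vec_append_split[of v a "b + c"] carrier_vec_append_split[of _ b c] assms by metis

lemma zero_mat_mult_vec: "v \<in> carrier_vec k \<Longrightarrow> 0\<^sub>m n k *\<^sub>v v = (0\<^sub>v n :: 'a :: comm_ring_1 vec)"
  by (intro eq_vecI) auto

lemma append_vec_eq_zero:
  assumes "x \<in> carrier_vec a" "x @\<^sub>v y = 0\<^sub>v (a + b)"
  shows "x = 0\<^sub>v a" "y = 0\<^sub>v b"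
proof -
  have "0\<^sub>v (a + b) = 0\<^sub>v a @\<^sub>v (0\<^sub>v b :: 'a vec)" by (intro eq_vecI) auto
  thus "x = 0\<^sub>v a" "y = 0\<^sub>v b" using append_vec_eq[OF assms(1), of "0\<^sub>v a"] assms(2) by auto
qed

lemma mult_mat_vec_uminus:
  fixes A :: "real mat"
  assumes "A \<in> carrier_mat n k" "v \<in> carrier_vec k"
  shows "A *\<^sub>v (- v) = - (A *\<^sub>v v)"
  using assms by (intro eq_vecI) auto

lemma mat_eq_vecI:
  fixes A :: "'a :: comm_ring_1 mat"
  assumes A: "A \<in> carrier_mat n k" and B: "B \<in> carrier_mat n k"
    and eq: "\<And>v. v \<in> carrier_vec k \<Longrightarrow> A *\<^sub>v v = B *\<^sub>v v"
  shows "A = B"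
proof (rule eq_matI)
  fix i j assume "i < dim_row B" "j < dim_col B"
  hence ij: "i < n" "j < k" using B by auto
  have "(A *\<^sub>v unit_vec k j) $ i = (B *\<^sub>v unit_vec k j) $ i" by (simp add: eq)
  thus "A $$ (i, j) = B $$ (i, j)" using ij A B by simp
qed (use A B in auto)

lemma diag_block_mat_Cons_mult_vec:
  fixes X :: "'a :: comm_ring_1 mat"
  assumes "X \<in> carrier_mat n n" "diag_block_mat Xs \<in> carrier_mat k k" "a \<in> carrier_vec n" "b \<in> carrier_vec k"
  shows "diag_block_mat (X # Xs) *\<^sub>v (a @\<^sub>v b) = (X *\<^sub>v a) @\<^sub>v (diag_block_mat Xs *\<^sub>v b)"
  using assms mult_mat_vec_split[OF assms] by (simp add: Let_def)

section \<open>Definiteness and nonsingularity of the matrices of the problem\<close>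

locale admm =
  fixes A B D :: "real mat" and nx ny nz :: nat
  assumes dim_pos: "0 < nx" "0 < ny" "0 < nz"
    and A: "A \<in> carrier_mat ny nx" and AAt: "det (A * A\<^sup>T) \<noteq> 0"
    and B: "B \<in> carrier_mat ny nz" and BtB: "det (B\<^sup>T * B) \<noteq> 0"
    and D: "D \<in> carrier_mat nx nx" and D_spd: "sym_pos_def D"
begin

lemma D_sym: "D\<^sup>T = D" using D_spd by (simp add: sym_pos_def_def)

lemma D_zero: "v \<in> carrier_vec nx \<Longrightarrow> v \<bullet> (D *\<^sub>v v) \<le> 0 \<Longrightarrow> v = 0\<^sub>v nx"
  using D_spd D by (force simp: sym_pos_def_def)

lemma D_det: "det D \<noteq> 0"
  by (rule mat_inv_inj[OF D]) (auto intro: D_zero)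

lemma D_inv: "mat_inv D \<in> carrier_mat nx nx" using mat_inv_det(1)[OF D D_det] .

lemma B_inj: "z \<in> carrier_vec nz \<Longrightarrow> B *\<^sub>v z = 0\<^sub>v ny \<Longrightarrow> z = 0\<^sub>v nz"
proof -
  assume z: "z \<in> carrier_vec nz" "B *\<^sub>v z = 0\<^sub>v ny"
  have "(B\<^sup>T * B) *\<^sub>v z = B\<^sup>T *\<^sub>v 0\<^sub>v ny" using z B by simp
  also have "\<dots> = 0\<^sub>v nz" using B by (intro mult_zero_vec) simp
  finally show ?thesis
    using det_0_iff_vec_prod_zero_field[of "B\<^sup>T * B" nz] BtB B z(1) by auto
qed

lemma At_inj: "w \<in> carrier_vec ny \<Longrightarrow> A\<^sup>T *\<^sub>v w = 0\<^sub>v nx \<Longrightarrow> w = 0\<^sub>v ny"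
proof -
  assume w: "w \<in> carrier_vec ny" "A\<^sup>T *\<^sub>v w = 0\<^sub>v nx"
  have "(A * A\<^sup>T) *\<^sub>v w = A *\<^sub>v (A\<^sup>T *\<^sub>v w)" using w A by (intro assoc_mult_mat_vec) auto
  also have "\<dots> = 0\<^sub>v ny" using A by (simp add: w(2) mult_zero_vec)
  finally show ?thesis
    using det_0_iff_vec_prod_zero_field[of "A * A\<^sup>T" ny] AAt A w(1) by auto
qed

definition E :: "real mat" where "E = A * mat_inv D * A\<^sup>T"
abbreviation Dt :: "real mat" where "Dt \<equiv> D_tilde A D"

lemma E: "E \<in> carrier_mat ny ny" "E\<^sup>T = E"
proof -
  show "E \<in> carrier_mat ny ny" using A D_inv by (simp add: E_def)
  have "E\<^sup>T = A * (A * mat_inv D)\<^sup>T"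
    unfolding E_def using transpose_mult[of "A * mat_inv D" ny nx "A\<^sup>T" ny] A D_inv by simp
  also have "(A * mat_inv D)\<^sup>T = mat_inv D * A\<^sup>T"
    using transpose_mult[OF A D_inv] mat_inv_symmetric[OF D D_sym D_det] by simp
  also have "A * (mat_inv D * A\<^sup>T) = E"
    unfolding E_def using A D_inv by (intro assoc_mult_mat[symmetric]) auto
  finally show "E\<^sup>T = E" .
qed

lemma E_mult: "w \<in> carrier_vec ny \<Longrightarrow> E *\<^sub>v w = A *\<^sub>v (mat_inv D *\<^sub>v (A\<^sup>T *\<^sub>v w))"
proof -
  assume w: "w \<in> carrier_vec ny"
  have Aw: "A\<^sup>T *\<^sub>v w \<in> carrier_vec nx" using A w by simp
  have At: "A\<^sup>T \<in> carrier_mat nx ny" using A by simp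
  have AD: "A * mat_inv D \<in> carrier_mat ny nx" using A D_inv by simp
  show ?thesis unfolding E_def
    by (simp only: assoc_mult_mat_vec[OF AD At w] assoc_mult_mat_vec[OF A D_inv Aw])
qed

text \<open>w.Ew = u.Du for u = D^-1 A^T w, so definiteness of D and injectivity of A^T carry over
  to E.\<close>

lemma E_zero: "w \<in> carrier_vec ny \<Longrightarrow> w \<bullet> (E *\<^sub>v w) \<le> 0 \<Longrightarrow> w = 0\<^sub>v ny"
proof -
  assume w: "w \<in> carrier_vec ny" "w \<bullet> (E *\<^sub>v w) \<le> 0"
  define u where "u = mat_inv D *\<^sub>v (A\<^sup>T *\<^sub>v w)"
  have Aw: "A\<^sup>T *\<^sub>v w \<in> carrier_vec nx" using A w by simp
  have u: "u \<in> carrier_vec nx" using D_inv Aw by (simp add: u_def)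
  have Du: "D *\<^sub>v u = A\<^sup>T *\<^sub>v w" unfolding u_def by (rule mat_inv_cancel(1)[OF D D_det Aw])
  have "u \<bullet> (D *\<^sub>v u) = (A *\<^sub>v u) \<bullet> w" unfolding Du using transpose_mult_scalar_prod[OF A u w(1)] by simp
  also have "\<dots> = w \<bullet> (A *\<^sub>v u)" using A u w by (intro comm_scalar_prod) auto
  also have "\<dots> = w \<bullet> (E *\<^sub>v w)" by (simp add: E_mult[OF w(1)] u_def)
  finally have "u = 0\<^sub>v nx" using w(2) u by (intro D_zero) auto
  hence "A\<^sup>T *\<^sub>v w = 0\<^sub>v nx" using Du D by (simp add: mult_zero_vec)
  thus ?thesis using w(1) by (rule At_inj[rotated])
qed

lemma E_det: "det E \<noteq> 0"
  by (rule mat_inv_inj[OF E(1)]) (auto intro: E_zero)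

lemma Dt: "Dt \<in> carrier_mat ny ny" "Dt\<^sup>T = Dt"
  using mat_inv_det(1)[OF E(1) E_det] mat_inv_symmetric[OF E E_det] by (simp_all add: D_tilde_def E_def)

lemma E_Dt: "v \<in> carrier_vec ny \<Longrightarrow> E *\<^sub>v (Dt *\<^sub>v v) = v"
  using mat_inv_cancel(1)[OF E(1) E_det] by (simp add: D_tilde_def E_def)

lemma Dt_zero: "v \<in> carrier_vec ny \<Longrightarrow> v \<bullet> (Dt *\<^sub>v v) \<le> 0 \<Longrightarrow> v = 0\<^sub>v ny"
proof -
  assume v: "v \<in> carrier_vec ny" "v \<bullet> (Dt *\<^sub>v v) \<le> 0"
  define u where "u = Dt *\<^sub>v v"
  have u: "u \<in> carrier_vec ny" using Dt v by (simp add: u_def)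
  have Eu: "E *\<^sub>v u = v" unfolding u_def by (rule E_Dt[OF v(1)])
  have "u \<bullet> (E *\<^sub>v u) = v \<bullet> (Dt *\<^sub>v v)"
    unfolding Eu using comm_scalar_prod[OF u v(1)] by (simp add: u_def)
  hence "u = 0\<^sub>v ny" using u v(2) by (intro E_zero) auto
  thus ?thesis using Eu E by (simp add: mult_zero_vec)
qed

abbreviation "m \<equiv> lambda_min Dt"
abbreviation "l \<equiv> lambda_max Dt"

lemma m_pos: "0 < m"
proof -
  obtain e where "eigenvalue Dt e" using symmetric_min_rayleigh_eigenvalue[OF Dt dim_pos(2)] by blast
  hence "m \<in> spectrum Dt" unfolding lambda_min_def
    using card_finite_spectrum(1)[OF Dt(1)] by (intro Min_in) (auto simp: spectrum_def)
  then obtain v where v: "v \<in> carrier_vec ny" "v \<noteq> 0\<^sub>v ny" "Dt *\<^sub>v v = m \<cdot>\<^sub>v v"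
    using Dt by (auto simp: spectrum_def eigenvalue_def eigenvector_def)
  have "0 < v \<bullet> (Dt *\<^sub>v v)" using Dt_zero[OF v(1)] v(2) by force
  also have "v \<bullet> (Dt *\<^sub>v v) = m * (v \<bullet> v)" using v(1) by (simp add: v(3))
  finally show ?thesis
    by (simp add: zero_less_mult_iff flip: vec_norm2_real)
qed

abbreviation N :: nat where "N \<equiv> nx + (nz + ny)"

lemma kkt_carrier: "kkt_mat A B D \<in> carrier_mat N N"
  using A B D unfolding kkt_mat_def Let_def by (auto intro!: carrier_append_rows)

lemma precond_carrier: "admm_precond A B D \<beta> \<in> carrier_mat N N"
  using A B D unfolding admm_precond_def Let_def by (auto intro!: carrier_append_rows)

context
  fixes x z y :: "real vec"
  assumes x: "x \<in> carrier_vec nx" and z: "z \<in> carrier_vec nz" and y: "y \<in> carrier_vec ny"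
begin

lemma kkt_mult_vec:
  "kkt_mat A B D *\<^sub>v (x @\<^sub>v z @\<^sub>v y) = (D *\<^sub>v x + A\<^sup>T *\<^sub>v y) @\<^sub>v (B\<^sup>T *\<^sub>v y) @\<^sub>v (A *\<^sub>v x + B *\<^sub>v z)"
proof -
  have v: "x @\<^sub>v z @\<^sub>v y \<in> carrier_vec N" using x z y by simp
  have c: "D *\<^sub>v x \<in> carrier_vec nx" "A\<^sup>T *\<^sub>v y \<in> carrier_vec nx" "B\<^sup>T *\<^sub>v y \<in> carrier_vec nz"
    "A *\<^sub>v x \<in> carrier_vec ny" "B *\<^sub>v z \<in> carrier_vec ny" using A B D x y z by simp_all
  have d: "dim_col A = nx" "dim_row A = ny" "dim_col B = nz" using A B by auto
  have "kkt_mat A B D *\<^sub>v (x @\<^sub>v z @\<^sub>v y)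
      = ((D @\<^sub>c 0\<^sub>m nx nz @\<^sub>c A\<^sup>T) *\<^sub>v (x @\<^sub>v z @\<^sub>v y)) @\<^sub>v
        ((0\<^sub>m nz nx @\<^sub>c 0\<^sub>m nz nz @\<^sub>c B\<^sup>T) *\<^sub>v (x @\<^sub>v z @\<^sub>v y)) @\<^sub>v
        ((A @\<^sub>c B @\<^sub>c 0\<^sub>m ny ny) *\<^sub>v (x @\<^sub>v z @\<^sub>v y))"
    unfolding kkt_mat_def Let_def d using A B D v
    by (intro append_rows3_mult_vec[of _ nx N _ nz _ ny] append_cols3_carrier) auto
  also have "(D @\<^sub>c 0\<^sub>m nx nz @\<^sub>c A\<^sup>T) *\<^sub>v (x @\<^sub>v z @\<^sub>v y) = D *\<^sub>v x + A\<^sup>T *\<^sub>v y"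
    using A D x z y c by (subst append_cols3_mult_vec[of _ nx nx _ nz _ ny]) (auto simp: zero_mat_mult_vec)
  also have "(0\<^sub>m nz nx @\<^sub>c 0\<^sub>m nz nz @\<^sub>c B\<^sup>T) *\<^sub>v (x @\<^sub>v z @\<^sub>v y) = B\<^sup>T *\<^sub>v y"
    using B x z y c by (subst append_cols3_mult_vec[of _ nz nx _ nz _ ny]) (auto simp: zero_mat_mult_vec)
  also have "(A @\<^sub>c B @\<^sub>c 0\<^sub>m ny ny) *\<^sub>v (x @\<^sub>v z @\<^sub>v y) = A *\<^sub>v x + B *\<^sub>v z"
    using A B x z y c by (subst append_cols3_mult_vec[of _ ny nx _ nz _ ny]) (auto simp: zero_mat_mult_vec)
  finally show ?thesis .
qed

lemma precond_mult_vec: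
  "admm_precond A B D \<beta> *\<^sub>v (x @\<^sub>v z @\<^sub>v y)
    = (D *\<^sub>v x + (- \<beta> \<cdot>\<^sub>v (A\<^sup>T *\<^sub>v (B *\<^sub>v z)) + A\<^sup>T *\<^sub>v y)) @\<^sub>v (B\<^sup>T *\<^sub>v y)
      @\<^sub>v (A *\<^sub>v x + (B *\<^sub>v z + - (1 / \<beta>) \<cdot>\<^sub>v y))"
proof -
  have v: "x @\<^sub>v z @\<^sub>v y \<in> carrier_vec N" using x z y by simp
  have c: "D *\<^sub>v x \<in> carrier_vec nx" "A\<^sup>T *\<^sub>v y \<in> carrier_vec nx" "B\<^sup>T *\<^sub>v y \<in> carrier_vec nz"
    "A *\<^sub>v x \<in> carrier_vec ny" "B *\<^sub>v z \<in> carrier_vec ny" using A B D x y z by simp_all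
  have At: "A\<^sup>T \<in> carrier_mat nx ny" using A by simp
  have d: "dim_col A = nx" "dim_row A = ny" "dim_col B = nz" using A B by auto
  have "admm_precond A B D \<beta> *\<^sub>v (x @\<^sub>v z @\<^sub>v y)
      = ((D @\<^sub>c ((- \<beta>) \<cdot>\<^sub>m (A\<^sup>T * B)) @\<^sub>c A\<^sup>T) *\<^sub>v (x @\<^sub>v z @\<^sub>v y)) @\<^sub>v
        ((0\<^sub>m nz nx @\<^sub>c 0\<^sub>m nz nz @\<^sub>c B\<^sup>T) *\<^sub>v (x @\<^sub>v z @\<^sub>v y)) @\<^sub>v
        ((A @\<^sub>c B @\<^sub>c ((- (1 / \<beta>)) \<cdot>\<^sub>m 1\<^sub>m ny)) *\<^sub>v (x @\<^sub>v z @\<^sub>v y))"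
    unfolding admm_precond_def Let_def d using A B D v
    by (intro append_rows3_mult_vec[of _ nx N _ nz _ ny] append_cols3_carrier) auto
  also have "(D @\<^sub>c ((- \<beta>) \<cdot>\<^sub>m (A\<^sup>T * B)) @\<^sub>c A\<^sup>T) *\<^sub>v (x @\<^sub>v z @\<^sub>v y)
      = D *\<^sub>v x + (- \<beta> \<cdot>\<^sub>v (A\<^sup>T *\<^sub>v (B *\<^sub>v z)) + A\<^sup>T *\<^sub>v y)"
    using A B D x z y smult_mat_mult_vec[of "A\<^sup>T * B" nx nz z "- \<beta>"] assoc_mult_mat_vec[OF At B z]
    by (subst append_cols3_mult_vec[of _ nx nx _ nz _ ny]) auto
  also have "(0\<^sub>m nz nx @\<^sub>c 0\<^sub>m nz nz @\<^sub>c B\<^sup>T) *\<^sub>v (x @\<^sub>v z @\<^sub>v y) = B\<^sup>T *\<^sub>v y"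
    using B x z y c by (subst append_cols3_mult_vec[of _ nz nx _ nz _ ny]) (auto simp: zero_mat_mult_vec)
  also have "(A @\<^sub>c B @\<^sub>c ((- (1 / \<beta>)) \<cdot>\<^sub>m 1\<^sub>m ny)) *\<^sub>v (x @\<^sub>v z @\<^sub>v y)
      = A *\<^sub>v x + (B *\<^sub>v z + - (1 / \<beta>) \<cdot>\<^sub>v y)"
    using A B x z y smult_mat_mult_vec[of "1\<^sub>m ny" ny ny y "- (1 / \<beta>)"]
    by (subst append_cols3_mult_vec[of _ ny nx _ nz _ ny]) auto
  finally show ?thesis .
qed

end

text \<open>On the kernel the third row gives y = \<beta> (A x + B z), which turns the first into D
  x + \<beta> A^T A x = 0 and forces x = 0. Then y = \<beta> B z, and the second row gives B^T B z =
  0.\<close>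

lemma precond_det:
  assumes beta: "0 < \<beta>"
  shows "det (admm_precond A B D \<beta>) \<noteq> 0"
proof (rule mat_inv_inj[OF precond_carrier])
  fix v assume v: "v \<in> carrier_vec N" "admm_precond A B D \<beta> *\<^sub>v v = 0\<^sub>v N"
  obtain x z y where xzy: "v = x @\<^sub>v z @\<^sub>v y" and
    c: "x \<in> carrier_vec nx" "z \<in> carrier_vec nz" "y \<in> carrier_vec ny"
    using carrier_vec_append_split3[OF v(1)] .
  have c': "D *\<^sub>v x \<in> carrier_vec nx" "A\<^sup>T *\<^sub>v y \<in> carrier_vec nx" "B\<^sup>T *\<^sub>v y \<in> carrier_vec nz"
    "A *\<^sub>v x \<in> carrier_vec ny" "B *\<^sub>v z \<in> carrier_vec ny" "A\<^sup>T *\<^sub>v (B *\<^sub>v z) \<in> carrier_vec nx"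
    using A B D c by simp_all
  have At: "A\<^sup>T \<in> carrier_mat nx ny" using A by simp
  note eq = v(2)[unfolded xzy precond_mult_vec[OF c]]
  have e1: "D *\<^sub>v x + (- \<beta> \<cdot>\<^sub>v (A\<^sup>T *\<^sub>v (B *\<^sub>v z)) + A\<^sup>T *\<^sub>v y) = 0\<^sub>v nx"
    using append_vec_eq_zero(1)[OF _ eq] c' by simp
  have eq': "(B\<^sup>T *\<^sub>v y) @\<^sub>v (A *\<^sub>v x + (B *\<^sub>v z + - (1 / \<beta>) \<cdot>\<^sub>v y)) = 0\<^sub>v (nz + ny)"
    using append_vec_eq_zero(2)[OF _ eq] c' by simp
  have e2: "B\<^sup>T *\<^sub>v y = 0\<^sub>v nz" using append_vec_eq_zero(1)[OF _ eq'] c' by simp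
  have e3: "A *\<^sub>v x + (B *\<^sub>v z + - (1 / \<beta>) \<cdot>\<^sub>v y) = 0\<^sub>v ny"
    using append_vec_eq_zero(2)[OF _ eq'] c' by simp
  have y_eq: "y = \<beta> \<cdot>\<^sub>v (A *\<^sub>v x) + \<beta> \<cdot>\<^sub>v (B *\<^sub>v z)"
  proof -
    have "u = \<beta> \<cdot>\<^sub>v a + \<beta> \<cdot>\<^sub>v b"
      if eq: "a + (b + - (1 / \<beta>) \<cdot>\<^sub>v u) = 0\<^sub>v ny"
        and cc: "a \<in> carrier_vec ny" "b \<in> carrier_vec ny" "u \<in> carrier_vec ny" for a b u :: "real vec"
    proof (rule eq_vecI)
      fix i assume "i < dim_vec (\<beta> \<cdot>\<^sub>v a + \<beta> \<cdot>\<^sub>v b)"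
      hence i: "i < ny" using cc by simp
      have "(a + (b + - (1 / \<beta>) \<cdot>\<^sub>v u)) $ i = 0" unfolding eq using i by simp
      thus "u $ i = (\<beta> \<cdot>\<^sub>v a + \<beta> \<cdot>\<^sub>v b) $ i" using i cc beta by (simp add: field_simps)
    qed (use cc in auto)
    from this[OF e3 c'(4,5) c(3)] show ?thesis .
  qed
  have "A\<^sup>T *\<^sub>v y = \<beta> \<cdot>\<^sub>v (A\<^sup>T *\<^sub>v (A *\<^sub>v x)) + \<beta> \<cdot>\<^sub>v (A\<^sup>T *\<^sub>v (B *\<^sub>v z))"
    unfolding y_eq using c' by (simp add: mult_add_distrib_mat_vec[OF At] mult_mat_vec[OF At])
  moreover have "d + (- \<beta> \<cdot>\<^sub>v b + (\<beta> \<cdot>\<^sub>v a + \<beta> \<cdot>\<^sub>v b)) = d + \<beta> \<cdot>\<^sub>v a"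
    if "a \<in> carrier_vec nx" "b \<in> carrier_vec nx" "d \<in> carrier_vec nx" for a b d :: "real vec"
    using that by (intro eq_vecI) auto
  ultimately have "D *\<^sub>v x + \<beta> \<cdot>\<^sub>v (A\<^sup>T *\<^sub>v (A *\<^sub>v x)) = 0\<^sub>v nx"
    using e1 c' mult_mat_vec_carrier[OF At c'(4)] by metis
  hence "x \<bullet> (D *\<^sub>v x + \<beta> \<cdot>\<^sub>v (A\<^sup>T *\<^sub>v (A *\<^sub>v x))) = 0" using c(1) by simp
  moreover have "x \<bullet> (D *\<^sub>v x + \<beta> \<cdot>\<^sub>v (A\<^sup>T *\<^sub>v (A *\<^sub>v x))) = x \<bullet> (D *\<^sub>v x) + \<beta> * ((A *\<^sub>v x) \<bullet> (A *\<^sub>v x))"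
    using c(1) c' At transpose_mult_scalar_prod[OF A c(1) c'(4)]
    by (simp add: scalar_prod_add_distrib[of _ nx])
  moreover have "0 \<le> \<beta> * ((A *\<^sub>v x) \<bullet> (A *\<^sub>v x))" using beta by (simp flip: vec_norm2_real)
  ultimately have x0: "x = 0\<^sub>v nx" using c(1) by (intro D_zero) auto
  have "y = \<beta> \<cdot>\<^sub>v (B *\<^sub>v z)" 
  proof -
    have "\<beta> \<cdot>\<^sub>v 0\<^sub>v ny + \<beta> \<cdot>\<^sub>v b = \<beta> \<cdot>\<^sub>v b" if "b \<in> carrier_vec ny" for b :: "real vec"
      using that by (intro eq_vecI) auto
    from this[OF c'(5)] show ?thesis unfolding y_eq x0 mult_zero_vec[OF A] .
  qed
  hence By: "B\<^sup>T *\<^sub>v y = \<beta> \<cdot>\<^sub>v ((B\<^sup>T * B) *\<^sub>v z)" using B c c' by (simp add: mult_mat_vec[of _ nz ny])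
  have "z \<bullet> (\<beta> \<cdot>\<^sub>v ((B\<^sup>T * B) *\<^sub>v z)) = 0" unfolding By[symmetric] e2 using c by simp
  moreover have "z \<bullet> (\<beta> \<cdot>\<^sub>v ((B\<^sup>T * B) *\<^sub>v z)) = \<beta> * (vec_norm2 (B *\<^sub>v z))\<^sup>2"
    using B c c' transpose_mult_scalar_prod[OF B c(2) c'(5)] by (simp add: vec_norm2_real)
  ultimately have "vec_norm2 (B *\<^sub>v z) = 0" using beta by simp
  hence "B *\<^sub>v z = 0\<^sub>v ny" using vec_norm2_eq_0_iff[of "B *\<^sub>v z"] B by simp
  moreover have "\<beta> \<cdot>\<^sub>v 0\<^sub>v ny = 0\<^sub>v ny" by (intro eq_vecI) auto
  ultimately have z0: "z = 0\<^sub>v nz" "y = 0\<^sub>v ny" using B_inj[OF c(2)] \<open>y = \<beta> \<cdot>\<^sub>v (B *\<^sub>v z)\<close> by auto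
  show "v = 0\<^sub>v N" unfolding xzy x0 z0 by (intro eq_vecI) auto
qed

definition G :: "real \<Rightarrow> real mat" where "G \<beta> = admm_iter_mat A B D \<beta>"

lemma G_eq: "G \<beta> = 1\<^sub>m N - mat_inv (admm_precond A B D \<beta>) * kkt_mat A B D"
  using A B by (simp add: G_def admm_iter_mat_def add.assoc)

lemma G_carrier: "0 < \<beta> \<Longrightarrow> G \<beta> \<in> carrier_mat N N"
  unfolding G_eq using mat_inv_det(1)[OF precond_carrier precond_det] kkt_carrier
  by (intro minus_carrier_mat mult_carrier_mat) auto

text \<open>Multiplying G = I - P^-1 M by the preconditioner P gives P - M, so a guess for the image
  can be verified without inverting P.\<close>

lemma G_multI:
  assumes beta: "0 < \<beta>" and v: "v \<in> carrier_vec N" and w: "w \<in> carrier_vec N"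
    and eq: "admm_precond A B D \<beta> *\<^sub>v w = admm_precond A B D \<beta> *\<^sub>v v - kkt_mat A B D *\<^sub>v v"
  shows "G \<beta> *\<^sub>v v = w"
proof -
  let ?P = "admm_precond A B D \<beta>"
  note P = precond_carrier[of \<beta>] precond_det[OF beta]
  note i = mat_inv_det[OF P]
  have "w = mat_inv ?P *\<^sub>v (?P *\<^sub>v v - kkt_mat A B D *\<^sub>v v)"
    using mat_inv_cancel(2)[OF P w] eq by simp
  also have "\<dots> = mat_inv ?P *\<^sub>v (?P *\<^sub>v v) - mat_inv ?P *\<^sub>v (kkt_mat A B D *\<^sub>v v)"
    using P(1) v kkt_carrier i by (intro mult_minus_distrib_mat_vec) auto
  also have "\<dots> = v - (mat_inv ?P * kkt_mat A B D) *\<^sub>v v"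
    using mat_inv_cancel(2)[OF P v] assoc_mult_mat_vec[OF i(1) kkt_carrier v] by simp
  also have "\<dots> = G \<beta> *\<^sub>v v" unfolding G_eq using v i kkt_carrier
    by (subst minus_mult_distrib_mat_vec[of _ N N]) auto
  finally show ?thesis by simp
qed

end

text \<open>Kept apart from \<open>admm_split\<close> because the claim that c1 is bounded
  quantifies over Q and R alone. R enters through |R z| = |B z|.\<close>

locale admm_scaling = admm +
  fixes R :: "real mat" and \<beta> :: real
  assumes R: "R \<in> carrier_mat nz nz" and beta: "0 < \<beta>"
    and R_norm: "\<And>z. z \<in> carrier_vec nz \<Longrightarrow> vec_norm2 (R *\<^sub>v z) = vec_norm2 (B *\<^sub>v z)"
begin

abbreviation np :: nat where "np \<equiv> ny - nz"
abbreviation Sc :: "real mat" where "Sc \<equiv> scaling_mat A B R \<beta>"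

lemma R_det: "det R \<noteq> 0"
proof (rule mat_inv_inj[OF R])
  fix v assume v: "v \<in> carrier_vec nz" "R *\<^sub>v v = 0\<^sub>v nz"
  hence "vec_norm2 (B *\<^sub>v v) = 0" using R_norm[OF v(1)] by simp
  hence "B *\<^sub>v v = 0\<^sub>v ny" using vec_norm2_eq_0_iff[of "B *\<^sub>v v"] B by simp
  thus "v = 0\<^sub>v nz" by (rule B_inj[OF v(1)])
qed

lemma R_solve:
  assumes a: "a \<in> carrier_vec nz"
  shows "\<exists>z \<in> carrier_vec nz. \<beta> \<cdot>\<^sub>v (R *\<^sub>v z) = a"
proof -
  define z where "z = mat_inv R *\<^sub>v ((1 / \<beta>) \<cdot>\<^sub>v a)"
  have a': "(1 / \<beta>) \<cdot>\<^sub>v a \<in> carrier_vec nz" using a by simp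
  have "R *\<^sub>v z = (1 / \<beta>) \<cdot>\<^sub>v a" unfolding z_def by (rule mat_inv_cancel(1)[OF R R_det a'])
  hence "\<beta> \<cdot>\<^sub>v (R *\<^sub>v z) = a" using beta a by (simp add: smult_smult_assoc)
  moreover have "z \<in> carrier_vec nz" unfolding z_def using mat_inv_det(1)[OF R R_det] a' by (rule mult_mat_vec_carrier)
  ultimately show ?thesis by blast
qed

lemma R_cancel:
  assumes z: "z \<in> carrier_vec nz" "z' \<in> carrier_vec nz" and eq: "\<beta> \<cdot>\<^sub>v (R *\<^sub>v z) = \<beta> \<cdot>\<^sub>v (R *\<^sub>v z')"
  shows "z = z'"
proof -
  have "(1 / \<beta>) \<cdot>\<^sub>v (\<beta> \<cdot>\<^sub>v v) = v" for v :: "real vec"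
    using beta by (intro eq_vecI) auto
  hence "R *\<^sub>v z = R *\<^sub>v z'" using eq by metis
  thus ?thesis using mat_inv_cancel(2)[OF R R_det z(1)] mat_inv_cancel(2)[OF R R_det z(2)] by metis
qed

lemma scaling_eq: "Sc = diag_block_mat [\<beta> \<cdot>\<^sub>m 1\<^sub>m nx, \<beta> \<cdot>\<^sub>m R, 1\<^sub>m np, 1\<^sub>m nz]"
  using A B by (simp add: scaling_mat_def)

lemma scaling_carrier: "Sc \<in> carrier_mat (nx + (nz + (np + nz))) (nx + (nz + (np + nz)))"
  unfolding scaling_eq using R by (intro carrier_matI) (auto simp: dim_diag_block_mat)

lemma scaling_mult_vec:
  assumes x: "x \<in> carrier_vec nx" and z: "z \<in> carrier_vec nz" and p: "p \<in> carrier_vec np" and q: "q \<in> carrier_vec nz"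
  shows "Sc *\<^sub>v (x @\<^sub>v z @\<^sub>v p @\<^sub>v q) = (\<beta> \<cdot>\<^sub>v x) @\<^sub>v (\<beta> \<cdot>\<^sub>v (R *\<^sub>v z)) @\<^sub>v p @\<^sub>v q"
proof -
  have c: "diag_block_mat [1\<^sub>m np, 1\<^sub>m nz] \<in> carrier_mat (np + nz) (np + nz)"
    "diag_block_mat [\<beta> \<cdot>\<^sub>m R, 1\<^sub>m np, 1\<^sub>m nz] \<in> carrier_mat (nz + (np + nz)) (nz + (np + nz))"
    "diag_block_mat [1\<^sub>m nz] \<in> carrier_mat nz nz"
    using R by (intro carrier_matI; simp add: dim_diag_block_mat)+
  have "Sc *\<^sub>v (x @\<^sub>v z @\<^sub>v p @\<^sub>v q)
      = ((\<beta> \<cdot>\<^sub>m 1\<^sub>m nx) *\<^sub>v x) @\<^sub>v ((\<beta> \<cdot>\<^sub>m R) *\<^sub>v z) @\<^sub>v (1\<^sub>m np *\<^sub>v p) @\<^sub>v (diag_block_mat [1\<^sub>m nz] *\<^sub>v q)"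
    unfolding scaling_eq using R x z p q c
    by (simp only: diag_block_mat_Cons_mult_vec[OF _ c(2) x] diag_block_mat_Cons_mult_vec[OF _ c(1) z]
      diag_block_mat_Cons_mult_vec[OF _ c(3) p] append_carrier_vec smult_carrier_mat one_carrier_mat)
  also have "(\<beta> \<cdot>\<^sub>m 1\<^sub>m nx) *\<^sub>v x = \<beta> \<cdot>\<^sub>v x" using x by (simp add: smult_mat_mult_vec[of _ nx nx])
  also have "(\<beta> \<cdot>\<^sub>m R) *\<^sub>v z = \<beta> \<cdot>\<^sub>v (R *\<^sub>v z)" using z R by (simp add: smult_mat_mult_vec[of _ nz nz])
  finally show ?thesis using p q by (simp del: diag_block_mat.simps)
qed

lemma scaling_split:
  assumes "v \<in> carrier_vec (nx + (nz + (np + nz)))"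
  obtains x z p q where "v = x @\<^sub>v z @\<^sub>v p @\<^sub>v q" "x \<in> carrier_vec nx" "z \<in> carrier_vec nz"
    "p \<in> carrier_vec np" "q \<in> carrier_vec nz"
  using carrier_vec_append_split3[OF assms] carrier_vec_append_split[of _ np nz] by metis

lemma scaling_norm:
  assumes x: "x \<in> carrier_vec nx" and z: "z \<in> carrier_vec nz" and p: "p \<in> carrier_vec np" and q: "q \<in> carrier_vec nz"
  shows "(vec_norm2 (Sc *\<^sub>v (x @\<^sub>v z @\<^sub>v p @\<^sub>v q)))\<^sup>2
    = \<beta>\<^sup>2 * (vec_norm2 x)\<^sup>2 + \<beta>\<^sup>2 * (vec_norm2 (B *\<^sub>v z))\<^sup>2 + (vec_norm2 p)\<^sup>2 + (vec_norm2 q)\<^sup>2"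
  unfolding scaling_mult_vec[OF assms]
  using z beta by (simp add: vec_norm2_append vec_norm2_smult R_norm power_mult_distrib)

lemma scaling_det: "det Sc \<noteq> 0"
proof (rule mat_inv_inj[OF scaling_carrier])
  fix v assume v: "v \<in> carrier_vec (nx + (nz + (np + nz)))" "Sc *\<^sub>v v = 0\<^sub>v (nx + (nz + (np + nz)))"
  obtain x z p q where e: "v = x @\<^sub>v z @\<^sub>v p @\<^sub>v q" and c: "x \<in> carrier_vec nx" "z \<in> carrier_vec nz"
    "p \<in> carrier_vec np" "q \<in> carrier_vec nz" using scaling_split[OF v(1)] .
  have "\<beta>\<^sup>2 * (vec_norm2 x)\<^sup>2 + \<beta>\<^sup>2 * (vec_norm2 (B *\<^sub>v z))\<^sup>2 + (vec_norm2 p)\<^sup>2 + (vec_norm2 q)\<^sup>2 = 0"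
    using scaling_norm[OF c] v(2) by (simp add: e)
  hence "\<beta>\<^sup>2 * (vec_norm2 x)\<^sup>2 = 0" "\<beta>\<^sup>2 * (vec_norm2 (B *\<^sub>v z))\<^sup>2 = 0" "(vec_norm2 p)\<^sup>2 = 0" "(vec_norm2 q)\<^sup>2 = 0"
    by (simp_all only: add_nonneg_eq_0_iff add_nonneg_nonneg mult_nonneg_nonneg zero_le_power2)
  hence n: "vec_norm2 x = 0" "vec_norm2 (B *\<^sub>v z) = 0" "vec_norm2 p = 0" "vec_norm2 q = 0" using beta by auto
  have "B *\<^sub>v z = 0\<^sub>v ny" using n(2) vec_norm2_eq_0_iff[of "B *\<^sub>v z"] B by simp
  hence "z = 0\<^sub>v nz" by (rule B_inj[OF c(2)])
  thus "v = 0\<^sub>v (nx + (nz + (np + nz)))"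
    using n c vec_norm2_eq_0_iff[of x] vec_norm2_eq_0_iff[of p] vec_norm2_eq_0_iff[of q]
    by (auto simp: e intro!: eq_vecI)
qed

lemma scaling_cond_ge_1: "1 \<le> cond2 Sc"
  using cond2_ge_1[OF scaling_carrier scaling_det] dim_pos by simp

text \<open>The scaling matrix sends (0, a, 0, 0) to a vector of norm \<beta> |B a|, and it fixes
  the last block, so that its inverse has norm at least 1. This serves the lower bound for the norm
  of G in \<open>g_norm_lower\<close>.\<close>

lemma scaling_cond_ge:
  assumes a: "a \<in> carrier_vec nz"
  shows "\<beta> * vec_norm2 (B *\<^sub>v a) \<le> cond2 Sc * vec_norm2 a"
proof -
  let ?v = "0\<^sub>v nx @\<^sub>v a @\<^sub>v 0\<^sub>v np @\<^sub>v (0\<^sub>v nz :: real vec)"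
  let ?u = "0\<^sub>v nx @\<^sub>v 0\<^sub>v nz @\<^sub>v 0\<^sub>v np @\<^sub>v unit_vec nz 0 :: real vec"
  have n_app: "vec_norm2 (0\<^sub>v k @\<^sub>v w) = vec_norm2 w" "vec_norm2 (w @\<^sub>v 0\<^sub>v k) = vec_norm2 w" for k and w :: "real vec"
    using vec_norm2_append[of "0\<^sub>v k :: real vec" w] vec_norm2_append[of w "0\<^sub>v k"] by simp_all
  have z4: "0\<^sub>v np @\<^sub>v (0\<^sub>v nz :: real vec) = 0\<^sub>v (np + nz)" by (intro eq_vecI) auto
  have v: "?v \<in> carrier_vec (nx + (nz + (np + nz)))" "vec_norm2 ?v = vec_norm2 a"
    using a by (simp_all add: n_app z4)
  have u: "?u \<in> carrier_vec (nx + (nz + (np + nz)))" by simp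
  have u_pos: "0 < vec_norm2 ?u"
    unfolding n_app using dim_pos(3)
    by (intro vec_norm2_pos[of _ nz]) (auto dest: arg_cong[of _ _ "\<lambda>v. v $ 0"])
  have "(vec_norm2 (Sc *\<^sub>v ?v))\<^sup>2 = (\<beta> * vec_norm2 (B *\<^sub>v a))\<^sup>2"
    using a by (subst scaling_norm) (auto simp: power_mult_distrib)
  hence "vec_norm2 (Sc *\<^sub>v ?v) = \<beta> * vec_norm2 (B *\<^sub>v a)" using beta by (subst (asm) power2_eq_iff_nonneg) auto
  hence 1: "\<beta> * vec_norm2 (B *\<^sub>v a) \<le> mat_norm2 Sc * vec_norm2 a"
    using vec_norm2_mult_le[OF scaling_carrier v(1)] by (simp only: v(2))
  have z0: "\<beta> \<cdot>\<^sub>v 0\<^sub>v nx = 0\<^sub>v nx" "\<beta> \<cdot>\<^sub>v (R *\<^sub>v 0\<^sub>v nz) = 0\<^sub>v nz" using R by (auto intro!: eq_vecI)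
  have "Sc *\<^sub>v ?u = ?u" by (subst scaling_mult_vec) (auto simp: z0)
  hence "mat_inv Sc *\<^sub>v ?u = ?u" using mat_inv_cancel(2)[OF scaling_carrier scaling_det u] by simp
  hence "vec_norm2 ?u \<le> mat_norm2 (mat_inv Sc) * vec_norm2 ?u"
    using vec_norm2_mult_le[OF mat_inv_det(1)[OF scaling_carrier scaling_det] u] by simp
  hence "1 \<le> mat_norm2 (mat_inv Sc)" using u_pos by simp
  hence "mat_norm2 Sc * vec_norm2 a * 1 \<le> mat_norm2 Sc * vec_norm2 a * mat_norm2 (mat_inv Sc)"
    by (intro mult_left_mono) auto
  with 1 show ?thesis by (simp add: cond2_def mult_ac)
qed

end

text \<open>In the coordinates \<open>(\<beta> R z, P\<^sup>T y)\<close> the iteration acts on its range as \<open>(I + K) / 2\<close>. The state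
  enters an iteration only through \<open>w = y + \<beta> B z = \<beta> s + D\<^sub>t s\<close>.\<close>

locale admm_split = admm A B D nx ny nz
  for A B D :: "real mat" and nx ny nz :: nat +
  fixes Q R P :: "real mat" and \<beta> :: real
  assumes qr: "qr_decomposition B Q R" and compl: "orthogonal_completion Q P"
    and beta_bounds: "lambda_min (D_tilde A D) \<le> \<beta>" "\<beta> \<le> lambda_max (D_tilde A D)"
begin

lemma beta_pos: "0 < \<beta>" using m_pos beta_bounds by simp

lemma QR: "Q \<in> carrier_mat ny nz" "R \<in> carrier_mat nz nz" "orthonormal_cols Q" "B = Q * R"
  using qr B by (auto simp: qr_decomposition_def)

lemma R_norm: "z \<in> carrier_vec nz \<Longrightarrow> vec_norm2 (R *\<^sub>v z) = vec_norm2 (B *\<^sub>v z)"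
  using orthonormal_cols_norm[OF QR(1,3), of "R *\<^sub>v z"] QR by simp

sublocale admm_scaling A B D nx ny nz R \<beta>
  using QR beta_pos R_norm by unfold_locales auto

sublocale split_shifted_inverse Q P "D_tilde A D" ny nz "lambda_min (D_tilde A D)" "lambda_max (D_tilde A D)" \<beta>
  using QR compl Dt lambda_min_le_rayleigh[OF Dt] rayleigh_le_lambda_max[OF Dt] m_pos beta_bounds
  by unfold_locales auto

lemma K_mat_eq: "K_mat A D Q P \<beta> = K"
  using A by (simp add: K_mat_def K_def H_def Let_def)

definition F :: "real mat" where "F = (1 / 2) \<cdot>\<^sub>m (1\<^sub>m ny + K)"

lemma F_carrier: "F \<in> carrier_mat ny ny" by (simp add: F_def)

definition state_mat :: "real mat" where
  "state_mat = (0\<^sub>m nz nx @\<^sub>c (\<beta> \<cdot>\<^sub>m R) @\<^sub>c 0\<^sub>m nz ny) @\<^sub>r (0\<^sub>m np nx @\<^sub>c 0\<^sub>m np nz @\<^sub>c P\<^sup>T)"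

lemma state_carrier: "state_mat \<in> carrier_mat ny (nx + (nz + ny))"
proof -
  have "state_mat \<in> carrier_mat (nz + np) (nx + (nz + ny))"
    unfolding state_mat_def using QR P by (intro carrier_append_rows append_cols3_carrier) auto
  thus ?thesis using k_le by simp
qed

lemma state_mult_vec:
  assumes x: "x \<in> carrier_vec nx" and z: "z \<in> carrier_vec nz" and y: "y \<in> carrier_vec ny"
  shows "state_mat *\<^sub>v (x @\<^sub>v z @\<^sub>v y) = (\<beta> \<cdot>\<^sub>v (R *\<^sub>v z)) @\<^sub>v (P\<^sup>T *\<^sub>v y)"
proof -
  have v: "x @\<^sub>v z @\<^sub>v y \<in> carrier_vec (nx + (nz + ny))" using x z y by simp
  have c: "R *\<^sub>v z \<in> carrier_vec nz" "P\<^sup>T *\<^sub>v y \<in> carrier_vec np" using QR P x z y by simp_all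
  have "state_mat *\<^sub>v (x @\<^sub>v z @\<^sub>v y)
      = ((0\<^sub>m nz nx @\<^sub>c (\<beta> \<cdot>\<^sub>m R) @\<^sub>c 0\<^sub>m nz ny) *\<^sub>v (x @\<^sub>v z @\<^sub>v y)) @\<^sub>v
        ((0\<^sub>m np nx @\<^sub>c 0\<^sub>m np nz @\<^sub>c P\<^sup>T) *\<^sub>v (x @\<^sub>v z @\<^sub>v y))"
    unfolding state_mat_def using QR P v
    by (intro mat_mult_append[of _ nz "nx + (nz + ny)" _ np] append_cols3_carrier) auto
  also have "(0\<^sub>m nz nx @\<^sub>c (\<beta> \<cdot>\<^sub>m R) @\<^sub>c 0\<^sub>m nz ny) *\<^sub>v (x @\<^sub>v z @\<^sub>v y) = \<beta> \<cdot>\<^sub>v (R *\<^sub>v z)"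
    using QR x z y c by (subst append_cols3_mult_vec[of _ nz nx _ nz _ ny])
      (auto simp: zero_mat_mult_vec smult_mat_mult_vec[of _ nz nz])
  also have "(0\<^sub>m np nx @\<^sub>c 0\<^sub>m np nz @\<^sub>c P\<^sup>T) *\<^sub>v (x @\<^sub>v z @\<^sub>v y) = P\<^sup>T *\<^sub>v y"
    using P x z y c by (subst append_cols3_mult_vec[of _ np nx _ nz _ ny]) (auto simp: zero_mat_mult_vec)
  finally show ?thesis .
qed

text \<open>Replacing y by the pair (P^T y, Q^T y) is an isometry, and the state consists of the two
  middle blocks of the scaling matrix applied to the result.\<close>

lemma state_norm:
  assumes v: "v \<in> carrier_vec (nx + (nz + ny))"
  shows "vec_norm2 (state_mat *\<^sub>v v) \<le> mat_norm2 Sc * vec_norm2 v"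
proof -
  obtain x z y where e: "v = x @\<^sub>v z @\<^sub>v y" and
    c: "x \<in> carrier_vec nx" "z \<in> carrier_vec nz" "y \<in> carrier_vec ny" using carrier_vec_append_split3[OF v] .
  let ?t = "x @\<^sub>v z @\<^sub>v (P\<^sup>T *\<^sub>v y) @\<^sub>v (Q\<^sup>T *\<^sub>v y)"
  have py: "P\<^sup>T *\<^sub>v y \<in> carrier_vec np" "Q\<^sup>T *\<^sub>v y \<in> carrier_vec nz" using QR P c by simp_all
  have "(vec_norm2 ?t)\<^sup>2 = (vec_norm2 v)\<^sup>2"
    using split_norm[OF c(3)] by (simp add: e vec_norm2_append)
  hence t: "vec_norm2 ?t = vec_norm2 v" by simp
  have "(vec_norm2 (state_mat *\<^sub>v v))\<^sup>2 \<le> (vec_norm2 (Sc *\<^sub>v ?t))\<^sup>2"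
    unfolding scaling_mult_vec[OF c(1,2) py] e state_mult_vec[OF c] by (simp add: vec_norm2_append)
  hence "vec_norm2 (state_mat *\<^sub>v v) \<le> vec_norm2 (Sc *\<^sub>v ?t)" by (rule power2_le_imp_le) simp
  also have "\<dots> \<le> mat_norm2 Sc * vec_norm2 ?t" using c py by (intro vec_norm2_mult_le[OF scaling_carrier]) auto
  finally show ?thesis by (simp add: t)
qed

text \<open>With e = \<open>Dt\<close> s the claim is checked row by row through
  \<open>G_multI\<close>. The equation for c means \<beta> B c = Q Q^T e, hence e = \<beta> B c + P
  P^T e, which gives the first row; the second holds since B^T P = 0; the third uses that A D^-1 A^T
  is the inverse of \<open>Dt\<close>, so the new x satisfies A x' = -s.\<close>

lemma G_mult_vec:
  assumes x: "x \<in> carrier_vec nx" and z: "z \<in> carrier_vec nz" and y: "y \<in> carrier_vec ny"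
    and s: "s \<in> carrier_vec ny" and w: "y + \<beta> \<cdot>\<^sub>v (B *\<^sub>v z) = \<beta> \<cdot>\<^sub>v s + Dt *\<^sub>v s"
    and c: "c \<in> carrier_vec nz" and Rc: "\<beta> \<cdot>\<^sub>v (R *\<^sub>v c) = Q\<^sup>T *\<^sub>v (Dt *\<^sub>v s)"
  shows "G \<beta> *\<^sub>v (x @\<^sub>v z @\<^sub>v y)
    = (- (mat_inv D *\<^sub>v (A\<^sup>T *\<^sub>v (Dt *\<^sub>v s)))) @\<^sub>v (z - c) @\<^sub>v (P *\<^sub>v (P\<^sup>T *\<^sub>v (Dt *\<^sub>v s)))"
proof -
  define e where "e = Dt *\<^sub>v s"
  define x' where "x' = - (mat_inv D *\<^sub>v (A\<^sup>T *\<^sub>v e))"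
  define y' where "y' = P *\<^sub>v (P\<^sup>T *\<^sub>v e)"
  have At: "A\<^sup>T \<in> carrier_mat nx ny" using A by simp
  have e: "e \<in> carrier_vec ny" unfolding e_def using Dt(1) s by (rule mult_mat_vec_carrier)
  have Ae: "A\<^sup>T *\<^sub>v e \<in> carrier_vec nx" using At e by (rule mult_mat_vec_carrier)
  have DAe: "mat_inv D *\<^sub>v (A\<^sup>T *\<^sub>v e) \<in> carrier_vec nx" using D_inv Ae by (rule mult_mat_vec_carrier)
  have x': "x' \<in> carrier_vec nx" using DAe by (simp add: x'_def)
  have PT: "P\<^sup>T *\<^sub>v e \<in> carrier_vec np" using P e by simp
  have y': "y' \<in> carrier_vec ny" unfolding y'_def using P PT by (rule mult_mat_vec_carrier)
  have Dx: "D *\<^sub>v x' = - (A\<^sup>T *\<^sub>v e)"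
    unfolding x'_def using mat_inv_cancel(1)[OF D D_det Ae] DAe D
    by (simp add: mult_mat_vec_uminus[OF D DAe])
  have Ax: "A *\<^sub>v x' = - s"
  proof -
    have "A *\<^sub>v x' = - (A *\<^sub>v (mat_inv D *\<^sub>v (A\<^sup>T *\<^sub>v e)))"
      unfolding x'_def by (rule mult_mat_vec_uminus[OF A DAe])
    also have "A *\<^sub>v (mat_inv D *\<^sub>v (A\<^sup>T *\<^sub>v e)) = s"
      using E_mult[OF e] E_Dt[OF s] by (simp add: e_def)
    finally show ?thesis .
  qed
  have Bc: "\<beta> \<cdot>\<^sub>v (B *\<^sub>v c) = Q *\<^sub>v (Q\<^sup>T *\<^sub>v e)"
  proof -
    have Rcc: "R *\<^sub>v c \<in> carrier_vec nz" using QR(2) c by simp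
    have "\<beta> \<cdot>\<^sub>v (B *\<^sub>v c) = Q *\<^sub>v (\<beta> \<cdot>\<^sub>v (R *\<^sub>v c))"
      using QR(1,2,4) c Rcc by (simp add: mult_mat_vec[OF QR(1) Rcc])
    thus ?thesis by (simp add: Rc e_def)
  qed
  have e_split: "e = \<beta> \<cdot>\<^sub>v (B *\<^sub>v c) + y'"
    unfolding Bc y'_def using split_vec[OF e] by simp
  have Bcc: "B *\<^sub>v c \<in> carrier_vec ny" "B *\<^sub>v z \<in> carrier_vec ny" using B c z by simp_all
  have By': "B\<^sup>T *\<^sub>v y' = 0\<^sub>v nz"
  proof -
    have "B\<^sup>T = R\<^sup>T * Q\<^sup>T" unfolding QR(4) using transpose_mult[OF QR(1,2)] .
    hence "B\<^sup>T *\<^sub>v y' = R\<^sup>T *\<^sub>v (Q\<^sup>T *\<^sub>v y')" using QR(1,2) y' by simp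
    also have "Q\<^sup>T *\<^sub>v y' = 0\<^sub>v nz" unfolding y'_def by (rule transpose_cross(4)[OF PT])
    also have "R\<^sup>T *\<^sub>v 0\<^sub>v nz = 0\<^sub>v nz" using QR(2) by (intro mult_zero_vec) simp
    finally show ?thesis .
  qed
  have zc: "z - c \<in> carrier_vec nz" using z c by simp
  have Bzc: "B *\<^sub>v (z - c) = B *\<^sub>v z - B *\<^sub>v c" using B z c by (rule mult_minus_distrib_mat_vec)
  have Atc: "A\<^sup>T *\<^sub>v (B *\<^sub>v z) \<in> carrier_vec nx" "A\<^sup>T *\<^sub>v (B *\<^sub>v c) \<in> carrier_vec nx" "A\<^sup>T *\<^sub>v y' \<in> carrier_vec nx"
    "A\<^sup>T *\<^sub>v y \<in> carrier_vec nx" "D *\<^sub>v x \<in> carrier_vec nx" "A *\<^sub>v x \<in> carrier_vec ny" "B\<^sup>T *\<^sub>v y \<in> carrier_vec nz"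
    using A B D Bcc y' y x by simp_all
  have "A\<^sup>T *\<^sub>v e = \<beta> \<cdot>\<^sub>v (A\<^sup>T *\<^sub>v (B *\<^sub>v c)) + A\<^sup>T *\<^sub>v y'"
    unfolding e_split using Bcc y' by (simp add: mult_add_distrib_mat_vec[OF At] mult_mat_vec[OF At])
  hence row1: "D *\<^sub>v x' + (- \<beta> \<cdot>\<^sub>v (A\<^sup>T *\<^sub>v (B *\<^sub>v (z - c))) + A\<^sup>T *\<^sub>v y')
      = (D *\<^sub>v x + (- \<beta> \<cdot>\<^sub>v (A\<^sup>T *\<^sub>v (B *\<^sub>v z)) + A\<^sup>T *\<^sub>v y)) - (D *\<^sub>v x + A\<^sup>T *\<^sub>v y)"
  proof -
    have "- (\<beta> \<cdot>\<^sub>v b + u) + (- \<beta> \<cdot>\<^sub>v (a - b) + u) = (d + (- \<beta> \<cdot>\<^sub>v a + f)) - (d + f)"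
      if "a \<in> carrier_vec nx" "b \<in> carrier_vec nx" "u \<in> carrier_vec nx" "d \<in> carrier_vec nx" "f \<in> carrier_vec nx"
      for a b u d f :: "real vec"
      using that by (intro eq_vecI) (auto simp: algebra_simps)
    from this[OF Atc(1,2,3,5,4)] show ?thesis
      unfolding Dx \<open>A\<^sup>T *\<^sub>v e = _\<close> Bzc mult_minus_distrib_mat_vec[OF At Bcc(2,1)] .
  qed
  have row2: "B\<^sup>T *\<^sub>v y' = B\<^sup>T *\<^sub>v y - B\<^sup>T *\<^sub>v y"
    unfolding By' using Atc(7) by (intro eq_vecI) auto
  \<comment> \<open>Multiplied by \<beta>, this row is y + \<beta> B z = \<beta> s + e, the defining
    equation of s.\<close>
  have row3: "A *\<^sub>v x' + (B *\<^sub>v (z - c) + - (1 / \<beta>) \<cdot>\<^sub>v y')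
      = (A *\<^sub>v x + (B *\<^sub>v z + - (1 / \<beta>) \<cdot>\<^sub>v y)) - (A *\<^sub>v x + B *\<^sub>v z)"
  proof -
    have "- s + (a - b + - (1 / \<beta>) \<cdot>\<^sub>v u) = (d + (a + - (1 / \<beta>) \<cdot>\<^sub>v y)) - (d + a)"
      if cc: "a \<in> carrier_vec ny" "b \<in> carrier_vec ny" "u \<in> carrier_vec ny" "d \<in> carrier_vec ny"
        and eq: "y + \<beta> \<cdot>\<^sub>v a = \<beta> \<cdot>\<^sub>v s + (\<beta> \<cdot>\<^sub>v b + u)" for a b u d :: "real vec"
    proof (rule eq_vecI)
      fix i assume "i < dim_vec ((d + (a + - (1 / \<beta>) \<cdot>\<^sub>v y)) - (d + a))"
      hence i: "i < ny" using cc by simp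
      have "(y + \<beta> \<cdot>\<^sub>v a) $ i = (\<beta> \<cdot>\<^sub>v s + (\<beta> \<cdot>\<^sub>v b + u)) $ i" by (simp only: eq)
      hence yi: "y $ i = \<beta> * s $ i + \<beta> * b $ i + u $ i - \<beta> * a $ i" using i cc s y by simp
      show "(- s + (a - b + - (1 / \<beta>) \<cdot>\<^sub>v u)) $ i = ((d + (a + - (1 / \<beta>) \<cdot>\<^sub>v y)) - (d + a)) $ i"
        using i cc s y beta_pos by (simp add: yi) (simp add: field_simps)
    qed (use cc s in auto)
    from this[OF Bcc(2,1) y' Atc(6)] w[unfolded e_def[symmetric] e_split] show ?thesis
      unfolding Ax Bzc by blast
  qed
  have "G \<beta> *\<^sub>v (x @\<^sub>v z @\<^sub>v y) = x' @\<^sub>v (z - c) @\<^sub>v y'"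
  proof (rule G_multI[OF beta_pos])
    show "x @\<^sub>v z @\<^sub>v y \<in> carrier_vec N" using x z y by simp
    show "x' @\<^sub>v (z - c) @\<^sub>v y' \<in> carrier_vec N" using x' zc y' by simp
    have minus_append: "(a - a') @\<^sub>v (b - b') @\<^sub>v (d - d') = (a @\<^sub>v b @\<^sub>v d) - (a' @\<^sub>v b' @\<^sub>v d')"
      if "a \<in> carrier_vec nx" "a' \<in> carrier_vec nx" "b \<in> carrier_vec nz" "b' \<in> carrier_vec nz"
        "d \<in> carrier_vec ny" "d' \<in> carrier_vec ny" for a b d a' b' d' :: "real vec"
      using that by (intro eq_vecI) auto
    show "admm_precond A B D \<beta> *\<^sub>v (x' @\<^sub>v (z - c) @\<^sub>v y')
        = admm_precond A B D \<beta> *\<^sub>v (x @\<^sub>v z @\<^sub>v y) - kkt_mat A B D *\<^sub>v (x @\<^sub>v z @\<^sub>v y)"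
      unfolding precond_mult_vec[OF x' zc y'] precond_mult_vec[OF x z y] kkt_mult_vec[OF x z y]
        row1 row2 row3 by (rule minus_append) (use Atc Bcc y in auto)
  qed
  thus ?thesis by (simp add: x'_def y'_def e_def)
qed


lemma shift_solve:
  assumes w: "w \<in> carrier_vec ny"
  obtains s c where "s \<in> carrier_vec ny" "w = \<beta> \<cdot>\<^sub>v s + Dt *\<^sub>v s"
    "c \<in> carrier_vec nz" "\<beta> \<cdot>\<^sub>v (R *\<^sub>v c) = Q\<^sup>T *\<^sub>v (Dt *\<^sub>v s)"
proof -
  obtain s where s: "s \<in> carrier_vec ny" "w = \<beta> \<cdot>\<^sub>v s + Dt *\<^sub>v s" using shift_surj[OF w] .
  have q: "Q\<^sup>T *\<^sub>v (Dt *\<^sub>v s) \<in> carrier_vec nz" using QR(1) Dt(1) s(1) by simp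
  obtain c where "c \<in> carrier_vec nz" "\<beta> \<cdot>\<^sub>v (R *\<^sub>v c) = Q\<^sup>T *\<^sub>v (Dt *\<^sub>v s)"
    using R_solve[OF q] by blast
  with s show ?thesis using that by blast
qed

lemma G_range:
  assumes v: "v \<in> carrier_vec N"
  obtains x z b where "G \<beta> *\<^sub>v v = x @\<^sub>v z @\<^sub>v (P *\<^sub>v b)" "x \<in> carrier_vec nx" "z \<in> carrier_vec nz" "b \<in> carrier_vec np"
proof -
  obtain x z y where e: "v = x @\<^sub>v z @\<^sub>v y" and
    c: "x \<in> carrier_vec nx" "z \<in> carrier_vec nz" "y \<in> carrier_vec ny" using carrier_vec_append_split3[OF v] .
  have "y + \<beta> \<cdot>\<^sub>v (B *\<^sub>v z) \<in> carrier_vec ny" using B c by simp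
  from shift_solve[OF this] obtain s d where s: "s \<in> carrier_vec ny" "y + \<beta> \<cdot>\<^sub>v (B *\<^sub>v z) = \<beta> \<cdot>\<^sub>v s + Dt *\<^sub>v s"
    and d: "d \<in> carrier_vec nz" "\<beta> \<cdot>\<^sub>v (R *\<^sub>v d) = Q\<^sup>T *\<^sub>v (Dt *\<^sub>v s)" by blast
  have "mat_inv D *\<^sub>v (A\<^sup>T *\<^sub>v (Dt *\<^sub>v s)) \<in> carrier_vec nx" "P\<^sup>T *\<^sub>v (Dt *\<^sub>v s) \<in> carrier_vec np"
    "z - d \<in> carrier_vec nz"
    using D_inv A Dt(1) s(1) P c d by simp_all
  with G_mult_vec[OF c s d] show ?thesis using that e by (metis uminus_carrier_vec)
qed

lemma G_ignores_x:
  assumes "x \<in> carrier_vec nx" "z \<in> carrier_vec nz" "y \<in> carrier_vec ny"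
  shows "G \<beta> *\<^sub>v (x @\<^sub>v z @\<^sub>v y) = G \<beta> *\<^sub>v (0\<^sub>v nx @\<^sub>v z @\<^sub>v y)"
proof -
  have "y + \<beta> \<cdot>\<^sub>v (B *\<^sub>v z) \<in> carrier_vec ny" using B assms by simp
  from shift_solve[OF this] obtain s d where s: "s \<in> carrier_vec ny" "y + \<beta> \<cdot>\<^sub>v (B *\<^sub>v z) = \<beta> \<cdot>\<^sub>v s + Dt *\<^sub>v s"
    and d: "d \<in> carrier_vec nz" "\<beta> \<cdot>\<^sub>v (R *\<^sub>v d) = Q\<^sup>T *\<^sub>v (Dt *\<^sub>v s)" by blast
  show ?thesis using G_mult_vec[OF assms s d] G_mult_vec[OF zero_carrier_vec assms(2,3) s d] by simp
qed

text \<open>On the range, y = P b, so w = Q a + P b and the state (a, b) is U^T w with U = [Q P].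
  From w = \<beta> s + e and H w = \<beta> s - e, half the sum of w and H w is \<beta> s and half
  the difference is e. The iteration keeps Q^T (\<beta> s) in the first block and P^T e in the
  second; these different choices are the origin of the sign matrix J in K.\<close>

lemma state_step:
  assumes x: "x \<in> carrier_vec nx" and z: "z \<in> carrier_vec nz" and b: "b \<in> carrier_vec np"
  shows "state_mat *\<^sub>v (G \<beta> *\<^sub>v (x @\<^sub>v z @\<^sub>v (P *\<^sub>v b))) = F *\<^sub>v (state_mat *\<^sub>v (x @\<^sub>v z @\<^sub>v (P *\<^sub>v b)))"
proof -
  have Pb: "P *\<^sub>v b \<in> carrier_vec ny" using P b by simp
  have Qt: "Q\<^sup>T \<in> carrier_mat nz ny" and Pt: "P\<^sup>T \<in> carrier_mat np ny" using QR P by simp_all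
  define w where "w = P *\<^sub>v b + \<beta> \<cdot>\<^sub>v (B *\<^sub>v z)"
  have w: "w \<in> carrier_vec ny" using B Pb z by (simp add: w_def)
  obtain s c where s: "s \<in> carrier_vec ny" "w = \<beta> \<cdot>\<^sub>v s + Dt *\<^sub>v s"
    and c: "c \<in> carrier_vec nz" "\<beta> \<cdot>\<^sub>v (R *\<^sub>v c) = Q\<^sup>T *\<^sub>v (Dt *\<^sub>v s)" using shift_solve[OF w] .
  define e where "e = Dt *\<^sub>v s"
  have e: "e \<in> carrier_vec ny" unfolding e_def by (rule mult_mat_vec_carrier[OF Dt(1) s(1)])
  have bs: "\<beta> \<cdot>\<^sub>v s \<in> carrier_vec ny" using s by simp
  have Rz: "R *\<^sub>v z \<in> carrier_vec nz" "R *\<^sub>v c \<in> carrier_vec nz" using QR z c by simp_all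
  define a where "a = \<beta> \<cdot>\<^sub>v (R *\<^sub>v z)"
  have a: "a \<in> carrier_vec nz" using Rz by (simp add: a_def)
  have w_split: "w = Q *\<^sub>v a + P *\<^sub>v b"
  proof -
    have "\<beta> \<cdot>\<^sub>v (B *\<^sub>v z) = Q *\<^sub>v a" unfolding a_def mult_mat_vec[OF QR(1) Rz(1)]
      using QR(1,2,4) z by simp
    moreover have "Q *\<^sub>v a \<in> carrier_vec ny" using QR(1) a by simp
    ultimately show ?thesis unfolding w_def using Pb by (simp add: comm_add_vec[of _ ny])
  qed
  have a_eq: "a = Q\<^sup>T *\<^sub>v (\<beta> \<cdot>\<^sub>v s) + Q\<^sup>T *\<^sub>v e"
    using transpose_split(1)[OF a b] mult_add_distrib_mat_vec[OF Qt bs e] s(2) w_split by (simp add: e_def)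
  have b_eq: "b = P\<^sup>T *\<^sub>v (\<beta> \<cdot>\<^sub>v s) + P\<^sup>T *\<^sub>v e"
    using transpose_split(2)[OF a b] mult_add_distrib_mat_vec[OF Pt bs e] s(2) w_split by (simp add: e_def)
  have PPb: "P\<^sup>T *\<^sub>v (P *\<^sub>v b) = b" using b by (rule transpose_cross(3))
  have Pe: "P\<^sup>T *\<^sub>v e \<in> carrier_vec np" "Q\<^sup>T *\<^sub>v e \<in> carrier_vec nz"
    "P\<^sup>T *\<^sub>v (\<beta> \<cdot>\<^sub>v s) \<in> carrier_vec np" "Q\<^sup>T *\<^sub>v (\<beta> \<cdot>\<^sub>v s) \<in> carrier_vec nz"
    using mult_mat_vec_carrier[OF Pt e] mult_mat_vec_carrier[OF Qt e]
      mult_mat_vec_carrier[OF Pt bs] mult_mat_vec_carrier[OF Qt bs] by blast+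
  have Gv: "G \<beta> *\<^sub>v (x @\<^sub>v z @\<^sub>v (P *\<^sub>v b))
    = (- (mat_inv D *\<^sub>v (A\<^sup>T *\<^sub>v e))) @\<^sub>v (z - c) @\<^sub>v (P *\<^sub>v (P\<^sup>T *\<^sub>v e))"
    unfolding e_def using G_mult_vec[OF x z Pb s(1) _ c] s(2) by (simp add: w_def)
  have "- (mat_inv D *\<^sub>v (A\<^sup>T *\<^sub>v e)) \<in> carrier_vec nx" "z - c \<in> carrier_vec nz" "P *\<^sub>v (P\<^sup>T *\<^sub>v e) \<in> carrier_vec ny"
    using D_inv A e z c P by simp_all
  hence "state_mat *\<^sub>v (G \<beta> *\<^sub>v (x @\<^sub>v z @\<^sub>v (P *\<^sub>v b)))
      = (\<beta> \<cdot>\<^sub>v (R *\<^sub>v (z - c))) @\<^sub>v (P\<^sup>T *\<^sub>v (P *\<^sub>v (P\<^sup>T *\<^sub>v e)))"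
    unfolding Gv by (rule state_mult_vec)
  also have "P\<^sup>T *\<^sub>v (P *\<^sub>v (P\<^sup>T *\<^sub>v e)) = P\<^sup>T *\<^sub>v e" using Pe(1) by (rule transpose_cross(3))
  also have "\<beta> \<cdot>\<^sub>v (R *\<^sub>v (z - c)) = a - Q\<^sup>T *\<^sub>v e"
  proof -
    have "\<beta> \<cdot>\<^sub>v (u - v) = \<beta> \<cdot>\<^sub>v u - \<beta> \<cdot>\<^sub>v v" if "u \<in> carrier_vec nz" "v \<in> carrier_vec nz" for u v :: "real vec"
      using that by (intro eq_vecI) (auto simp: algebra_simps)
    from this[OF Rz] show ?thesis
      by (simp only: mult_minus_distrib_mat_vec[OF QR(2) z c(1)] c(2) a_def e_def)
  qed
  finally have lhs: "state_mat *\<^sub>v (G \<beta> *\<^sub>v (x @\<^sub>v z @\<^sub>v (P *\<^sub>v b))) = (a - Q\<^sup>T *\<^sub>v e) @\<^sub>v (P\<^sup>T *\<^sub>v e)" .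
  have st: "state_mat *\<^sub>v (x @\<^sub>v z @\<^sub>v (P *\<^sub>v b)) = a @\<^sub>v b"
    by (simp only: state_mult_vec[OF x z Pb] PPb a_def)
  have ab: "a @\<^sub>v b \<in> carrier_vec ny" using append_carrier_vec[OF a b] k_le by simp
  have "K *\<^sub>v (a @\<^sub>v b) = (Q\<^sup>T *\<^sub>v (H *\<^sub>v w)) @\<^sub>v - (P\<^sup>T *\<^sub>v (H *\<^sub>v w))"
    unfolding K_mult_vec(1)[OF ab] U_mult_vec[OF a b] w_split[symmetric] ..
  also have "H *\<^sub>v w = \<beta> \<cdot>\<^sub>v s - e" unfolding s(2) e_def by (rule H_mult_vec[OF s(1)])
  finally have Kab: "K *\<^sub>v (a @\<^sub>v b) = (Q\<^sup>T *\<^sub>v (\<beta> \<cdot>\<^sub>v s) - Q\<^sup>T *\<^sub>v e) @\<^sub>v - (P\<^sup>T *\<^sub>v (\<beta> \<cdot>\<^sub>v s) - P\<^sup>T *\<^sub>v e)"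
    by (simp only: mult_minus_distrib_mat_vec[OF Qt bs e] mult_minus_distrib_mat_vec[OF Pt bs e])
  have "F *\<^sub>v (a @\<^sub>v b) = (1 / 2) \<cdot>\<^sub>v ((a @\<^sub>v b) + K *\<^sub>v (a @\<^sub>v b))"
    unfolding F_def using ab
    by (simp add: smult_mat_mult_vec[of _ ny ny] add_mult_distrib_mat_vec[of _ ny ny])
  also have "\<dots> = (a - Q\<^sup>T *\<^sub>v e) @\<^sub>v (P\<^sup>T *\<^sub>v e)"
  proof -
    have "(1 / 2) \<cdot>\<^sub>v (((p + q) @\<^sub>v (p' + q')) + ((p - q) @\<^sub>v (- (p' - q')))) = (p + q - q) @\<^sub>v q'"
      if "p \<in> carrier_vec nz" "q \<in> carrier_vec nz" "p' \<in> carrier_vec np" "q' \<in> carrier_vec np"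
      for p q p' q' :: "real vec"
      using that by (intro eq_vecI) auto
    from this[OF Pe(4,2,3,1)] show ?thesis
      unfolding Kab a_eq[symmetric] b_eq[symmetric] .
  qed
  finally show ?thesis unfolding lhs st by simp
qed

text \<open>A right inverse of the state map, with x = 0 and values in the range. Its norm is
  controlled because the scaling matrix sends (0, z, b, 0) to (0, a, b, 0).\<close>

lemma state_lift:
  assumes \<sigma>: "\<sigma> \<in> carrier_vec ny"
  obtains z b where "z \<in> carrier_vec nz" "b \<in> carrier_vec np"
    "state_mat *\<^sub>v (0\<^sub>v nx @\<^sub>v z @\<^sub>v (P *\<^sub>v b)) = \<sigma>"
    "vec_norm2 (0\<^sub>v nx @\<^sub>v z @\<^sub>v (P *\<^sub>v b)) \<le> mat_norm2 (mat_inv Sc) * vec_norm2 \<sigma>"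
proof -
  obtain a b where e: "\<sigma> = a @\<^sub>v b" and ab: "a \<in> carrier_vec nz" "b \<in> carrier_vec np" using J_split[OF \<sigma>] .
  obtain z where z: "z \<in> carrier_vec nz" "\<beta> \<cdot>\<^sub>v (R *\<^sub>v z) = a" using R_solve[OF ab(1)] by blast
  have Pb: "P *\<^sub>v b \<in> carrier_vec ny" using P ab by simp
  have PPb: "P\<^sup>T *\<^sub>v (P *\<^sub>v b) = b" using ab(2) by (rule transpose_cross(3))
  have st: "state_mat *\<^sub>v (0\<^sub>v nx @\<^sub>v z @\<^sub>v (P *\<^sub>v b)) = \<sigma>"
    by (simp only: state_mult_vec[OF zero_carrier_vec z(1) Pb] z(2) PPb e)
  let ?u = "0\<^sub>v nx @\<^sub>v z @\<^sub>v b @\<^sub>v (0\<^sub>v nz :: real vec)"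
  let ?s = "0\<^sub>v nx @\<^sub>v a @\<^sub>v b @\<^sub>v (0\<^sub>v nz :: real vec)"
  have Pb_norm: "vec_norm2 (P *\<^sub>v b) = vec_norm2 b"
    using split_norm[OF Pb] PPb transpose_cross(4)[OF ab(2)] by simp
  have sq: "(vec_norm2 (0\<^sub>v nx @\<^sub>v z @\<^sub>v (P *\<^sub>v b)))\<^sup>2 = (vec_norm2 ?u)\<^sup>2" "(vec_norm2 \<sigma>)\<^sup>2 = (vec_norm2 ?s)\<^sup>2"
    by (simp_all add: vec_norm2_append Pb_norm e)
  hence n: "vec_norm2 (0\<^sub>v nx @\<^sub>v z @\<^sub>v (P *\<^sub>v b)) = vec_norm2 ?u" "vec_norm2 \<sigma> = vec_norm2 ?s" by simp_all
  have u: "?u \<in> carrier_vec (nx + (nz + (np + nz)))" "?s \<in> carrier_vec (nx + (nz + (np + nz)))"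
    using z ab by simp_all
  have "\<beta> \<cdot>\<^sub>v 0\<^sub>v nx = 0\<^sub>v nx" by (intro eq_vecI) auto
  hence Su: "Sc *\<^sub>v ?u = ?s" by (simp only: scaling_mult_vec[OF zero_carrier_vec z(1) ab(2) zero_carrier_vec] z(2))
  have "vec_norm2 ?u = vec_norm2 (mat_inv Sc *\<^sub>v ?s)"
    using mat_inv_cancel(2)[OF scaling_carrier scaling_det u(1)] by (simp only: Su)
  also have "\<dots> \<le> mat_norm2 (mat_inv Sc) * vec_norm2 ?s"
    by (rule vec_norm2_mult_le[OF mat_inv_det(1)[OF scaling_carrier scaling_det] u(2)])
  finally show ?thesis using that[OF z(1) ab(2) st] n by simp
qed

abbreviation g_norm :: real where "g_norm \<equiv> mat_norm2 (G \<beta>)"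

lemma c1_eq: "c1_factor A B D R \<beta> = cond2 Sc * g_norm\<^sup>2"
  by (simp add: c1_factor_def G_def)

text \<open>Write G^2 q(G) v as G applied to q(G) G v. The inner G moves v into the range, where the
  state evolves by F; the outer G forgets x, so its argument may be replaced by the lift of its
  state. The norms along the way are those of G, the scaling matrix, q(F), the inverse scaling
  matrix and G, which explains both parts of c1.\<close>

lemma poly_G_norm:
  assumes bound: "\<And>\<sigma>. \<sigma> \<in> carrier_vec ny \<Longrightarrow> vec_norm2 (poly_vec q F \<sigma>) \<le> c * vec_norm2 \<sigma>" and c: "0 \<le> c"
    and v: "v \<in> carrier_vec N"
  shows "vec_norm2 (poly_vec (pCons 0 (pCons 0 q)) (G \<beta>) v) \<le> c1_factor A B D R \<beta> * c * vec_norm2 v"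
proof -
  note Gc = G_carrier[OF beta_pos]
  define u where "u = poly_vec q (G \<beta>) v"
  have u: "u \<in> carrier_vec N" unfolding u_def by (rule poly_vec_carrier[OF Gc v])
  have Gu: "G \<beta> *\<^sub>v u \<in> carrier_vec N" using Gc u by (rule mult_mat_vec_carrier)
  have Gv: "G \<beta> *\<^sub>v v \<in> carrier_vec N" using Gc v by (rule mult_mat_vec_carrier)
  have pc: "poly_vec (pCons 0 p) (G \<beta>) v = G \<beta> *\<^sub>v poly_vec p (G \<beta>) v" for p
    using mult_mat_vec_carrier[OF Gc poly_vec_carrier[OF Gc v, of p]] v
    by (simp add: poly_vec_pCons[OF Gc v] zero_smult_vec)
  have eq: "poly_vec (pCons 0 (pCons 0 q)) (G \<beta>) v = G \<beta> *\<^sub>v (G \<beta> *\<^sub>v u)" by (simp only: pc u_def)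
  define f where "f = state_mat * G \<beta>"
  have fc: "f \<in> carrier_mat ny N" using state_carrier Gc by (simp add: f_def)
  have f: "f *\<^sub>v w = state_mat *\<^sub>v (G \<beta> *\<^sub>v w)" if "w \<in> carrier_vec N" for w
    unfolding f_def by (rule assoc_mult_mat_vec[OF state_carrier Gc that])
  have step: "f *\<^sub>v (G \<beta> *\<^sub>v w) = F *\<^sub>v (f *\<^sub>v w)" if w: "w \<in> carrier_vec N" for w
  proof -
    obtain x z b where "G \<beta> *\<^sub>v w = x @\<^sub>v z @\<^sub>v (P *\<^sub>v b)" "x \<in> carrier_vec nx" "z \<in> carrier_vec nz" "b \<in> carrier_vec np"
      using G_range[OF w] .
    thus ?thesis using state_step f[OF w] f[OF mult_mat_vec_carrier[OF Gc w]] by simp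
  qed
  have "f * G \<beta> = F * f"
  proof (rule mat_eq_vecI)
    show "(f * G \<beta>) *\<^sub>v w = (F * f) *\<^sub>v w" if "w \<in> carrier_vec N" for w
      using step[OF that] assoc_mult_mat_vec[OF fc Gc that] assoc_mult_mat_vec[OF F_carrier fc that] by simp
  qed (use fc Gc F_carrier in auto)
  hence fu: "state_mat *\<^sub>v (G \<beta> *\<^sub>v u) = poly_vec q F (f *\<^sub>v v)"
    using poly_vec_mult_mat[OF Gc F_carrier fc _ v, of q] f[OF u] by (simp add: u_def)
  have fv: "f *\<^sub>v v \<in> carrier_vec ny" using fc v by (rule mult_mat_vec_carrier)
  define \<sigma> where "\<sigma> = poly_vec q F (f *\<^sub>v v)"
  have \<sigma>: "\<sigma> \<in> carrier_vec ny" unfolding \<sigma>_def by (rule poly_vec_carrier[OF F_carrier fv])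
  obtain z b where zb: "z \<in> carrier_vec nz" "b \<in> carrier_vec np"
    "state_mat *\<^sub>v (0\<^sub>v nx @\<^sub>v z @\<^sub>v (P *\<^sub>v b)) = \<sigma>"
    "vec_norm2 (0\<^sub>v nx @\<^sub>v z @\<^sub>v (P *\<^sub>v b)) \<le> mat_norm2 (mat_inv Sc) * vec_norm2 \<sigma>"
    using state_lift[OF \<sigma>] .
  \<comment> \<open>Both arguments of the outer G lie in the range and have the same state, so they
    agree except possibly in x.\<close>
  have GG: "G \<beta> *\<^sub>v (G \<beta> *\<^sub>v u) = G \<beta> *\<^sub>v (0\<^sub>v nx @\<^sub>v z @\<^sub>v (P *\<^sub>v b))"
  proof -
    obtain x' z' b' where g: "G \<beta> *\<^sub>v u = x' @\<^sub>v z' @\<^sub>v (P *\<^sub>v b')" "x' \<in> carrier_vec nx" "z' \<in> carrier_vec nz" "b' \<in> carrier_vec np"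
      using G_range[OF u] .
    have Pb: "P *\<^sub>v b' \<in> carrier_vec ny" "P *\<^sub>v b \<in> carrier_vec ny" using P g zb by simp_all
    have Rz: "\<beta> \<cdot>\<^sub>v (R *\<^sub>v z') \<in> carrier_vec nz" "\<beta> \<cdot>\<^sub>v (R *\<^sub>v z) \<in> carrier_vec nz" using QR(2) g zb by simp_all
    have "(\<beta> \<cdot>\<^sub>v (R *\<^sub>v z')) @\<^sub>v b' = \<sigma>"
      using fu state_mult_vec[OF g(2,3) Pb(1)] transpose_cross(3)[OF g(4)] by (simp add: g(1) \<sigma>_def)
    moreover have "(\<beta> \<cdot>\<^sub>v (R *\<^sub>v z)) @\<^sub>v b = \<sigma>"
      using zb(3) state_mult_vec[OF zero_carrier_vec zb(1) Pb(2)] transpose_cross(3)[OF zb(2)] by simp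
    ultimately have "(\<beta> \<cdot>\<^sub>v (R *\<^sub>v z')) @\<^sub>v b' = (\<beta> \<cdot>\<^sub>v (R *\<^sub>v z)) @\<^sub>v b" by simp
    hence "\<beta> \<cdot>\<^sub>v (R *\<^sub>v z') = \<beta> \<cdot>\<^sub>v (R *\<^sub>v z)" "b' = b" by (simp_all only: append_vec_eq[OF Rz])
    hence "z' = z" using R_cancel[OF g(3) zb(1)] by simp
    thus ?thesis using G_ignores_x[OF g(2,3) Pb(1)] \<open>b' = b\<close> by (simp add: g(1))
  qed
  have Pb: "0\<^sub>v nx @\<^sub>v z @\<^sub>v (P *\<^sub>v b) \<in> carrier_vec N" using P zb by simp
  have "vec_norm2 (f *\<^sub>v v) \<le> mat_norm2 Sc * vec_norm2 (G \<beta> *\<^sub>v v)"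
    unfolding f[OF v] by (rule state_norm[OF Gv])
  also have "\<dots> \<le> mat_norm2 Sc * (g_norm * vec_norm2 v)"
    by (intro mult_left_mono vec_norm2_mult_le[OF Gc v]) simp
  finally have fv_le: "c * vec_norm2 (f *\<^sub>v v) \<le> c * (mat_norm2 Sc * (g_norm * vec_norm2 v))"
    using c by (rule mult_left_mono)
  have "vec_norm2 (G \<beta> *\<^sub>v (G \<beta> *\<^sub>v u)) \<le> g_norm * vec_norm2 (0\<^sub>v nx @\<^sub>v z @\<^sub>v (P *\<^sub>v b))"
    unfolding GG by (rule vec_norm2_mult_le[OF Gc Pb])
  also have "\<dots> \<le> g_norm * (mat_norm2 (mat_inv Sc) * vec_norm2 \<sigma>)"
    using zb(4) by (rule mult_left_mono) simp
  also have "\<dots> \<le> g_norm * (mat_norm2 (mat_inv Sc) * (c * (mat_norm2 Sc * (g_norm * vec_norm2 v))))"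
    unfolding \<sigma>_def by (intro mult_left_mono order_trans[OF bound[OF fv] fv_le]) auto
  finally show ?thesis by (simp add: eq c1_eq cond2_def power2_eq_square mult_ac)
qed

text \<open>The state \<open>(0, a, -\<beta> B a)\<close>, for which \<open>w = 0\<close>, is mapped to \<open>(0, a, 0)\<close>.\<close>

lemma g_norm_lower: "1 \<le> 2 * (cond2 Sc * g_norm)\<^sup>2"
proof -
  note Gc = G_carrier[OF beta_pos]
  define a where "a = (unit_vec nz 0 :: real vec)"
  have a: "a \<in> carrier_vec nz" "a \<noteq> 0\<^sub>v nz"
    using dim_pos(3) by (auto simp: a_def dest: arg_cong[of _ _ "\<lambda>v. v $ 0"])
  have pos: "0 < vec_norm2 a" using a by (rule vec_norm2_pos)
  define y where "y = - (\<beta> \<cdot>\<^sub>v (B *\<^sub>v a))"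
  have Ba: "B *\<^sub>v a \<in> carrier_vec ny" using B a by simp
  have y: "y \<in> carrier_vec ny" using Ba by (simp add: y_def)
  have D0: "Dt *\<^sub>v 0\<^sub>v ny = 0\<^sub>v ny" by (rule mult_zero_vec[OF Dt(1)])
  have z0: "A\<^sup>T *\<^sub>v 0\<^sub>v ny = 0\<^sub>v nx" "mat_inv D *\<^sub>v 0\<^sub>v nx = 0\<^sub>v nx" "P\<^sup>T *\<^sub>v 0\<^sub>v ny = 0\<^sub>v np" "P *\<^sub>v 0\<^sub>v np = 0\<^sub>v ny"
    "R *\<^sub>v 0\<^sub>v nz = 0\<^sub>v nz" "Q\<^sup>T *\<^sub>v 0\<^sub>v ny = 0\<^sub>v nz"
    using A D_inv P QR by (auto intro!: mult_zero_vec)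
  have s0: "\<beta> \<cdot>\<^sub>v 0\<^sub>v k = (0\<^sub>v k :: real vec)" for k by (intro eq_vecI) auto
  have "y + \<beta> \<cdot>\<^sub>v (B *\<^sub>v a) = \<beta> \<cdot>\<^sub>v 0\<^sub>v ny + Dt *\<^sub>v 0\<^sub>v ny"
    using Ba by (simp add: y_def D0 s0 uminus_l_inv_vec)
  moreover have "\<beta> \<cdot>\<^sub>v (R *\<^sub>v 0\<^sub>v nz) = Q\<^sup>T *\<^sub>v (Dt *\<^sub>v 0\<^sub>v ny)" by (simp add: D0 z0 s0)
  ultimately have "G \<beta> *\<^sub>v (0\<^sub>v nx @\<^sub>v a @\<^sub>v y) = (- 0\<^sub>v nx) @\<^sub>v (a - 0\<^sub>v nz) @\<^sub>v 0\<^sub>v ny"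
    using G_mult_vec[OF zero_carrier_vec a(1) y zero_carrier_vec _ zero_carrier_vec] by (simp add: D0 z0)
  hence "(vec_norm2 (G \<beta> *\<^sub>v (0\<^sub>v nx @\<^sub>v a @\<^sub>v y)))\<^sup>2 = (vec_norm2 a)\<^sup>2"
    using a by (simp add: vec_norm2_append)
  hence "(vec_norm2 a)\<^sup>2 \<le> (g_norm * vec_norm2 (0\<^sub>v nx @\<^sub>v a @\<^sub>v y))\<^sup>2"
    using vec_norm2_mult_le[OF Gc, of "0\<^sub>v nx @\<^sub>v a @\<^sub>v y"] a y by (metis append_carrier_vec power_mono vec_norm2_nonneg zero_carrier_vec)
  also have "\<dots> = g_norm\<^sup>2 * ((vec_norm2 a)\<^sup>2 + (\<beta> * vec_norm2 (B *\<^sub>v a))\<^sup>2)"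
    using beta_pos by (simp add: power_mult_distrib vec_norm2_append y_def vec_norm2_smult)
  also have "\<dots> \<le> g_norm\<^sup>2 * ((cond2 Sc * vec_norm2 a)\<^sup>2 + (cond2 Sc * vec_norm2 a)\<^sup>2)"
    using scaling_cond_ge[OF a(1)] scaling_cond_ge_1 beta_pos mult_right_mono[OF scaling_cond_ge_1, of "vec_norm2 a"]
    by (intro mult_left_mono add_mono power_mono) auto
  also have "\<dots> = 2 * (cond2 Sc * g_norm)\<^sup>2 * (vec_norm2 a)\<^sup>2" by (simp add: power_mult_distrib)
  finally show ?thesis using pos by (simp add: pos_le_divide_eq)
qed

end

section \<open>Convergence bound\<close>

context admm_split
begin

text \<open>\<kappa> is the product of \<beta>/m and l/\<beta>, both at least 1, hence t \<le>
  \<kappa> \<le> t^2 for the larger factor t. The monotone map u -> (u - 1)/(u + 1) takes these two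
  ratios to g2 and g1, and the second fraction is its value at the smaller ratio \<kappa>/t.\<close>

lemma residual_polynomial_params:
  defines "\<kappa> \<equiv> l / m" and "t \<equiv> max (\<beta> / m) (l / \<beta>)"
  assumes "2 \<le> k"
  shows "residual_polynomial \<kappa> t k"
    "(t - 1) / (t + 1) = max g1 g2" "(t - 1) / (t + 1) * ((\<kappa> - t) / (\<kappa> + t)) = g1 * g2"
proof -
  note pos = m_pos beta_pos
  have 1: "1 \<le> \<beta> / m" "1 \<le> l / \<beta>" using pos beta_bounds by simp_all
  have prod: "\<kappa> = (\<beta> / m) * (l / \<beta>)" using pos by (simp add: \<kappa>_def)
  have t: "1 \<le> t" "t \<le> \<kappa>" "\<kappa> \<le> t\<^sup>2"
  proof -
    show "1 \<le> t" using 1 by (simp add: t_def le_max_iff_disj)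
    have "\<beta> / m * 1 \<le> (\<beta> / m) * (l / \<beta>)" "1 * (l / \<beta>) \<le> (\<beta> / m) * (l / \<beta>)"
      using 1 by (intro mult_left_mono mult_right_mono; simp)+
    thus "t \<le> \<kappa>" unfolding prod t_def by simp
    show "\<kappa> \<le> t\<^sup>2" unfolding prod t_def power2_eq_square using 1 by (intro mult_mono) auto
  qed
  show "residual_polynomial \<kappa> t k" using t assms(3) by unfold_locales
  have e: "(\<beta> / m - 1) / (\<beta> / m + 1) = g2" "(l / \<beta> - 1) / (l / \<beta> + 1) = g1"
    using pos beta_bounds by (simp_all add: divide_simps)
  have e2: "(\<kappa> - \<beta> / m) / (\<kappa> + \<beta> / m) = g1" "(\<kappa> - l / \<beta>) / (\<kappa> + l / \<beta>) = g2"
  proof -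
    have "\<kappa> - \<beta> / m = (l - \<beta>) / m" "\<kappa> + \<beta> / m = (l + \<beta>) / m"
      by (simp_all add: \<kappa>_def diff_divide_distrib add_divide_distrib)
    thus "(\<kappa> - \<beta> / m) / (\<kappa> + \<beta> / m) = g1" using pos by simp
    have "\<kappa> - l / \<beta> = (\<beta> - m) * (l / (m * \<beta>))" "\<kappa> + l / \<beta> = (\<beta> + m) * (l / (m * \<beta>))"
      using pos by (simp_all add: \<kappa>_def field_simps)
    moreover have "l / (m * \<beta>) \<noteq> 0" using pos beta_bounds by simp
    ultimately show "(\<kappa> - l / \<beta>) / (\<kappa> + l / \<beta>) = g2" by simp
  qed
  have mono: "(u - 1) / (u + 1) \<le> (v - 1) / (v + 1)" if "1 \<le> u" "u \<le> v" for u v :: real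
    using that by (simp add: divide_simps) (simp add: algebra_simps)
  show "(t - 1) / (t + 1) = max g1 g2" "(t - 1) / (t + 1) * ((\<kappa> - t) / (\<kappa> + t)) = g1 * g2"
  proof (atomize (full), cases "l / \<beta> \<le> \<beta> / m")
    case True
    hence t: "t = \<beta> / m" by (simp add: t_def)
    have "g1 \<le> g2" using mono[OF 1(2) True] by (simp only: e)
    thus "(t - 1) / (t + 1) = max g1 g2 \<and> (t - 1) / (t + 1) * ((\<kappa> - t) / (\<kappa> + t)) = g1 * g2"
      by (simp only: t e e2 max_absorb2 mult.commute simp_thms)
  next
    case False
    hence t: "t = l / \<beta>" by (simp add: t_def)
    have "g2 \<le> g1" using mono[OF 1(1), of "l / \<beta>"] False by (simp only: e not_le less_imp_le)
    thus "(t - 1) / (t + 1) = max g1 g2 \<and> (t - 1) / (t + 1) * ((\<kappa> - t) / (\<kappa> + t)) = g1 * g2"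
      by (simp only: t e e2 max_absorb1 simp_thms)
  qed
qed

lemma eigendecomposition_K:
  assumes "eigendecomposition (map_mat complex_of_real (K_mat A D Q P \<beta>)) X \<Lambda>"
  shows "X \<in> carrier_mat ny ny" "det X \<noteq> 0" "\<Lambda> \<in> carrier_mat ny ny" "diagonal_mat \<Lambda>"
    "X * \<Lambda> = map_mat complex_of_real K * X"
    "\<And>i. i < ny \<Longrightarrow> eigenvalue (map_mat complex_of_real K) (\<Lambda> $$ (i, i))"
proof -
  let ?K = "map_mat complex_of_real K"
  have Kc: "?K \<in> carrier_mat ny ny" by simp
  have "similar_mat_wit ?K \<Lambda> X (mat_inv X)" and d: "diagonal_mat \<Lambda>"
    using assms by (simp_all add: eigendecomposition_def K_mat_eq)
  from similar_mat_witD2[OF Kc this(1)]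
  have X: "X \<in> carrier_mat ny ny" "mat_inv X \<in> carrier_mat ny ny" and L: "\<Lambda> \<in> carrier_mat ny ny"
    and XX: "X * mat_inv X = 1\<^sub>m ny" "mat_inv X * X = 1\<^sub>m ny" and K_eq: "?K = X * \<Lambda> * mat_inv X" by auto
  show "X \<in> carrier_mat ny ny" "\<Lambda> \<in> carrier_mat ny ny" "diagonal_mat \<Lambda>" by fact+
  show det: "det X \<noteq> 0" using det_mult[OF X] XX(1) by force
  have "?K * X = X * \<Lambda> * (mat_inv X * X)"
    unfolding K_eq using X L by (intro assoc_mult_mat[of _ ny ny _ ny _ ny]) auto
  also have "\<dots> = X * \<Lambda>" using X L by (simp add: XX)
  finally show KX: "X * \<Lambda> = ?K * X" by simp
  fix i assume i: "i < ny"
  define x where "x = X *\<^sub>v unit_vec ny i"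
  have x: "x \<in> carrier_vec ny" using X by (simp add: x_def)
  have "x \<noteq> 0\<^sub>v ny"
  proof
    assume "x = 0\<^sub>v ny"
    hence "unit_vec ny i = mat_inv X *\<^sub>v 0\<^sub>v ny" using mat_inv_cancel(2)[OF X(1) det, of "unit_vec ny i"] by (simp add: x_def)
    hence "unit_vec ny i = (0\<^sub>v ny :: complex vec)" using mult_zero_vec[OF X(2)] by simp
    thus False using i by (metis index_unit_vec(1) index_zero_vec(1) zero_neq_one)
  qed
  have "\<Lambda> *\<^sub>v unit_vec ny i = \<Lambda> $$ (i, i) \<cdot>\<^sub>v unit_vec ny i"
    using L d i by (intro eq_vecI) (auto simp: diagonal_mat_def)
  moreover have "?K *\<^sub>v x = (X * \<Lambda>) *\<^sub>v unit_vec ny i"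
    unfolding KX x_def by (rule assoc_mult_mat_vec[OF Kc X(1) unit_vec_carrier, symmetric])
  moreover have "(X * \<Lambda>) *\<^sub>v unit_vec ny i = X *\<^sub>v (\<Lambda> *\<^sub>v unit_vec ny i)"
    by (rule assoc_mult_mat_vec[OF X(1) L unit_vec_carrier])
  ultimately have "?K *\<^sub>v x = \<Lambda> $$ (i, i) \<cdot>\<^sub>v x"
    by (simp add: x_def mult_mat_smult_vec[OF X(1)])
  thus "eigenvalue ?K (\<Lambda> $$ (i, i))"
    using x \<open>x \<noteq> 0\<^sub>v ny\<close> carrier_matD[OF K_carrier] by (auto simp: eigenvalue_def eigenvector_def)
qed

lemma gmres_bound:
  assumes eig: "eigendecomposition (map_mat complex_of_real (K_mat A D Q P \<beta>)) X \<Lambda>"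
    and r: "r \<in> carrier_vec N" and u0: "u0 \<in> carrier_vec N" and k: "1 \<le> k"
    and u: "gmres_left_iterate (admm_precond A B D \<beta>) (kkt_mat A B D) r u0 k u \<or>
      gmres_right_iterate (admm_precond A B D \<beta>) (kkt_mat A B D) r u0 k u"
  defines "\<rho> \<equiv> (l / m) powr (2 / 3) / ((l / m) powr (2 / 3) + 1)"
  shows "vec_norm2 (kkt_mat A B D *\<^sub>v u - r)
    \<le> 2 * c1_factor A B D R \<beta> * cond2 (admm_precond A B D \<beta>) * cond2 X * \<rho> powr (0.209 * real k)
      * vec_norm2 (kkt_mat A B D *\<^sub>v u0 - r)"
proof -
  note X = eigendecomposition_K[OF eig]
  note Gc = G_carrier[OF beta_pos]
  note gmres = gmres_residual_le[OF precond_carrier precond_det[OF beta_pos] kkt_carrier r u0 u G_eq]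
  have X1: "1 \<le> cond2 X" using cond2_ge_1[OF X(1,2) dim_pos(2)] .
  have cS: "1 \<le> cond2 Sc" by (rule scaling_cond_ge_1)
  have g: "0 \<le> g_norm" by simp
  \<comment> \<open>Any degree will do here: only the bounds on the rate are taken from it, and they
    must cover k = 1 as well.\<close>
  interpret two: residual_polynomial "l / m" "max (\<beta> / m) (l / \<beta>)" 2
    by (rule residual_polynomial_params(1)) simp
  have \<rho>: "\<rho> = two.rate" by (simp add: \<rho>_def two.rate_def)
  have rate: "1 / 2 \<le> \<rho>" "\<rho> < 1" using two.rate unfolding \<rho> by auto
  show ?thesis
  proof (cases "k = 1")
    \<comment> \<open>For p(z) = z the bound is the norm g of G, whereas c1 contains g^2. The
      missing factor is supplied by sqrt 2 * cond2 \<open>Sc\<close> * g \<ge> 1, and the other sqrt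
      2 compensates rate powr 0.209, as the rate is at least 1/2.\<close>
    case True
    have "sqrt 1 \<le> sqrt (2 * (cond2 Sc * g_norm)\<^sup>2)" using g_norm_lower by (rule real_sqrt_le_mono)
    hence sq: "1 \<le> sqrt 2 * (cond2 Sc * g_norm)" using cS g by (simp add: real_sqrt_mult)
    have "1 / sqrt 2 = (1 / 2 :: real) powr (1 / 2)" by (simp add: powr_half_sqrt real_sqrt_divide)
    also have "\<dots> \<le> (1 / 2) powr 0.209" by (intro powr_mono') auto
    also have "\<dots> \<le> \<rho> powr 0.209" using rate by (intro powr_mono2) auto
    finally have "sqrt 2 * (1 / sqrt 2) \<le> sqrt 2 * \<rho> powr 0.209" by (intro mult_left_mono) auto
    hence "1 \<le> sqrt 2 * \<rho> powr 0.209" by simp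
    hence "1 * 1 \<le> (sqrt 2 * (cond2 Sc * g_norm)) * (sqrt 2 * \<rho> powr 0.209)" using sq by (intro mult_mono) auto
    also have "\<dots> = 2 * (cond2 Sc * g_norm) * \<rho> powr 0.209" by simp
    finally have 1: "1 \<le> 2 * (cond2 Sc * g_norm) * \<rho> powr 0.209" by simp
    hence "1 * 1 \<le> (2 * (cond2 Sc * g_norm) * \<rho> powr 0.209) * cond2 X" using X1 by (intro mult_mono) auto
    hence "g_norm * 1 \<le> g_norm * ((2 * (cond2 Sc * g_norm) * \<rho> powr 0.209) * cond2 X)"
      using g by (intro mult_left_mono) auto
    also have "\<dots> = 2 * c1_factor A B D R \<beta> * cond2 X * \<rho> powr 0.209"
      by (simp add: c1_eq power2_eq_square)
    finally have g_le: "g_norm \<le> 2 * c1_factor A B D R \<beta> * cond2 X * \<rho> powr 0.209" by simp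
    have pv: "poly_vec [:0, 1:] (G \<beta>) v = G \<beta> *\<^sub>v v" if "v \<in> carrier_vec N" for v
      using that mult_mat_vec_carrier[OF Gc that] Gc
      by (simp add: poly_vec_pCons[OF Gc that] zero_smult_vec mult_zero_vec[OF Gc])
    have "vec_norm2 (kkt_mat A B D *\<^sub>v u - r)
        \<le> g_norm * cond2 (admm_precond A B D \<beta>) * vec_norm2 (kkt_mat A B D *\<^sub>v u0 - r)"
      by (rule gmres[of "[:0, 1:]"]) (use True in \<open>auto simp: pv intro: vec_norm2_mult_le[OF Gc]\<close>)
    also have "\<dots> \<le> (2 * c1_factor A B D R \<beta> * cond2 X * \<rho> powr 0.209) * cond2 (admm_precond A B D \<beta>)
        * vec_norm2 (kkt_mat A B D *\<^sub>v u0 - r)"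
      using g_le by (intro mult_right_mono) (auto simp: cond2_def)
    finally show ?thesis using True by (simp add: mult_ac)
  next
    case False
    hence k2: "2 \<le> k" using k by simp
    note par = residual_polynomial_params[OF k2]
    interpret rp: residual_polynomial "l / m" "max (\<beta> / m) (l / \<beta>)" k by (rule par(1))
    define c where "c = 2 * \<rho> powr (0.209 * real k)"
    have c: "0 \<le> c" by (simp add: c_def)
    obtain q where q: "degree q \<le> k - 2" "poly q 1 = 1"
      and q_le: "\<And>e. rp.admissible e \<Longrightarrow> cmod (poly (map_poly complex_of_real q) ((1 + e) / 2)) \<le> c"
      using rp.residual_polynomial_exists by (auto simp: c_def \<rho>_def rp.rate_def)
    \<comment> \<open>The product a b must be rewritten before a alone, since \<open>par(2)\<close>
      would destroy the left-hand side of \<open>par(3)\<close>.\<close>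
    have adm: "rp.admissible e" if "eigenvalue (map_mat complex_of_real K) e" for e
      unfolding rp.admissible_def rp.a_def rp.b_def unfolding par(3) unfolding par(2)
      using K_complex_eigenvalue_bound[OF that] by blast
    define M where "M = (1 / 2 :: complex) \<cdot>\<^sub>m (1\<^sub>m ny + \<Lambda>)"
    have M: "M \<in> carrier_mat ny ny" "diagonal_mat M"
      using X(3,4) by (auto simp: M_def diagonal_mat_def)
    have Mii: "M $$ (i, i) = (1 + \<Lambda> $$ (i, i)) / 2" if "i < ny" for i
      using that X(3) by (simp add: M_def)
    have Fc: "map_mat complex_of_real F = (1 / 2 :: complex) \<cdot>\<^sub>m (1\<^sub>m ny + map_mat complex_of_real K)"
      using carrier_matD[OF K_carrier] by (intro eq_matI) (auto simp: F_def)
    have Kc: "map_mat complex_of_real K \<in> carrier_mat ny ny" by simp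
    have XM: "X * M = map_mat complex_of_real F * X"
      unfolding M_def Fc using X(1,3) Kc
      by (simp add: mult_smult_distrib[of _ ny ny _ ny] mult_smult_assoc_mat[of _ ny ny _ ny]
        mult_add_distrib_mat[of _ ny ny _ ny] add_mult_distrib_mat[of _ ny ny _ _ ny] X(5))
    have F_bound: "vec_norm2 (poly_vec q F \<sigma>) \<le> (c * cond2 X) * vec_norm2 \<sigma>" if "\<sigma> \<in> carrier_vec ny" for \<sigma>
      using poly_vec_diagonalizable_norm[OF F_carrier X(1,2) M XM _ c that] Mii q_le adm X(6) by simp
    have "vec_norm2 (kkt_mat A B D *\<^sub>v u - r)
        \<le> (c1_factor A B D R \<beta> * (c * cond2 X)) * cond2 (admm_precond A B D \<beta>)
          * vec_norm2 (kkt_mat A B D *\<^sub>v u0 - r)"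
    proof (rule gmres[of "pCons 0 (pCons 0 q)"])
      show "degree (pCons 0 (pCons 0 q)) \<le> k" using q(1) k2
        by (intro order_trans[OF degree_pCons_le] ) (auto intro: order_trans[OF degree_pCons_le])
      show "vec_norm2 (poly_vec (pCons 0 (pCons 0 q)) (G \<beta>) v) \<le> c1_factor A B D R \<beta> * (c * cond2 X) * vec_norm2 v"
        if "v \<in> carrier_vec N" for v
        using F_bound c X1 that by (intro poly_G_norm) auto
    qed (use q c X1 cS in \<open>auto simp: c1_eq\<close>)
    thus ?thesis by (simp add: c_def mult_ac)
  qed
qed

end

section \<open>Boundedness of c1 and of the condition number of the preconditioner for \<beta> in
  [m, l]\<close>

definition entrywise_continuous :: "real set \<Rightarrow> nat \<Rightarrow> nat \<Rightarrow> (real \<Rightarrow> real mat) \<Rightarrow> bool" where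
  "entrywise_continuous I n k \<Phi> \<longleftrightarrow> (\<forall>\<beta>. \<Phi> \<beta> \<in> carrier_mat n k) \<and>
    (\<forall>i < n. \<forall>j < k. continuous_on I (\<lambda>\<beta>. \<Phi> \<beta> $$ (i, j)))"

lemma entrywise_continuousD:
  assumes "entrywise_continuous I n k \<Phi>"
  shows "\<Phi> \<beta> \<in> carrier_mat n k" "i < n \<Longrightarrow> j < k \<Longrightarrow> continuous_on I (\<lambda>\<beta>. \<Phi> \<beta> $$ (i, j))"
  using assms by (auto simp: entrywise_continuous_def)

lemma entrywise_continuous_const: "A \<in> carrier_mat n k \<Longrightarrow> entrywise_continuous I n k (\<lambda>_. A)"
  by (simp add: entrywise_continuous_def)

lemma entrywise_continuous_smult:
  assumes "A \<in> carrier_mat n k" "continuous_on I f"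
  shows "entrywise_continuous I n k (\<lambda>\<beta>. f \<beta> \<cdot>\<^sub>m A)"
  using assms by (auto simp: entrywise_continuous_def intro!: continuous_intros)

lemma entrywise_continuous_append_cols:
  assumes \<Phi>: "entrywise_continuous I n k \<Phi>" and \<Psi>: "entrywise_continuous I n l \<Psi>"
  shows "entrywise_continuous I n (k + l) (\<lambda>\<beta>. \<Phi> \<beta> @\<^sub>c \<Psi> \<beta>)"
proof -
  have "(\<Phi> \<beta> @\<^sub>c \<Psi> \<beta>) $$ (i, j) = (if j < k then \<Phi> \<beta> $$ (i, j) else \<Psi> \<beta> $$ (i, j - k))"
    if "i < n" "j < k + l" for i j \<beta>
    using that entrywise_continuousD(1)[OF \<Phi>, of \<beta>] entrywise_continuousD(1)[OF \<Psi>, of \<beta>]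
    by (auto simp: append_cols_def)
  hence "continuous_on I (\<lambda>\<beta>. (\<Phi> \<beta> @\<^sub>c \<Psi> \<beta>) $$ (i, j))" if "i < n" "j < k + l" for i j
    using that \<Phi> \<Psi> by (cases "j < k") (simp_all add: entrywise_continuous_def)
  thus ?thesis using \<Phi> \<Psi> by (simp add: entrywise_continuous_def)
qed

lemma entrywise_continuous_append_rows:
  assumes \<Phi>: "entrywise_continuous I n k \<Phi>" and \<Psi>: "entrywise_continuous I l k \<Psi>"
  shows "entrywise_continuous I (n + l) k (\<lambda>\<beta>. \<Phi> \<beta> @\<^sub>r \<Psi> \<beta>)"
proof -
  have "(\<Phi> \<beta> @\<^sub>r \<Psi> \<beta>) $$ (i, j) = (if i < n then \<Phi> \<beta> $$ (i, j) else \<Psi> \<beta> $$ (i - n, j))"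
    if "i < n + l" "j < k" for i j \<beta>
    using that entrywise_continuousD(1)[OF \<Phi>, of \<beta>] entrywise_continuousD(1)[OF \<Psi>, of \<beta>]
    by (auto simp: append_rows_def)
  hence "continuous_on I (\<lambda>\<beta>. (\<Phi> \<beta> @\<^sub>r \<Psi> \<beta>) $$ (i, j))" if "i < n + l" "j < k" for i j
    using that \<Phi> \<Psi> by (cases "i < n") (simp_all add: entrywise_continuous_def)
  thus ?thesis using \<Phi> \<Psi> by (simp add: entrywise_continuous_def)
qed

lemma entrywise_continuous_det:
  assumes \<Phi>: "entrywise_continuous I n n \<Phi>"
  shows "continuous_on I (\<lambda>\<beta>. det (\<Phi> \<beta>))"
proof -
  have "det (\<Phi> \<beta>) = (\<Sum>p | p permutes {0..<n}. signof p * (\<Prod>i = 0..<n. \<Phi> \<beta> $$ (i, p i)))" for \<beta>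
    using entrywise_continuousD(1)[OF \<Phi>, of \<beta>] by (rule det_def')
  moreover have "continuous_on I (\<lambda>\<beta>. \<Sum>p | p permutes {0..<n}. signof p * (\<Prod>i = 0..<n. \<Phi> \<beta> $$ (i, p i)))"
    by (intro continuous_intros entrywise_continuousD(2)[OF \<Phi>]) (auto dest: permutes_in_image)
  ultimately show ?thesis by simp
qed

lemma entrywise_continuous_cofactor:
  assumes \<Phi>: "entrywise_continuous I n n \<Phi>" and ij: "i < n" "j < n"
  shows "continuous_on I (\<lambda>\<beta>. cofactor (\<Phi> \<beta>) i j)"
proof -
  have "entrywise_continuous I (n - 1) (n - 1) (\<lambda>\<beta>. mat_delete (\<Phi> \<beta>) i j)"
    unfolding entrywise_continuous_def
  proof (intro conjI allI impI)
    show "mat_delete (\<Phi> \<beta>) i j \<in> carrier_mat (n - 1) (n - 1)" for \<beta>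
      using entrywise_continuousD(1)[OF \<Phi>, of \<beta>] by (rule mat_delete_carrier)
    fix a b assume ab: "a < n - 1" "b < n - 1"
    have "mat_delete (\<Phi> \<beta>) i j $$ (a, b) = \<Phi> \<beta> $$ (if a < i then a else Suc a, if b < j then b else Suc b)" for \<beta>
      using ab entrywise_continuousD(1)[OF \<Phi>, of \<beta>] by (simp add: mat_delete_def)
    thus "continuous_on I (\<lambda>\<beta>. mat_delete (\<Phi> \<beta>) i j $$ (a, b))"
      using ab by (simp only:) (intro entrywise_continuousD(2)[OF \<Phi>]; auto)
  qed
  from entrywise_continuous_det[OF this] show ?thesis
    unfolding Determinant.cofactor_def by (intro continuous_intros)
qed

lemma mat_inv_adj:
  fixes A :: "real mat"
  assumes A: "A \<in> carrier_mat n n" and d: "det A \<noteq> 0"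
  shows "mat_inv A = (1 / det A) \<cdot>\<^sub>m adj_mat A"
proof (rule mat_invI[OF A])
  show "(1 / det A) \<cdot>\<^sub>m adj_mat A \<in> carrier_mat n n" using adj_mat(1)[OF A] by simp
  have "(1 / det A) \<cdot>\<^sub>m adj_mat A * A = (1 / det A) \<cdot>\<^sub>m (det A \<cdot>\<^sub>m 1\<^sub>m n)"
    using adj_mat[OF A] A by (simp add: mult_smult_assoc_mat[of _ n n _ n])
  also have "\<dots> = 1\<^sub>m n" using d by (intro eq_matI) auto
  finally show "(1 / det A) \<cdot>\<^sub>m adj_mat A * A = 1\<^sub>m n" .
qed

text \<open>By Cramer's rule the entries are cofactors divided by the determinant. The conclusion
  speaks of entries on I only, because outside I the matrix may be singular and the value and
  dimensions of \<open>mat_inv\<close> unspecified.\<close>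

lemma entrywise_continuous_mat_inv:
  assumes \<Phi>: "entrywise_continuous I n n \<Phi>" and d: "\<And>\<beta>. \<beta> \<in> I \<Longrightarrow> det (\<Phi> \<beta>) \<noteq> 0" and ij: "i < n" "j < n"
  shows "continuous_on I (\<lambda>\<beta>. mat_inv (\<Phi> \<beta>) $$ (i, j))"
proof -
  have "mat_inv (\<Phi> \<beta>) $$ (i, j) = (1 / det (\<Phi> \<beta>)) * cofactor (\<Phi> \<beta>) j i" if "\<beta> \<in> I" for \<beta>
    using mat_inv_adj[OF entrywise_continuousD(1)[OF \<Phi>] d[OF that]]
      entrywise_continuousD(1)[OF \<Phi>, of \<beta>] ij by (simp add: adj_mat_def)
  moreover have "continuous_on I (\<lambda>\<beta>. (1 / det (\<Phi> \<beta>)) * cofactor (\<Phi> \<beta>) j i)"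
    using d ij by (intro continuous_intros entrywise_continuous_det[OF \<Phi>] entrywise_continuous_cofactor[OF \<Phi>]) auto
  ultimately show ?thesis by (simp cong: continuous_on_cong)
qed

text \<open>The sum of the absolute values of the entries is continuous on a compact interval and
  dominates the spectral norm. Dimensions are assumed on the interval only, so that the lemma
  applies to inverses.\<close>

lemma mat_norm2_uniform_bound:
  fixes a b :: real
  assumes c: "\<And>\<beta>. \<beta> \<in> {a..b} \<Longrightarrow> \<Phi> \<beta> \<in> carrier_mat n k"
    and cont: "\<And>i j. i < n \<Longrightarrow> j < k \<Longrightarrow> continuous_on {a..b} (\<lambda>\<beta>. (\<Phi> \<beta> :: real mat) $$ (i, j))"
  shows "\<exists>C. \<forall>\<beta> \<in> {a..b}. mat_norm2 (\<Phi> \<beta>) \<le> C"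
proof (cases "a \<le> b")
  case True
  have "continuous_on {a..b} (\<lambda>\<beta>. \<Sum>i<n. \<Sum>j<k. norm (\<Phi> \<beta> $$ (i, j)))"
    by (intro continuous_intros cont) auto
  from continuous_attains_sup[OF compact_Icc _ this] True
  obtain x where x: "\<And>\<beta>. \<beta> \<in> {a..b} \<Longrightarrow>
    (\<Sum>i<n. \<Sum>j<k. norm (\<Phi> \<beta> $$ (i, j))) \<le> (\<Sum>i<n. \<Sum>j<k. norm (\<Phi> x $$ (i, j)))" by force
  show ?thesis
  proof (intro exI ballI)
    fix \<beta> assume b: "\<beta> \<in> {a..b}"
    have "entry_sum (\<Phi> \<beta>) \<le> (\<Sum>i<n. \<Sum>j<k. norm (\<Phi> x $$ (i, j)))"
      using x[OF b] c[OF b] by (simp add: entry_sum_def)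
    thus "mat_norm2 (\<Phi> \<beta>) \<le> (\<Sum>i<n. \<Sum>j<k. norm (\<Phi> x $$ (i, j)))"
      by (rule order_trans[OF mat_norm2_le_entry_sum])
  qed
qed auto

context admm
begin

lemma precond_continuous: "0 < a \<Longrightarrow> entrywise_continuous {a..b} N N (\<lambda>\<beta>. admm_precond A B D \<beta>)"
proof -
  assume a: "0 < a"
  have d: "dim_col A = nx" "dim_row A = ny" "dim_col B = nz" using A B by auto
  have f: "continuous_on {a..b} (\<lambda>\<beta>. - \<beta>)" "continuous_on {a..b} (\<lambda>\<beta>. - (1 / \<beta>))"
    using a by (auto intro!: continuous_intros)
  show ?thesis unfolding admm_precond_def Let_def d using A B D f
    by (intro entrywise_continuous_append_rows entrywise_continuous_append_cols
      entrywise_continuous_smult entrywise_continuous_const) auto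
qed

lemma precond_uniform_bound:
  "\<exists>C. \<forall>\<beta>. m \<le> \<beta> \<and> \<beta> \<le> l \<longrightarrow> cond2 (admm_precond A B D \<beta>) \<le> C \<and> mat_norm2 (G \<beta>) \<le> C"
proof -
  note cont = precond_continuous[OF m_pos, of l]
  have d: "det (admm_precond A B D \<beta>) \<noteq> 0" if "\<beta> \<in> {m..l}" for \<beta> using that m_pos precond_det by simp
  obtain C1 where C1: "\<And>\<beta>. \<beta> \<in> {m..l} \<Longrightarrow> mat_norm2 (admm_precond A B D \<beta>) \<le> C1"
    using mat_norm2_uniform_bound[OF entrywise_continuousD[OF cont]] by blast
  obtain C2 where C2: "\<And>\<beta>. \<beta> \<in> {m..l} \<Longrightarrow> mat_norm2 (mat_inv (admm_precond A B D \<beta>)) \<le> C2"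
    using mat_norm2_uniform_bound[of m l "\<lambda>\<beta>. mat_inv (admm_precond A B D \<beta>)" N N]
      mat_inv_det(1)[OF precond_carrier d] entrywise_continuous_mat_inv[OF cont d] by blast
  define C3 where "C3 = mat_norm2 (1\<^sub>m N :: real mat) + C2 * mat_norm2 (kkt_mat A B D)"
  have "cond2 (admm_precond A B D \<beta>) \<le> C1 * C2" "mat_norm2 (G \<beta>) \<le> C3" if b: "\<beta> \<in> {m..l}" for \<beta>
  proof -
    let ?P = "admm_precond A B D \<beta>"
    note i = mat_inv_det[OF precond_carrier d[OF b]]
    have "0 \<le> C1" using C1[OF b] mat_norm2_nonneg order_trans by blast
    thus "cond2 ?P \<le> C1 * C2" unfolding cond2_def using C1[OF b] C2[OF b] by (intro mult_mono) auto
    have C2_nonneg: "0 \<le> C2" using C2[OF b] mat_norm2_nonneg order_trans by blast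
    hence nonneg: "0 \<le> C3" by (simp add: C3_def)
    show "mat_norm2 (G \<beta>) \<le> C3"
    proof (rule mat_norm2_le[OF G_carrier nonneg])
      show "0 < \<beta>" using b m_pos by simp
      fix v :: "real vec" assume v: "v \<in> carrier_vec N"
      have Mv: "kkt_mat A B D *\<^sub>v v \<in> carrier_vec N" using kkt_carrier v by (rule mult_mat_vec_carrier)
      have PMv: "mat_inv ?P *\<^sub>v (kkt_mat A B D *\<^sub>v v) \<in> carrier_vec N" using i(1) Mv by (rule mult_mat_vec_carrier)
      have "G \<beta> *\<^sub>v v = 1\<^sub>m N *\<^sub>v v + - (mat_inv ?P *\<^sub>v (kkt_mat A B D *\<^sub>v v))"
        unfolding G_eq using v i(1) kkt_carrier PMv
        by (subst minus_mult_distrib_mat_vec[of _ N N]) (auto intro!: eq_vecI)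
      also have "vec_norm2 \<dots> \<le> vec_norm2 (1\<^sub>m N *\<^sub>v v) + vec_norm2 (mat_inv ?P *\<^sub>v (kkt_mat A B D *\<^sub>v v))"
        using vec_norm2_triangle[of "1\<^sub>m N *\<^sub>v v" N "- (mat_inv ?P *\<^sub>v (kkt_mat A B D *\<^sub>v v))"] v PMv by simp
      also have "\<dots> \<le> mat_norm2 (1\<^sub>m N :: real mat) * vec_norm2 v + C2 * (mat_norm2 (kkt_mat A B D) * vec_norm2 v)"
      proof (rule add_mono)
        show "vec_norm2 (1\<^sub>m N *\<^sub>v v) \<le> mat_norm2 (1\<^sub>m N :: real mat) * vec_norm2 v"
          by (rule vec_norm2_mult_le[OF one_carrier_mat v])
        have "vec_norm2 (mat_inv ?P *\<^sub>v (kkt_mat A B D *\<^sub>v v)) \<le> mat_norm2 (mat_inv ?P) * vec_norm2 (kkt_mat A B D *\<^sub>v v)"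
          by (rule vec_norm2_mult_le[OF i(1) Mv])
        also have "\<dots> \<le> C2 * (mat_norm2 (kkt_mat A B D) * vec_norm2 v)"
          using C2[OF b] C2_nonneg by (intro mult_mono vec_norm2_mult_le[OF kkt_carrier v]) auto
        finally show "vec_norm2 (mat_inv ?P *\<^sub>v (kkt_mat A B D *\<^sub>v v)) \<le> C2 * (mat_norm2 (kkt_mat A B D) * vec_norm2 v)" .
      qed
      finally show "vec_norm2 (G \<beta> *\<^sub>v v) \<le> C3 * vec_norm2 v" by (simp add: C3_def algebra_simps)
    qed
  qed
  thus ?thesis by (intro exI[of _ "max (C1 * C2) C3"]) (auto simp: le_max_iff_disj)
qed

text \<open>(B^T B)^-1 B^T is a left inverse of B; its norm can be taken for L.\<close>

lemma B_lower: "\<exists>L \<ge> 0. \<forall>z \<in> carrier_vec nz. vec_norm2 z \<le> L * vec_norm2 (B *\<^sub>v z)"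
proof (intro exI conjI ballI)
  have BB: "B\<^sup>T * B \<in> carrier_mat nz nz" using B by simp
  have Lc: "mat_inv (B\<^sup>T * B) * B\<^sup>T \<in> carrier_mat nz ny" using mat_inv_det(1)[OF BB BtB] B by simp
  show "0 \<le> mat_norm2 (mat_inv (B\<^sup>T * B) * B\<^sup>T)" by simp
  fix z :: "real vec" assume z: "z \<in> carrier_vec nz"
  have Bt: "B\<^sup>T \<in> carrier_mat nz ny" and Bz: "B *\<^sub>v z \<in> carrier_vec ny" using B z by simp_all
  have "(mat_inv (B\<^sup>T * B) * B\<^sup>T) *\<^sub>v (B *\<^sub>v z) = mat_inv (B\<^sup>T * B) *\<^sub>v ((B\<^sup>T * B) *\<^sub>v z)"
    using assoc_mult_mat_vec[OF mat_inv_det(1)[OF BB BtB] Bt Bz] assoc_mult_mat_vec[OF Bt B z] by simp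
  also have "\<dots> = z" by (rule mat_inv_cancel(2)[OF BB BtB z])
  finally show "vec_norm2 z \<le> mat_norm2 (mat_inv (B\<^sup>T * B) * B\<^sup>T) * vec_norm2 (B *\<^sub>v z)"
    using vec_norm2_mult_le[OF Lc Bz] by simp
qed

end

context admm_scaling
begin

text \<open>The bound must hold for all QR decompositions at once, so continuity in \<beta> for a
  fixed R would not suffice. As |R z| = |B z|, it can be given in terms of B: the first factor
  dominates the block norms \<beta>, \<beta> |B| and 1, the second those of the inverse, 1/\<beta>,
  L/\<beta> and 1.\<close>

lemma scaling_uniform_bound:
  assumes b: "m \<le> \<beta>" "\<beta> \<le> l"
    and L: "0 \<le> L" "\<And>z. z \<in> carrier_vec nz \<Longrightarrow> vec_norm2 z \<le> L * vec_norm2 (B *\<^sub>v z)"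
  shows "cond2 Sc \<le> (1 + l + l * mat_norm2 B) * (1 + 1 / m + L / m)"
proof -
  have l: "0 < l" using b beta by simp
  define C where "C = 1 + l + l * mat_norm2 B"
  define c where "c = 1 + 1 / m + L / m"
  have C: "0 \<le> C" "1 \<le> C" "\<beta> \<le> C" "\<beta> * mat_norm2 B \<le> C"
  proof -
    have lB: "0 \<le> l * mat_norm2 B" using l by simp
    show "0 \<le> C" "1 \<le> C" "\<beta> \<le> C" using l b lB unfolding C_def by linarith+
    show "\<beta> * mat_norm2 B \<le> C"
      using l mult_right_mono[OF b(2) mat_norm2_nonneg[of B]] unfolding C_def by linarith
  qed
  have c: "0 \<le> c" "1 \<le> c" "1 / m \<le> c" "L / m \<le> c" using m_pos L(1) by (auto simp: c_def)
  have 1: "mat_norm2 Sc \<le> C"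
  proof (rule mat_norm2_le[OF scaling_carrier C(1)])
    fix v :: "real vec" assume "v \<in> carrier_vec (nx + (nz + (np + nz)))"
    then obtain x z p q where e: "v = x @\<^sub>v z @\<^sub>v p @\<^sub>v q" and cc: "x \<in> carrier_vec nx" "z \<in> carrier_vec nz"
      "p \<in> carrier_vec np" "q \<in> carrier_vec nz" using scaling_split by blast
    have "\<beta> * vec_norm2 x \<le> C * vec_norm2 x" "1 * vec_norm2 p \<le> C * vec_norm2 p" "1 * vec_norm2 q \<le> C * vec_norm2 q"
      using C by (intro mult_right_mono; simp)+
    moreover have "\<beta> * vec_norm2 (B *\<^sub>v z) \<le> C * vec_norm2 z"
    proof -
      have "\<beta> * vec_norm2 (B *\<^sub>v z) \<le> \<beta> * (mat_norm2 B * vec_norm2 z)"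
        using vec_norm2_mult_le[OF B cc(2)] beta by (intro mult_left_mono) auto
      also have "\<dots> \<le> C * vec_norm2 z" using mult_right_mono[OF C(4), of "vec_norm2 z"] by simp
      finally show ?thesis .
    qed
    ultimately have "(\<beta> * vec_norm2 x)\<^sup>2 + (\<beta> * vec_norm2 (B *\<^sub>v z))\<^sup>2 + (1 * vec_norm2 p)\<^sup>2 + (1 * vec_norm2 q)\<^sup>2
      \<le> (C * vec_norm2 x)\<^sup>2 + (C * vec_norm2 z)\<^sup>2 + (C * vec_norm2 p)\<^sup>2 + (C * vec_norm2 q)\<^sup>2"
      using beta by (intro add_mono power_mono) auto
    hence "(vec_norm2 (Sc *\<^sub>v v))\<^sup>2 \<le> (C * vec_norm2 v)\<^sup>2"
      unfolding e scaling_norm[OF cc] by (simp add: power_mult_distrib vec_norm2_append algebra_simps)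
    thus "vec_norm2 (Sc *\<^sub>v v) \<le> C * vec_norm2 v" by (rule power2_le_imp_le) (simp add: C)
  qed
  have 2: "mat_norm2 (mat_inv Sc) \<le> c"
  proof (rule mat_norm2_le[OF mat_inv_det(1)[OF scaling_carrier scaling_det] c(1)])
    fix w :: "real vec" assume w: "w \<in> carrier_vec (nx + (nz + (np + nz)))"
    define v where "v = mat_inv Sc *\<^sub>v w"
    have v: "v \<in> carrier_vec (nx + (nz + (np + nz)))" unfolding v_def
      by (rule mult_mat_vec_carrier[OF mat_inv_det(1)[OF scaling_carrier scaling_det] w])
    have Sv: "Sc *\<^sub>v v = w" unfolding v_def by (rule mat_inv_cancel(1)[OF scaling_carrier scaling_det w])
    obtain x z p q where e: "v = x @\<^sub>v z @\<^sub>v p @\<^sub>v q" and cc: "x \<in> carrier_vec nx" "z \<in> carrier_vec nz"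
      "p \<in> carrier_vec np" "q \<in> carrier_vec nz" using scaling_split[OF v] .
    have bm: "1 \<le> \<beta> / m" using b m_pos by simp
    have "1 * vec_norm2 p \<le> c * vec_norm2 p" "1 * vec_norm2 q \<le> c * vec_norm2 q"
      using c by (intro mult_right_mono; simp)+
    moreover have "vec_norm2 x \<le> c * (\<beta> * vec_norm2 x)"
    proof -
      have "1 * vec_norm2 x \<le> \<beta> / m * vec_norm2 x" using bm by (intro mult_right_mono) auto
      also have "\<dots> = 1 / m * (\<beta> * vec_norm2 x)" by simp
      also have "\<dots> \<le> c * (\<beta> * vec_norm2 x)" using c beta by (intro mult_right_mono) auto
      finally show ?thesis by simp
    qed
    moreover have "vec_norm2 z \<le> c * (\<beta> * vec_norm2 (B *\<^sub>v z))"
    proof -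
      have "vec_norm2 z \<le> 1 * (L * vec_norm2 (B *\<^sub>v z))" using L(2)[OF cc(2)] by simp
      also have "\<dots> \<le> \<beta> / m * (L * vec_norm2 (B *\<^sub>v z))" using bm L(1) by (intro mult_right_mono) auto
      also have "\<dots> = L / m * (\<beta> * vec_norm2 (B *\<^sub>v z))" by simp
      also have "\<dots> \<le> c * (\<beta> * vec_norm2 (B *\<^sub>v z))" using c beta by (intro mult_right_mono) auto
      finally show ?thesis .
    qed
    ultimately have "(vec_norm2 x)\<^sup>2 + (vec_norm2 z)\<^sup>2 + (1 * vec_norm2 p)\<^sup>2 + (1 * vec_norm2 q)\<^sup>2
      \<le> (c * (\<beta> * vec_norm2 x))\<^sup>2 + (c * (\<beta> * vec_norm2 (B *\<^sub>v z)))\<^sup>2 + (c * vec_norm2 p)\<^sup>2 + (c * vec_norm2 q)\<^sup>2"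
      by (intro add_mono power_mono) auto
    also have "\<dots> = (c * vec_norm2 w)\<^sup>2"
      unfolding Sv[symmetric] e power_mult_distrib[of c] scaling_norm[OF cc]
      by (simp add: power_mult_distrib algebra_simps)
    finally have "(vec_norm2 v)\<^sup>2 \<le> (c * vec_norm2 w)\<^sup>2" by (simp add: e vec_norm2_append)
    hence "vec_norm2 v \<le> c * vec_norm2 w" by (rule power2_le_imp_le) (simp add: c)
    thus "vec_norm2 (mat_inv Sc *\<^sub>v w) \<le> c * vec_norm2 w" by (simp add: v_def)
  qed
  show ?thesis unfolding cond2_def C_def[symmetric] c_def[symmetric] using 1 2 C by (intro mult_mono) auto
qed

end


theorem theorem9:
  fixes nx ny nz :: nat
    and A B D :: "real mat"
    and m l \<kappa> :: real
  assumes "0 < nx" and "0 < ny" and "0 < nz"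
    and "A \<in> carrier_mat ny nx" and "invertible_mat (A * A\<^sup>T)"
    and "B \<in> carrier_mat ny nz" and "invertible_mat (B\<^sup>T * B)"
    and "D \<in> carrier_mat nx nx" and "sym_pos_def D"
    and "m = lambda_min (D_tilde A D)"
    and "l = lambda_max (D_tilde A D)"
    and "\<kappa> = l / m"
  shows
    "(\<forall>\<beta> Q R P X \<Lambda> r u0 k u.
        0 < \<beta> \<and> m \<le> \<beta> \<and> \<beta> \<le> l \<and>
        qr_decomposition B Q R \<and> orthogonal_completion Q P \<and>
        eigendecomposition (map_mat complex_of_real (K_mat A D Q P \<beta>)) X \<Lambda> \<and>
        r \<in> carrier_vec (nx + nz + ny) \<and> u0 \<in> carrier_vec (nx + nz + ny) \<and>
        kkt_mat A B D *\<^sub>v u0 \<noteq> r \<and> 1 \<le> k \<and>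
        (gmres_left_iterate (admm_precond A B D \<beta>) (kkt_mat A B D) r u0 k u \<or>
         gmres_right_iterate (admm_precond A B D \<beta>) (kkt_mat A B D) r u0 k u)
        \<longrightarrow>
        vec_norm2 (kkt_mat A B D *\<^sub>v u - r) / vec_norm2 (kkt_mat A B D *\<^sub>v u0 - r)
          \<le> 2 * c1_factor A B D R \<beta> * cond2 (admm_precond A B D \<beta>) * cond2 X
            * (\<kappa> powr (2 / 3) / (\<kappa> powr (2 / 3) + 1)) powr (0.209 * real k))
     \<and>
     (\<exists>p1 p2 :: real poly. \<forall>\<beta>. 0 < \<beta> \<and> m \<le> \<beta> \<and> \<beta> \<le> l \<longrightarrow>
        (\<forall>Q R. qr_decomposition B Q R \<longrightarrow> c1_factor A B D R \<beta> \<le> poly p1 \<beta>) \<and>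
        cond2 (admm_precond A B D \<beta>) \<le> poly p2 \<beta>)"
proof -
  have AAt: "det (A * A\<^sup>T) \<noteq> 0" using assms(4,5) invertible_mat_det[of "A * A\<^sup>T" ny] by simp
  have BtB: "det (B\<^sup>T * B) \<noteq> 0" using assms(6,7) invertible_mat_det[of "B\<^sup>T * B" nz] by simp
  interpret adm: admm A B D nx ny nz
    using assms AAt BtB by unfold_locales auto
  let ?M = "kkt_mat A B D"
  have bound: "vec_norm2 (?M *\<^sub>v u - r) / vec_norm2 (?M *\<^sub>v u0 - r)
      \<le> 2 * c1_factor A B D R \<beta> * cond2 (admm_precond A B D \<beta>) * cond2 X
        * (\<kappa> powr (2 / 3) / (\<kappa> powr (2 / 3) + 1)) powr (0.209 * real k)"
    if \<beta>: "m \<le> \<beta>" "\<beta> \<le> l" and QR: "qr_decomposition B Q R" and P: "orthogonal_completion Q P"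
      and eig: "eigendecomposition (map_mat complex_of_real (K_mat A D Q P \<beta>)) X \<Lambda>"
      and r: "r \<in> carrier_vec (nx + nz + ny)" and u0: "u0 \<in> carrier_vec (nx + nz + ny)"
      and ne: "?M *\<^sub>v u0 \<noteq> r" and k: "1 \<le> k"
      and u: "gmres_left_iterate (admm_precond A B D \<beta>) ?M r u0 k u \<or>
        gmres_right_iterate (admm_precond A B D \<beta>) ?M r u0 k u" for \<beta> Q R P X \<Lambda> r u0 k u
  proof -
    interpret sp: admm_split A B D nx ny nz Q R P \<beta>
      using QR P \<beta> assms(10,11) by unfold_locales auto
    have rc: "r \<in> carrier_vec (nx + (nz + ny))" "u0 \<in> carrier_vec (nx + (nz + ny))"
      using r u0 by (simp_all add: add.assoc)
    have Mu: "?M *\<^sub>v u0 \<in> carrier_vec (nx + (nz + ny))"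
      using adm.kkt_carrier rc(2) by (rule mult_mat_vec_carrier)
    have "?M *\<^sub>v u0 - r \<noteq> 0\<^sub>v (nx + (nz + ny))"
    proof
      assume z: "?M *\<^sub>v u0 - r = 0\<^sub>v (nx + (nz + ny))"
      have "?M *\<^sub>v u0 = (?M *\<^sub>v u0 - r) + r" using Mu rc(1) carrier_matD[OF adm.kkt_carrier] by (intro eq_vecI) auto
      also have "\<dots> = r" unfolding z using rc(1) by simp
      finally show False using ne by simp
    qed
    hence pos: "0 < vec_norm2 (?M *\<^sub>v u0 - r)" using Mu rc(1) by (intro vec_norm2_pos) auto
    show ?thesis
      using sp.gmres_bound[OF eig rc k u] pos assms(10,11,12) by (simp add: pos_divide_le_eq)
  qed
  obtain C where C: "\<And>\<beta>. m \<le> \<beta> \<Longrightarrow> \<beta> \<le> l \<Longrightarrow> cond2 (admm_precond A B D \<beta>) \<le> C"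
    "\<And>\<beta>. m \<le> \<beta> \<Longrightarrow> \<beta> \<le> l \<Longrightarrow> mat_norm2 (admm_iter_mat A B D \<beta>) \<le> C"
    using adm.precond_uniform_bound assms(10,11) by (auto simp: adm.G_def)
  obtain L where L: "0 \<le> L" "\<And>z. z \<in> carrier_vec nz \<Longrightarrow> vec_norm2 z \<le> L * vec_norm2 (B *\<^sub>v z)"
    using adm.B_lower by blast
  define C' where "C' = (1 + l + l * mat_norm2 B) * (1 + 1 / m + L / m)"
  have c1: "c1_factor A B D R \<beta> \<le> C' * C\<^sup>2"
    if \<beta>: "0 < \<beta>" "m \<le> \<beta>" "\<beta> \<le> l" and QR: "qr_decomposition B Q R" for \<beta> Q R
  proof -
    have q: "Q \<in> carrier_mat ny nz" "R \<in> carrier_mat nz nz" "orthonormal_cols Q" "B = Q * R"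
      using QR assms(6) by (auto simp: qr_decomposition_def)
    have "vec_norm2 (R *\<^sub>v z) = vec_norm2 (B *\<^sub>v z)" if z: "z \<in> carrier_vec nz" for z
      using orthonormal_cols_norm[OF q(1,3), of "R *\<^sub>v z"] q(1,2,4) z by simp
    then interpret sc: admm_scaling A B D nx ny nz R \<beta>
      using q \<beta> by unfold_locales auto
    have le: "cond2 (scaling_mat A B R \<beta>) \<le> C'"
      using sc.scaling_uniform_bound[OF _ _ L] \<beta> by (simp add: C'_def assms(10,11))
    moreover have "0 \<le> C'" using le sc.scaling_cond_ge_1 by linarith
    ultimately show ?thesis
      unfolding c1_factor_def using C(2)[OF \<beta>(2,3)] by (intro mult_mono power_mono) auto
  qed
  have "\<exists>p1 p2 :: real poly. \<forall>\<beta>. 0 < \<beta> \<and> m \<le> \<beta> \<and> \<beta> \<le> l \<longrightarrow>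
        (\<forall>Q R. qr_decomposition B Q R \<longrightarrow> c1_factor A B D R \<beta> \<le> poly p1 \<beta>) \<and>
        cond2 (admm_precond A B D \<beta>) \<le> poly p2 \<beta>"
    by (rule exI[of _ "[:C' * C\<^sup>2:]"], rule exI[of _ "[:C:]"]) (use c1 C(1) in auto)
  with bound show ?thesis by blast
qed

end
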